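(* Let $U\in\mathcal{C}^3(\mathbb{R}^d)$ have a global minimum at $0$ with $U(0)=0$, and suppose $L:=\sup\|D^2U\|<\infty$ and $L_H:=\sup\|D^3U\|<\infty$. Let $T>0$ and $h\ge0$ satisfy $L(T^2+Th)\le1/6$ and, if $h>0$, $T/h\in\mathbb{N}$. Let $\tilde\pi$ be the transition kernel of unadjusted Hamiltonian Monte Carlo with duration $T$ and step size $h$. Then for any probability measures $\nu,\eta$ on $\mathbb{R}^d$, $$\mathrm{TV}(\eta\tilde\pi,\nu\tilde\pi)\ \le\ \tfrac32\left(T^{-2}+27\,d\,L_H^2\,T^4\right)^{1/2}W^1(\eta,\nu).$$
   Context: $|\cdot|$ is the Euclidean norm and $\|\cdot\|$ the operator norm of a multilinear form (supremum over unit vectors in each argument). Velocity Verlet: for $h>0$ let $\lfloor t\rfloor_h=\max\{s\in h\mathbb{Z}:s\le t\}$ and $\lceil t\rceil_h=\min\{s\in h\mathbb{Z}:s\ge t\}$; for $h=0$, $\lfloor t\rfloor_h=\lceil t\rceil_h=t$. For $(x,v)\in\mathbb{R}^{2d}$, $(\tilde q_t(x,v),\tilde v_t(x,v))_{t\ge0}$ is the continuous, piecewise differentiable solution of $$\tfrac{d}{dt}\tilde q_t=\tilde v_{\lfloor t\rfloor_h}-(t-\lfloor t\rfloor_h)\nabla U(\tilde q_{\lfloor t\rfloor_h}),\qquad \tfrac{d}{dt}\tilde v_t=-\tfrac12\left(\nabla U(\tilde q_{\lfloor t\rfloor_h})+\nabla U(\tilde q_{\lceil t\rceil_h})\right)$$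 with $(\tilde q_0,\tilde v_0)=(x,v)$ (for $h=0$ this is the exact Hamiltonian flow $\dot q=v$, $\dot v=-\nabla U(q)$). The uHMC kernel is $\tilde\pi(x,A)=P[\tilde q_T(x,\xi)\in A]$ with $\xi\sim\mathcal N(0,I_d)$; $\nu\tilde\pi(A)=\int\nu(dx)\tilde\pi(x,A)$. $\mathrm{TV}(\nu,\eta)=\sup_A|\nu(A)-\eta(A)|$ over Borel sets $A$. $W^1(\nu,\eta)=\inf E[|X-Y|]$ over all couplings $(X,Y)$ of $\nu,\eta$ (possibly $+\infty$). *)

theory Defs
  imports "HOL-Analysis.Analysis" "HOL-Probability.Probability"
begin

text \<open>
  \<open>C_k k f\<close>: \<open>f\<close> is \<open>k\<close> times continuously differentiable on the whole space, expressed by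
  iterated directional derivatives (in finite dimension, continuity of all \<open>k\<close>-fold ones amounts
  to continuity of the \<open>k\<close>-th derivative as a multilinear form).
\<close>

primrec C_k :: "nat \<Rightarrow> ('a::euclidean_space \<Rightarrow> real) \<Rightarrow> bool" where
  "C_k 0 f \<longleftrightarrow> continuous_on UNIV f"
| "C_k (Suc k) f \<longleftrightarrow>
     (\<forall>x. f differentiable (at x)) \<and> (\<forall>u. C_k k (\<lambda>x. frechet_derivative f (at x) u))"

definition grad :: "('a::euclidean_space \<Rightarrow> real) \<Rightarrow> 'a \<Rightarrow> 'a" where
  "grad U x = (THE g. GDERIV U x :> g)"

definition D2 :: "('a::euclidean_space \<Rightarrow> real) \<Rightarrow> 'a \<Rightarrow> 'a \<Rightarrow> 'a \<Rightarrow> real" where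
  "D2 U x u v = frechet_derivative (\<lambda>y. frechet_derivative U (at y) u) (at x) v"

definition D3 :: "('a::euclidean_space \<Rightarrow> real) \<Rightarrow> 'a \<Rightarrow> 'a \<Rightarrow> 'a \<Rightarrow> 'a \<Rightarrow> real" where
  "D3 U x u v w = frechet_derivative (\<lambda>y. D2 U y u v) (at x) w"

definition opnorm2 :: "('a::euclidean_space \<Rightarrow> 'a \<Rightarrow> real) \<Rightarrow> real" where
  "opnorm2 B = Sup {\<bar>B u v\<bar> | u v. norm u = 1 \<and> norm v = 1}"

definition opnorm3 :: "('a::euclidean_space \<Rightarrow> 'a \<Rightarrow> 'a \<Rightarrow> real) \<Rightarrow> real" where
  "opnorm3 B = Sup {\<bar>B u v w\<bar> | u v w. norm u = 1 \<and> norm v = 1 \<and> norm w = 1}"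

definition grid :: "real \<Rightarrow> real set" where
  "grid h = range (\<lambda>k::int. h * of_int k)"

definition floor_h :: "real \<Rightarrow> real \<Rightarrow> real" where
  "floor_h h t = (if h = 0 then t else (GREATEST s. s \<in> grid h \<and> s \<le> t))"

definition ceil_h :: "real \<Rightarrow> real \<Rightarrow> real" where
  "ceil_h h t = (if h = 0 then t else (LEAST s. s \<in> grid h \<and> t \<le> s))"

lemma floor_h_pos: "h > 0 \<Longrightarrow> floor_h h t = h * of_int \<lfloor>t / h\<rfloor>"
  unfolding floor_h_def grid_def
  by (auto intro!: Greatest_equality simp: le_floor_iff field_simps)
     (metis floor_divide_lower mult.commute)

lemma ceil_h_pos: "h > 0 \<Longrightarrow> ceil_h h t = h * of_int \<lceil>t / h\<rceil>"
  unfolding ceil_h_def grid_def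
  by (auto intro!: Least_equality simp: ceiling_le_iff field_simps)
     (metis ceiling_divide_upper mult.commute)

text \<open>
  For \<open>h > 0\<close> the differential equation is required off the grid, since the velocity has
  kinks at the grid points; for \<open>h = 0\<close> it is required at every \<open>t \<ge> 0\<close> (one-sidedly at \<open>0\<close>).
\<close>

definition verlet_solution ::
  "('a::euclidean_space \<Rightarrow> real) \<Rightarrow> real \<Rightarrow> 'a \<Rightarrow> 'a \<Rightarrow> (real \<Rightarrow> 'a) \<Rightarrow> (real \<Rightarrow> 'a) \<Rightarrow> bool" where
  "verlet_solution U h x v q w \<longleftrightarrow>
     q 0 = x \<and> w 0 = v \<and> continuous_on {0..} q \<and> continuous_on {0..} w \<and>
     (\<forall>t\<ge>0. h = 0 \<or> t \<notin> grid h \<longrightarrow>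
        (q has_vector_derivative
           (w (floor_h h t) - (t - floor_h h t) *\<^sub>R grad U (q (floor_h h t)))) (at t within {0..}) \<and>
        (w has_vector_derivative
           (- (1/2) *\<^sub>R (grad U (q (floor_h h t)) + grad U (q (ceil_h h t))))) (at t within {0..}))"

text \<open>
  The solution is unique only on \<open>{0..}\<close>, so the description operator selects its value at time
  \<open>t\<close> rather than the function.
\<close>

definition verlet_pos ::
  "('a::euclidean_space \<Rightarrow> real) \<Rightarrow> real \<Rightarrow> real \<Rightarrow> 'a \<Rightarrow> 'a \<Rightarrow> 'a" where
  "verlet_pos U h t x v = (THE y. \<exists>q w. verlet_solution U h x v q w \<and> q t = y)"

definition std_gaussian :: "'a::euclidean_space measure" where
  "std_gaussian =
     density lborel (\<lambda>x. ennreal (exp (- (norm x)\<^sup>2 / 2) / sqrt (2 * pi) ^ DIM('a)))"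

definition uHMC :: "('a::euclidean_space \<Rightarrow> real) \<Rightarrow> real \<Rightarrow> real \<Rightarrow> 'a \<Rightarrow> 'a measure" where
  "uHMC U T h x = distr std_gaussian borel (\<lambda>v. verlet_pos U h T x v)"

definition TV :: "'a::topological_space measure \<Rightarrow> 'a measure \<Rightarrow> real" where
  "TV \<mu> \<nu> = (SUP A\<in>sets borel. \<bar>measure \<mu> A - measure \<nu> A\<bar>)"

definition couplings ::
  "'a::euclidean_space measure \<Rightarrow> 'a measure \<Rightarrow> ('a \<times> 'a) measure set" where
  "couplings \<mu> \<nu> = {\<gamma>. prob_space \<gamma> \<and> sets \<gamma> = sets (borel \<Otimes>\<^sub>M borel) \<and>
     distr \<gamma> borel fst = \<mu> \<and> distr \<gamma> borel snd = \<nu>}"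

definition W1 :: "'a::euclidean_space measure \<Rightarrow> 'a measure \<Rightarrow> ennreal" where
  "W1 \<mu> \<nu> = (INF \<gamma>\<in>couplings \<mu> \<nu>. \<integral>\<^sup>+ p. ennreal (norm (fst p - snd p)) \<partial>\<gamma>)"

end

theory Submission imports Defs begin

text \<open>
  One-shot coupling. Given positions \<open>x\<close>, \<open>y\<close>, let \<open>\<Phi>\<close> send a velocity \<open>v\<close> to the velocity for which
  the path from \<open>y\<close> ends at the same point as the path from \<open>x\<close> with velocity \<open>v\<close>. Then the
  kernels at \<open>x\<close> and \<open>y\<close> differ in total variation by at most the distance between the standard
  Gaussian and its image under \<open>\<Phi>\<close>.

  Writing \<open>\<Phi> = id + R\<close>, change of variables gives the density ratio \<open>\<rho>\<close> of the two Gaussians, and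
  \<open>max 0 (1 - \<rho>) \<le> (\<rho> - 1 - ln \<rho>) / \<lambda> + \<lambda> / 2\<close> replaces Pinsker's inequality. Here \<open>ln \<rho>\<close> contains
  \<open>v \<bullet> R v\<close>, whose Gaussian mean is that of the trace of \<open>DR\<close> by integration by parts, and
  \<open>trace DR - ln det (1 + DR)\<close> is of second order in \<open>DR\<close>, which produces the factor \<open>d\<close> rather
  than \<open>d\<^sup>2\<close> under the root.

  Both the exact flow and the Verlet path solve \<open>q + K (\<nabla>U \<circ> q) = x + t v\<close> with \<open>K\<close> linear of norm
  at most \<open>T\<^sup>2\<close>, on a Banach space of paths, and fixing the endpoint instead of \<open>v\<close> replaces \<open>K\<close> by
  an operator of norm at most \<open>2 T\<^sup>2\<close>. Since \<open>L T\<^sup>2 \<le> 1/6\<close>, both equations are contractions, hence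
  uniquely solvable with differentiable solutions; the inverse of \<open>v \<mapsto> q T\<close> is read off the
  boundary value problem, and so are the bounds on \<open>R\<close> and \<open>DR\<close>.
\<close>

section \<open>Logarithmic determinants near the identity\<close>

text \<open>Total variation is at most 1, so with \<open>C\<close> the constant of the theorem and
  \<open>r = norm (x - y)\<close> only the case \<open>C * r < 1\<close> has content. There the
  bound on \<open>DR\<close>, of order \<open>T\<^sup>2 * L_H * r\<close>, is automatically below
  \<open>3/5\<close>. The logarithmic determinant is therefore expanded only near the identity, and
  neither \<open>L_H\<close> nor \<open>d\<close> has to be small.

  The relative entropy is quadratic in \<open>r\<close>. The choice \<open>\<lambda> = C * r\<close>
  makes each of the two terms in the substitute for Pinsker's inequality at most
  \<open>C * r / 2\<close>; the result is linear in \<open>r\<close>, as a bound by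
  \<open>W1\<close> requires.

  The two starting points are compared at a common endpoint. This makes \<open>DR\<close> a
  difference of derivatives of inverse velocity maps along two nearby paths, so that it carries a
  factor \<open>L_H * r\<close>.

  The constants \<open>3/2\<close> and \<open>27\<close> leave room: under the root, the estimates
  give \<open>25/16\<close> where the theorem has \<open>9/4\<close>, and \<open>6561/160\<close>
  where it has \<open>243/4\<close>.\<close>

lemma det_id_plus_has_derivative:
  fixes B :: "real^'n^'n"
  shows "((\<lambda>e. det (mat 1 + e *\<^sub>R B)) has_real_derivative trace B) (at 0)"
proof -
  let ?P = "{p. p permutes (UNIV :: 'n set)}"
  let ?m = "\<lambda>p e i. (mat 1 + e *\<^sub>R B) $ i $ p i"
  have d: "((\<lambda>e. \<Prod>i\<in>UNIV. ?m p e i) has_real_derivative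
      (\<Sum>i\<in>UNIV. B $ i $ p i * (\<Prod>j\<in>UNIV - {i}. mat 1 $ j $ p j))) (at 0)" for p
  proof -
    have "((\<lambda>e. ?m p e i) has_field_derivative B $ i $ p i) (at 0)" for i
      by (auto intro!: derivative_eq_intros)
    from has_field_derivative_prod[of UNIV "\<lambda>i e. ?m p e i", OF this]
    show ?thesis by simp
  qed
  have zero: "(\<Sum>i\<in>UNIV. B $ i $ p i * (\<Prod>j\<in>UNIV - {i}. mat 1 $ j $ p j))
      = (if p = id then trace B else 0)" if "p \<in> ?P" for p
  proof (cases "p = id")
    case True
    then show ?thesis by (simp add: trace_def mat_def)
  next
    case False
    then obtain k where k: "p k \<noteq> k" by (auto simp: fun_eq_iff)
    have inj: "inj p" using that by (auto intro: permutes_inj)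
    \<comment> \<open>A permutation other than the identity moves at least two points: along with
      \<open>k\<close> it moves \<open>p k\<close>. So a vanishing off-diagonal entry survives the
      removal of any one factor.\<close>
    have ex: "\<exists>j\<in>UNIV - {i}. p j \<noteq> j" for i
    proof (cases "i = k")
      case True
      then show ?thesis using k inj by (intro bexI[of _ "p k"]) (auto dest: injD)
    qed (use k in auto)
    have "(\<Prod>j\<in>UNIV - {i}. (mat 1 :: real^'n^'n) $ j $ p j) = 0" for i
    proof -
      obtain j where "j \<in> UNIV - {i}" "j \<noteq> p j" using ex[of i] by metis
      then show ?thesis by (intro prod_zero bexI[of _ j]) (simp_all add: mat_def)
    qed
    then show ?thesis using False by (simp only: mult_zero_right sum.neutral_const if_False)
  qed
  have "((\<lambda>e. \<Sum>p\<in>?P. of_int (sign p) * (\<Prod>i\<in>UNIV. ?m p e i)) has_real_derivative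
     (\<Sum>p\<in>?P. of_int (sign p) *
       (\<Sum>i\<in>UNIV. B $ i $ p i * (\<Prod>j\<in>UNIV - {i}. mat 1 $ j $ p j)))) (at 0)"
    by (intro DERIV_sum DERIV_cmult d)
  also have "(\<Sum>p\<in>?P. of_int (sign p) *
       (\<Sum>i\<in>UNIV. B $ i $ p i * (\<Prod>j\<in>UNIV - {i}. mat 1 $ j $ p j)))
      = (\<Sum>p\<in>?P. if p = id then trace B else 0)"
    by (intro sum.cong refl) (simp add: zero sign_id del: of_int_mult)
  also have "\<dots> = trace B"
    by (simp add: sum.delta[OF finite_permutations] permutes_id)
  finally show ?thesis by (simp add: det_def)
qed

lemma abs_trace_le:
  fixes M :: "real^'n^'n"
  assumes "\<And>x. norm (M *v x) \<le> b * norm x"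
  shows "\<bar>trace M\<bar> \<le> real CARD('n) * b"
proof -
  have "\<bar>M $ i $ i\<bar> \<le> b" for i
  proof -
    have "M $ i $ i = (M *v axis i 1) $ i"
      by (simp add: matrix_vector_mult_basis column_def)
    then have "\<bar>M $ i $ i\<bar> \<le> norm (M *v axis i 1)" using component_le_norm_cart by metis
    also have "\<dots> \<le> b" using assms[of "axis i 1"] by (simp add: norm_axis_1)
    finally show ?thesis .
  qed
  then have "(\<Sum>i\<in>UNIV. \<bar>M $ i $ i\<bar>) \<le> real CARD('n) * b"
    using sum_bounded_above[of "UNIV :: 'n set" "\<lambda>i. \<bar>M $ i $ i\<bar>" b] by simp
  then show ?thesis unfolding trace_def using sum_abs[of "\<lambda>i. M $ i $ i" UNIV] by linarith
qed

text \<open>Jacobi's formula along the segment: the derivative of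
  \<open>ln (det (mat 1 + s *\<^sub>R M))\<close> is \<open>trace (N ** M)\<close> with
  \<open>N\<close> the inverse of \<open>mat 1 + s *\<^sub>R M\<close>. Since
  \<open>N ** M = M - s *\<^sub>R (N ** M ** M)\<close> and \<open>N\<close> has norm at most
  \<open>1 / (1 - 3/5) = 5/2\<close>, this differs from \<open>trace M\<close> by at most
  \<open>s * d * (5/2) * a\<^sup>2\<close>, which integrates to the constant \<open>5/4\<close>.
  Each diagonal entry is bounded by the operator norm, hence the factor \<open>d\<close>.\<close>

lemma ln_det_id_plus_ge:
  fixes M :: "real^'n^'n"
  assumes M: "\<And>x. norm (M *v x) \<le> a * norm x" and a: "0 \<le> a" "a \<le> 3/5"
  shows "0 < det (mat 1 + M)"
    and "trace M - 5/4 * real CARD('n) * a\<^sup>2 \<le> ln (det (mat 1 + M))"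
proof -
  let ?f = "\<lambda>s. det (mat 1 + s *\<^sub>R M)"
  have mv: "(mat 1 + s *\<^sub>R M) *v x = x + s *\<^sub>R (M *v x)" for s x
    by (simp add: matrix_vector_mult_add_rdistrib scaleR_matrix_vector_assoc)
  have inv: "\<exists>N. N ** (mat 1 + s *\<^sub>R M) = mat 1 \<and> (mat 1 + s *\<^sub>R M) ** N = mat 1 \<and>
      (\<forall>x. norm (N *v x) \<le> 5/2 * norm x)" if s: "0 \<le> s" "s \<le> 1" for s
  proof -
    have low: "norm x * (2/5) \<le> norm ((mat 1 + s *\<^sub>R M) *v x)" for x
    proof -
      have "norm (s *\<^sub>R (M *v x)) \<le> 1 * (a * norm x)"
        unfolding norm_scaleR using M[of x] s by (intro mult_mono) auto
      also have "\<dots> \<le> 3/5 * norm x" using mult_right_mono[OF a(2) norm_ge_zero] by simp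
      finally show ?thesis unfolding mv using norm_triangle_ineq2[of x "- s *\<^sub>R (M *v x)"]
        by simp
    qed
    have "inj ((*v) (mat 1 + s *\<^sub>R M))"
    proof (rule injI)
      fix x y assume "(mat 1 + s *\<^sub>R M) *v x = (mat 1 + s *\<^sub>R M) *v y"
      then have "(mat 1 + s *\<^sub>R M) *v (x - y) = 0" by (simp add: matrix_vector_mult_diff_distrib)
      then show "x = y" using low[of "x - y"] by simp
    qed
    then obtain N where N: "N ** (mat 1 + s *\<^sub>R M) = mat 1"
      using matrix_left_invertible_injective[of "mat 1 + s *\<^sub>R M"] by (auto simp: inj_on_def)
    then have N2: "(mat 1 + s *\<^sub>R M) ** N = mat 1" using matrix_left_right_inverse by blast
    have "norm (N *v x) \<le> 5/2 * norm x" for x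
    proof -
      have "(mat 1 + s *\<^sub>R M) *v (N *v x) = x"
        by (simp add: matrix_vector_mul_assoc N2)
      then show ?thesis using low[of "N *v x"] by simp
    qed
    then show ?thesis using N N2 by blast
  qed
  have deriv: "\<exists>t. (?f has_real_derivative ?f s * t) (at s) \<and> ?f s \<noteq> 0 \<and>
      \<bar>t - trace M\<bar> \<le> s * (real CARD('n) * (5/2 * a\<^sup>2))" if s: "0 \<le> s" "s \<le> 1" for s
  proof -
    obtain N where N: "N ** (mat 1 + s *\<^sub>R M) = mat 1" "(mat 1 + s *\<^sub>R M) ** N = mat 1"
      and Nb: "\<And>x. norm (N *v x) \<le> 5/2 * norm x" using inv[OF s] by auto
    \<comment> \<open>Factoring out the matrix at \<open>s\<close> reduces the derivative at
      \<open>s\<close> to the derivative of the determinant at the identity.\<close>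
    have "mat 1 + e *\<^sub>R M = (mat 1 + s *\<^sub>R M) ** (mat 1 + (e - s) *\<^sub>R (N ** M))" for e
    proof -
      have "(mat 1 + s *\<^sub>R M) ** (mat 1 + (e - s) *\<^sub>R (N ** M))
          = (mat 1 + s *\<^sub>R M) + (e - s) *\<^sub>R ((mat 1 + s *\<^sub>R M) ** N ** M)"
        by (simp add: matrix_add_ldistrib matrix_scalar_ac matrix_mul_assoc scalar_matrix_assoc[symmetric])
      then show ?thesis by (simp add: N scaleR_diff_left)
    qed
    then have eq: "?f e = ?f s * det (mat 1 + (e - s) *\<^sub>R (N ** M))" for e
      by (metis det_mul)
    have "((\<lambda>e. det (mat 1 + (e - s) *\<^sub>R (N ** M))) has_real_derivative trace (N ** M)) (at s)"
      using DERIV_shift[of "\<lambda>e. det (mat 1 + e *\<^sub>R (N ** M))" "trace (N ** M)" s "- s"]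
        det_id_plus_has_derivative[of "N ** M"] by simp
    then have d: "(?f has_real_derivative ?f s * trace (N ** M)) (at s)"
      by (subst eq) (rule DERIV_cmult)
    have nz: "?f s \<noteq> 0"
      using N invertible_det_nz[of "mat 1 + s *\<^sub>R M"] unfolding invertible_def by blast
    have "N + s *\<^sub>R (N ** M) = mat 1"
      using N(1) by (simp add: matrix_add_ldistrib matrix_scalar_ac scalar_matrix_assoc[symmetric])
    then have "(N + s *\<^sub>R (N ** M)) ** M = M" by simp
    then have "N ** M + s *\<^sub>R (N ** M ** M) = M"
      by (simp add: matrix_eq matrix_vector_mul_assoc[symmetric] matrix_vector_mult_add_rdistrib
          scaleR_matrix_vector_assoc[symmetric])
    then have "N ** M = M - s *\<^sub>R (N ** M ** M)" by (metis add_diff_cancel_right')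
    then have "trace (N ** M) = trace (M - s *\<^sub>R (N ** M ** M))" by simp
    then have "trace (N ** M) - trace M = - (s * trace (N ** M ** M))"
      by (simp add: trace_def sum_subtractf sum_distrib_left)
    then have "\<bar>trace (N ** M) - trace M\<bar> = s * \<bar>trace (N ** M ** M)\<bar>"
      using s by (simp add: abs_mult)
    also have "\<dots> \<le> s * (real CARD('n) * (5/2 * a\<^sup>2))"
    proof (intro mult_left_mono abs_trace_le s)
      fix x
      have "norm ((N ** M ** M) *v x) \<le> 5/2 * norm (M *v (M *v x))"
        using Nb by (simp add: matrix_vector_mul_assoc[symmetric])
      also have "\<dots> \<le> 5/2 * (a * (a * norm x))"
        using M[of "M *v x"] mult_left_mono[OF M[of x] a(1)] by linarith
      finally show "norm ((N ** M ** M) *v x) \<le> 5/2 * a\<^sup>2 * norm x"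
        by (simp add: power2_eq_square mult.assoc)
    qed
    finally show ?thesis using d nz by blast
  qed
  have cont: "continuous_on {0..1} ?f"
    using deriv by (intro continuous_at_imp_continuous_on ballI) (meson atLeastAtMost_iff DERIV_isCont)
  \<comment> \<open>The determinant starts at 1, is continuous and never vanishes on the
    segment.\<close>
  have pos: "0 < ?f s" if s: "0 \<le> s" "s \<le> 1" for s
  proof (rule ccontr)
    assume "\<not> 0 < ?f s"
    then have "\<exists>r. 0 \<le> r \<and> r \<le> s \<and> ?f r = 0"
      using s by (intro IVT2') (auto intro: continuous_on_subset[OF cont])
    then show False using deriv s by force
  qed
  show p1: "0 < det (mat 1 + M)" using pos[of 1] by simp
  obtain t where t: "\<And>s. 0 \<le> s \<Longrightarrow> s \<le> 1 \<Longrightarrow> (?f has_real_derivative ?f s * t s) (at s)"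
    "\<And>s. 0 \<le> s \<Longrightarrow> s \<le> 1 \<Longrightarrow> \<bar>t s - trace M\<bar> \<le> s * (real CARD('n) * (5/2 * a\<^sup>2))"
    using deriv by metis
  \<comment> \<open>The quadratic term has exactly the derivative that absorbs the error in
    \<open>t s\<close>, so \<open>?g\<close> is nondecreasing; it starts at 0.\<close>
  let ?g = "\<lambda>s. ln (?f s) - s * trace M + s\<^sup>2 * (5/4 * real CARD('n) * a\<^sup>2)"
  have "?g 0 \<le> ?g 1"
  proof (rule DERIV_nonneg_imp_nondecreasing[of 0 1 ?g])
    fix s :: real assume s: "0 \<le> s" "s \<le> 1"
    have "(?g has_real_derivative
        (?f s * t s) / ?f s - trace M + 2 * s * (5/4 * real CARD('n) * a\<^sup>2)) (at s)"
      using pos[OF s] by (auto intro!: derivative_eq_intros t(1)[OF s] simp: field_simps)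
    moreover have "0 \<le> (?f s * t s) / ?f s - trace M + 2 * s * (5/4 * real CARD('n) * a\<^sup>2)"
    proof -
      have "trace M - t s \<le> s * (real CARD('n) * (5/2 * a\<^sup>2))" using t(2)[OF s] by linarith
      then show ?thesis using pos[OF s] by (simp add: field_simps)
    qed
    ultimately show "\<exists>y. (?g has_real_derivative y) (at s) \<and> 0 \<le> y" by blast
  qed simp
  then show "trace M - 5/4 * real CARD('n) * a\<^sup>2 \<le> ln (det (mat 1 + M))" by simp
qed

section \<open>Gaussian measures\<close>

definition gauss :: "'a::euclidean_space \<Rightarrow> real" where
  "gauss x = exp (- (norm x)\<^sup>2 / 2) / sqrt (2 * pi) ^ DIM('a)"

text \<open>Two values of \<open>c\<close> matter: \<open>1/2\<close> normalizes
  \<open>gauss\<close>, and \<open>1/8\<close> yields the dominating function in the integration by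
  parts.\<close>

lemma nn_integral_exp_neg_norm_sq:
  fixes c :: real assumes c: "0 < c"
  shows "(\<integral>\<^sup>+(x::'a::euclidean_space). ennreal (exp (- c * (norm x)\<^sup>2)) \<partial>lborel)
    = ennreal (sqrt (pi / c) ^ DIM('a))"
proof -
  define s where "s = sqrt (1 / (2 * c))"
  have s: "s > 0" and s2: "s\<^sup>2 = 1 / (2 * c)" using c by (auto simp: s_def)
  have one: "(\<integral>\<^sup>+(t::real). ennreal (exp (- c * t\<^sup>2)) \<partial>lborel) = ennreal (sqrt (pi / c))"
  proof -
    have eq: "exp (- c * t\<^sup>2) = sqrt (pi / c) * normal_density 0 s t" for t
      using c by (simp add: normal_density_def s2 field_simps)
    have "(\<integral>\<^sup>+(t::real). ennreal (normal_density 0 s t) \<partial>lborel) = 1"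
      by (subst nn_integral_eq_integral)
        (use integral_normal_density[of s 0] integrable_normal_density[of s 0] s in auto)
    then show ?thesis unfolding eq using c
      by (simp add: ennreal_mult nn_integral_cmult)
  qed
  have "(norm x)\<^sup>2 = (\<Sum>b\<in>Basis. (x \<bullet> b)\<^sup>2)" for x :: 'a
    by (simp add: norm_eq_sqrt_inner euclidean_inner[of x x] power2_eq_square sum_nonneg)
  then have "ennreal (exp (- c * (norm x)\<^sup>2)) = (\<Prod>b\<in>Basis. ennreal (exp (- c * (x \<bullet> b)\<^sup>2)))" for x :: 'a
    by (simp add: sum_distrib_left exp_sum prod_ennreal sum_negf[symmetric] del: sum_negf)
  then have "(\<integral>\<^sup>+(x::'a). ennreal (exp (- c * (norm x)\<^sup>2)) \<partial>lborel)
     = (\<Prod>b\<in>(Basis::'a set). (\<integral>\<^sup>+t. ennreal (exp (- c * t\<^sup>2)) \<partial>lborel))"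
    using nn_integral_lborel_prod[of "\<lambda>(b::'a) t. ennreal (exp (- c * t\<^sup>2))"] by simp
  then show ?thesis using c unfolding one by (simp add: ennreal_power)
qed

lemma integrable_exp_neg_norm_sq:
  fixes c :: real assumes c: "0 < c"
  shows "integrable lborel (\<lambda>x::'a::euclidean_space. exp (- c * (norm x)\<^sup>2))"
  by (rule integrableI_bounded) (simp_all add: nn_integral_exp_neg_norm_sq[OF c, simplified])

lemma gauss_pos [simp]: "0 < gauss x"
  by (simp add: gauss_def)

lemma gauss_nonneg [simp]: "0 \<le> gauss x"
  by (simp add: less_imp_le)

lemma std_gaussian_eq: "std_gaussian = density lborel (\<lambda>x. ennreal (gauss x))"
  by (simp add: std_gaussian_def gauss_def)

lemma borel_measurable_gauss [measurable]: "gauss \<in> borel_measurable borel"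
  unfolding gauss_def by measurable

lemma nn_integral_gauss: "(\<integral>\<^sup>+(x::'a::euclidean_space). ennreal (gauss x) \<partial>lborel) = 1"
proof -
  have eq: "ennreal (gauss x) = ennreal (1 / sqrt (2 * pi) ^ DIM('a)) * ennreal (exp (- (1/2) * (norm x)\<^sup>2))"
    for x :: 'a by (simp add: gauss_def ennreal_mult[symmetric])
  have "(\<integral>\<^sup>+(x::'a). ennreal (gauss x) \<partial>lborel)
      = ennreal (1 / sqrt (2 * pi) ^ DIM('a)) * ennreal (sqrt (2 * pi) ^ DIM('a))"
    unfolding eq using nn_integral_exp_neg_norm_sq[of "1/2", where 'a = 'a]
    by (subst nn_integral_cmult) (simp_all add: mult.commute)
  then show ?thesis by (simp add: ennreal_mult[symmetric])
qed

lemma integrable_gauss: "integrable lborel (gauss :: 'a::euclidean_space \<Rightarrow> real)"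
  by (rule integrableI_bounded) (simp_all add: nn_integral_gauss)

lemma integral_gauss: "(\<integral>(x::'a::euclidean_space). gauss x \<partial>lborel) = 1"
  by (subst integral_eq_nn_integral) (simp_all add: nn_integral_gauss)

lemma prob_space_std_gaussian: "prob_space (std_gaussian :: 'a::euclidean_space measure)"
  by (rule prob_spaceI) (simp add: std_gaussian_eq emeasure_density nn_integral_gauss)

lemma sets_std_gaussian [simp, measurable_cong]: "sets std_gaussian = sets borel"
  by (simp add: std_gaussian_eq)

lemma space_std_gaussian [simp]: "space std_gaussian = UNIV"
  by (simp add: std_gaussian_eq)

lemma measure_std_gaussian:
  fixes S :: "'a::euclidean_space set"
  assumes "S \<in> sets borel"
  shows "measure std_gaussian S = (\<integral>x. indicator S x * gauss x \<partial>lborel)"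
proof -
  have "emeasure std_gaussian S = (\<integral>\<^sup>+x. ennreal (indicator S x * gauss x) \<partial>lborel)"
    using assms by (auto simp: std_gaussian_eq emeasure_density split: split_indicator
        intro!: nn_integral_cong)
  then show ?thesis using assms
    by (simp add: measure_def integral_eq_nn_integral)
qed

section \<open>Integration by parts against the Gaussian\<close>

lemma integral_lborel_translate:
  fixes f :: "'a::euclidean_space \<Rightarrow> real"
  assumes [measurable]: "f \<in> borel_measurable borel"
  shows "(\<integral>x. f (c + x) \<partial>lborel) = (\<integral>x. f x \<partial>lborel)"
  using integral_distr[of "(+) c" lborel borel f] lborel_distr_plus[of c] by simp

text \<open>Integration by parts is the derivative of translation invariance.\<close>

lemma gauss_integration_by_parts:
  fixes g :: "'a::euclidean_space \<Rightarrow> real"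
  assumes g': "\<And>x. (g has_derivative g' x) (at x)"
    and B: "\<And>x. \<bar>g x\<bar> \<le> B" and b: "\<And>x. \<bar>g' x u\<bar> \<le> b" and u: "norm u = 1"
  shows "integrable lborel (\<lambda>x. gauss x * ((x \<bullet> u) * g x))"
    and "integrable lborel (\<lambda>x. gauss x * g' x u)"
    and "(\<integral>x. gauss x * ((x \<bullet> u) * g x) \<partial>lborel) = (\<integral>x. gauss x * g' x u \<partial>lborel)"
proof -
  define t where "t n = inverse (real (Suc n))" for n
  have t: "0 < t n" "t n \<le> 1" for n by (auto simp: t_def field_simps)
  have lim_t: "filterlim t (at 0) sequentially"
    unfolding t_def filterlim_at using LIMSEQ_inverse_real_of_nat by (auto intro!: eventuallyI)
  have cont: "continuous_on UNIV g" using g' by (meson has_derivative_continuous_on has_derivative_at_withinI)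
  then have [measurable]: "g \<in> borel_measurable borel" by (rule borel_measurable_continuous_onI)
  let ?C = "sqrt (2 * pi) ^ DIM('a)"
  have C: "?C > 0" by simp
  have dg: "((\<lambda>s. g (x + s *\<^sub>R u)) has_real_derivative g' (x + s *\<^sub>R u) u) (at s)" for x s
  proof -
    have "((\<lambda>s. g (x + s *\<^sub>R u)) has_derivative (\<lambda>h. g' (x + s *\<^sub>R u) (h *\<^sub>R u))) (at s)"
      by (rule has_derivative_compose[OF _ g', where f = "\<lambda>s. x + s *\<^sub>R u" and f' = "\<lambda>h. h *\<^sub>R u", simplified])
        (auto intro!: derivative_eq_intros)
    moreover have "g' y (h *\<^sub>R u) = h * g' y u" for h y
      using has_derivative_linear[OF g'[of y]] by (simp add: linear_scale)
    ultimately show ?thesis by (simp add: has_field_derivative_def mult.commute[of _ "g' _ u"])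
  qed
  have dG: "((\<lambda>s. gauss (x - s *\<^sub>R u)) has_real_derivative
       gauss (x - s *\<^sub>R u) * ((x - s *\<^sub>R u) \<bullet> u)) (at s)" for x s
  proof -
    have uu: "u \<bullet> u = 1" using u by (simp add: norm_eq_sqrt_inner)
    have nn: "(norm (x - s *\<^sub>R u))\<^sup>2 = x \<bullet> x - 2 * s * (x \<bullet> u) + s\<^sup>2" for s
      unfolding power2_norm_eq_inner by (simp add: algebra_simps uu inner_commute power2_eq_square)
    show ?thesis unfolding gauss_def nn
      by (auto intro!: derivative_eq_intros simp: field_simps inner_diff_left uu)
  qed
  \<comment> \<open>Difference quotients of \<open>g\<close> forward and of \<open>gauss\<close>
    backward: a translation exchanges them under the integral, and each side has its own dominated
    limit.\<close>
  define Q1 where "Q1 n x = (g (x + t n *\<^sub>R u) - g x) / t n" for n x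
  define Q2 where "Q2 n x = (gauss (x - t n *\<^sub>R u) - gauss x) / t n" for n x
  have [measurable]: "Q1 n \<in> borel_measurable borel" "Q2 n \<in> borel_measurable borel" for n
    unfolding Q1_def Q2_def by measurable
  have lim1: "(\<lambda>n. Q1 n x) \<longlonglongrightarrow> g' x u" for x
    using filterlim_compose[OF dg[of x 0, unfolded DERIV_def] lim_t] by (simp add: Q1_def)
  have lim2: "(\<lambda>n. Q2 n x) \<longlonglongrightarrow> gauss x * (x \<bullet> u)" for x
    using filterlim_compose[OF dG[of x 0, unfolded DERIV_def] lim_t] by (simp add: Q2_def)
  have b1: "\<bar>Q1 n x\<bar> \<le> b" for n x
  proof -
    obtain z where "g (x + t n *\<^sub>R u) - g (x + 0 *\<^sub>R u) = (t n - 0) * g' (x + z *\<^sub>R u) u"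
      using MVT2[of 0 "t n" "\<lambda>s. g (x + s *\<^sub>R u)" "\<lambda>s. g' (x + s *\<^sub>R u) u", OF t(1) dg] by blast
    then show ?thesis using t[of n] b by (simp add: Q1_def abs_mult)
  qed
  \<comment> \<open>The mean value theorem evaluates the quotient at
    \<open>y = x - z *\<^sub>R u\<close> with \<open>0 < z < 1\<close>. Half of the exponent of
    \<open>gauss y\<close> absorbs the factor \<open>norm y\<close>; for the other half,
    \<open>norm x \<le> norm y + 1\<close> gives
    \<open>(norm x)\<^sup>2 \<le> 2 * (norm y)\<^sup>2 + 2\<close>, whence the exponent
    \<open>1/8\<close> and the factor \<open>exp (1/4)\<close>.\<close>
  define w where "w x = exp (1/4) * exp (- (1/8) * (norm x)\<^sup>2) / ?C" for x :: 'a
  have b2: "\<bar>Q2 n x\<bar> \<le> w x" for n x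
  proof -
    obtain z where z: "0 < z" "z < t n" and "gauss (x - t n *\<^sub>R u) - gauss (x - 0 *\<^sub>R u)
        = (t n - 0) * (gauss (x - z *\<^sub>R u) * ((x - z *\<^sub>R u) \<bullet> u))"
      using MVT2[of 0 "t n" "\<lambda>s. gauss (x - s *\<^sub>R u)"
          "\<lambda>s. gauss (x - s *\<^sub>R u) * ((x - s *\<^sub>R u) \<bullet> u)", OF t(1) dG] by blast
    moreover define y where "y = x - z *\<^sub>R u"
    ultimately have "\<bar>Q2 n x\<bar> = gauss y * \<bar>y \<bullet> u\<bar>" using t[of n] by (simp add: Q2_def abs_mult)
    also have "\<dots> \<le> gauss y * norm y"
      using Cauchy_Schwarz_ineq2[of y u] u by (intro mult_left_mono) auto
    also have "\<dots> = exp (- (norm y)\<^sup>2 / 4) * (exp (- (norm y)\<^sup>2 / 4) * norm y) / ?C"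
      by (simp add: gauss_def exp_add[symmetric])
    also have "\<dots> \<le> exp (- (norm y)\<^sup>2 / 4) * 1 / ?C"
    proof (intro divide_right_mono mult_left_mono)
      have "norm y \<le> 1 + (norm y)\<^sup>2 / 4" using zero_le_power2[of "norm y / 2 - 1"]
        by (simp add: power2_diff power_divide)
      also have "\<dots> \<le> exp ((norm y)\<^sup>2 / 4)" by (rule exp_ge_add_one_self)
      finally show "exp (- (norm y)\<^sup>2 / 4) * norm y \<le> 1" by (simp add: exp_minus field_simps)
    qed (use C in auto)
    also have "\<dots> \<le> w x"
    proof -
      have "norm x \<le> norm y + 1" using norm_triangle_ineq[of y "z *\<^sub>R u"] z t[of n] u
        by (simp add: y_def)
      then have "(norm x)\<^sup>2 \<le> (norm y + 1)\<^sup>2" by (intro power_mono) auto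
      also have "\<dots> \<le> 2 * (norm y)\<^sup>2 + 2" using zero_le_power2[of "norm y - 1"]
        by (simp add: power2_diff power2_sum)
      finally have "exp (- (norm y)\<^sup>2 / 4) \<le> exp (1/4 + - (1/8) * (norm x)\<^sup>2)" by simp
      then show ?thesis unfolding w_def exp_add[symmetric] using C
        by (simp add: divide_right_mono)
    qed
    finally show ?thesis .
  qed
  have iw: "integrable lborel (\<lambda>x. B * w x)"
    unfolding w_def using integrable_exp_neg_norm_sq[of "1/8", where 'a = 'a] by simp
  have ig: "integrable lborel (\<lambda>x::'a. b * gauss x)" using integrable_gauss[where 'a = 'a] by simp
  have "B \<ge> 0" using B[of 0] by linarith
  have dom1: "AE x in lborel. norm (gauss x * Q1 n x) \<le> b * gauss x" for n
    using b1[of n] gauss_pos by (intro AE_I2) (auto simp: abs_mult divide_right_mono mult.commute)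
  have dom2: "AE x in lborel. norm (Q2 n x * g x) \<le> B * w x" for n
    using b2[of n] B \<open>B \<ge> 0\<close>
    by (intro AE_I2) (metis abs_ge_zero abs_mult mult.commute mult_mono' real_norm_def)
  have L1: "AE x in lborel. (\<lambda>n. gauss x * Q1 n x) \<longlonglongrightarrow> gauss x * g' x u"
    by (intro AE_I2 tendsto_intros lim1)
  have L2: "AE x in lborel. (\<lambda>n. Q2 n x * g x) \<longlonglongrightarrow> gauss x * ((x \<bullet> u) * g x)"
    using tendsto_mult[OF lim2 tendsto_const] by (auto simp: mult.assoc)
  \<comment> \<open>The derivative is not assumed continuous; it is measurable as a pointwise limit
    of the quotients.\<close>
  have [measurable]: "(\<lambda>x. g' x u) \<in> borel_measurable borel"
    by (rule borel_measurable_LIMSEQ_real[OF lim1]) measurable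
  show "integrable lborel (\<lambda>x. gauss x * ((x \<bullet> u) * g x))" 
    by (rule integrable_dominated_convergence[OF _ _ iw L2 dom2]) measurable
  show "integrable lborel (\<lambda>x. gauss x * g' x u)" 
    by (rule integrable_dominated_convergence[OF _ _ ig L1 dom1]) measurable
  \<comment> \<open>The exact discrete integration by parts; all that is used is invariance of
    \<open>lborel\<close> under the shift by \<open>t n *\<^sub>R u\<close>.\<close>
  have eq: "(\<integral>x. gauss x * Q1 n x \<partial>lborel) = (\<integral>x. Q2 n x * g x \<partial>lborel)" for n
  proof -
    have igg: "integrable lborel (\<lambda>x. gauss (x + c) * g (x + d))" for c d
    proof (rule Bochner_Integration.integrable_bound)
      have "integrable (distr lborel borel ((+) c)) (gauss :: 'a \<Rightarrow> real)"
        using integrable_gauss lborel_distr_plus[of c] by simp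
      then have "integrable lborel (\<lambda>x. gauss (x + c))"
        by (subst (asm) integrable_distr_eq) (auto simp: add.commute)
      then show "integrable lborel (\<lambda>x. B * gauss (x + c))" by simp
      show "AE x in lborel. norm (gauss (x + c) * g (x + d)) \<le> norm (B * gauss (x + c))"
        using B \<open>B \<ge> 0\<close> by (intro AE_I2) (simp add: abs_mult mult.commute divide_right_mono mult_right_mono)
    qed measurable
    have "(\<integral>x. gauss x * Q1 n x \<partial>lborel)
        = ((\<integral>x. gauss x * g (x + t n *\<^sub>R u) \<partial>lborel) - (\<integral>x. gauss x * g x \<partial>lborel)) / t n"
      using igg[of 0 "t n *\<^sub>R u"] igg[of 0 0] by (simp add: Q1_def right_diff_distrib diff_divide_distrib)
    also have "(\<integral>x. gauss x * g (x + t n *\<^sub>R u) \<partial>lborel) = (\<integral>x. gauss (x - t n *\<^sub>R u) * g x \<partial>lborel)"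
      using integral_lborel_translate[of "\<lambda>x. gauss (x - t n *\<^sub>R u) * g x" "t n *\<^sub>R u"]
      by (simp add: add.commute)
    also have "(\<dots> - (\<integral>x. gauss x * g x \<partial>lborel)) / t n = (\<integral>x. Q2 n x * g x \<partial>lborel)"
      using igg[of "- t n *\<^sub>R u" 0] igg[of 0 0] by (simp add: Q2_def left_diff_distrib diff_divide_distrib)
    finally show ?thesis .
  qed
  have "(\<lambda>n. \<integral>x. gauss x * Q1 n x \<partial>lborel) \<longlonglongrightarrow> (\<integral>x. gauss x * g' x u \<partial>lborel)"
    by (rule integral_dominated_convergence[OF _ _ ig L1 dom1]) measurable
  moreover have "(\<lambda>n. \<integral>x. Q2 n x * g x \<partial>lborel) \<longlonglongrightarrow> (\<integral>x. gauss x * ((x \<bullet> u) * g x) \<partial>lborel)"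
    by (rule integral_dominated_convergence[OF _ _ iw L2 dom2]) measurable
  ultimately show "(\<integral>x. gauss x * ((x \<bullet> u) * g x) \<partial>lborel) = (\<integral>x. gauss x * g' x u \<partial>lborel)"
    unfolding eq by (rule LIMSEQ_unique[symmetric])
qed

section \<open>A Gaussian and its image under a map near the identity\<close>

lemma AM_GM_neg_log:
  fixes r l :: real
  assumes r: "0 < r" and l: "0 < l"
  shows "max 0 (1 - r) \<le> (r - 1 - ln r) / l + l / 2"
proof -
  have nn: "0 \<le> r - 1 - ln r" using ln_le_minus_one[OF r] by simp
  show ?thesis
  proof (cases "r \<le> 1")
    case True
    \<comment> \<open>On \<open>(0, 1]\<close> the function \<open>r - 1 - ln r\<close> dominates
      \<open>(1 - r)\<^sup>2 / 2\<close>, its quadratic Taylor term at 1; the arithmetic-geometric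
      mean inequality with weight \<open>l\<close> then makes the square linear. Above 1 the left
      side of the claim is 0.\<close>
    let ?f = "\<lambda>x::real. x - 1 - ln x - (1 - x)\<^sup>2 / 2"
    have "?f 1 \<le> ?f r"
    proof (rule DERIV_nonpos_imp_nonincreasing[OF True])
      fix x assume x: "r \<le> x" "x \<le> 1"
      then have "x > 0" using r by simp
      then have "(?f has_real_derivative 1 - 1 / x + (1 - x)) (at x)"
        by (auto intro!: derivative_eq_intros simp: field_simps)
      moreover have "1 - 1 / x + (1 - x) = - (1 - x)\<^sup>2 / x"
        using \<open>x > 0\<close> by (simp add: field_simps power2_eq_square)
      moreover have "\<dots> \<le> 0" using \<open>x > 0\<close> by simp
      ultimately show "\<exists>y. (?f has_real_derivative y) (at x) \<and> y \<le> 0" by metis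
    qed
    then have "(1 - r)\<^sup>2 / 2 \<le> r - 1 - ln r" by simp
    then have "(1 - r)\<^sup>2 / 2 / l + l / 2 \<le> (r - 1 - ln r) / l + l / 2"
      using l by (intro add_right_mono divide_right_mono) auto
    moreover have "1 - r \<le> (1 - r)\<^sup>2 / 2 / l + l / 2"
    proof -
      have "2 * l * (1 - r) \<le> (1 - r)\<^sup>2 + l\<^sup>2"
        using zero_le_power2[of "(1 - r) - l"] by (simp add: power2_eq_square algebra_simps)
      then show ?thesis using l by (simp add: field_simps power2_eq_square)
    qed
    ultimately show ?thesis using True by simp
  next
    case False
    then show ?thesis using nn l by simp
  qed
qed

text \<open>Stein's identity: component \<open>i\<close> of \<open>R\<close> is integrated by parts
  in direction \<open>i\<close>, and the sum over \<open>i\<close> is the Gaussian divergence, which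
  has mean zero.\<close>

lemma gauss_trace_ibp:
  fixes R :: "real^'m \<Rightarrow> real^'m"
  assumes R': "\<And>v. (R has_derivative A v) (at v)"
    and Rb: "\<And>v. norm (R v) \<le> B" and Ab: "\<And>v b. norm (A v b) \<le> a * norm b"
  shows "integrable lborel (\<lambda>v. gauss v * (v \<bullet> R v - trace (matrix (A v))))"
    and "(\<integral>v. gauss v * (v \<bullet> R v - trace (matrix (A v))) \<partial>lborel) = 0"
proof -
  have ibp: "integrable lborel (\<lambda>v. gauss v * ((v \<bullet> axis i 1) * (R v $ i)))"
    "integrable lborel (\<lambda>v. gauss v * (A v (axis i 1) $ i))"
    "(\<integral>v. gauss v * ((v \<bullet> axis i 1) * (R v $ i)) \<partial>lborel) = (\<integral>v. gauss v * (A v (axis i 1) $ i) \<partial>lborel)"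
    for i
  proof -
    have d: "((\<lambda>v. R v $ i) has_derivative (\<lambda>b. A v b $ i)) (at v)" for v
      by (rule bounded_linear.has_derivative[OF bounded_linear_vec_nth R'])
    have b1: "\<bar>R v $ i\<bar> \<le> B" for v using component_le_norm_cart[of "R v" i] Rb[of v] by linarith
    have b2: "\<bar>A v (axis i 1) $ i\<bar> \<le> a" for v
      using component_le_norm_cart[of "A v (axis i 1)" i] Ab[of v "axis i 1"] by (simp add: norm_axis_1)
    show "integrable lborel (\<lambda>v. gauss v * ((v \<bullet> axis i 1) * (R v $ i)))"
    "integrable lborel (\<lambda>v. gauss v * (A v (axis i 1) $ i))"
    "(\<integral>v. gauss v * ((v \<bullet> axis i 1) * (R v $ i)) \<partial>lborel) = (\<integral>v. gauss v * (A v (axis i 1) $ i) \<partial>lborel)"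
      using gauss_integration_by_parts[OF d b1 b2] by (simp_all add: norm_axis_1)
  qed
  have eq: "gauss v * (v \<bullet> R v - trace (matrix (A v))) =
      (\<Sum>i\<in>UNIV. gauss v * ((v \<bullet> axis i 1) * (R v $ i)) - gauss v * (A v (axis i 1) $ i))" for v
    unfolding inner_axis by (simp add: inner_vec_def trace_def matrix_def sum_subtractf sum_distrib_left
        right_diff_distrib)
  show "integrable lborel (\<lambda>v. gauss v * (v \<bullet> R v - trace (matrix (A v))))"
    unfolding eq by (intro Bochner_Integration.integrable_sum Bochner_Integration.integrable_diff ibp)
  show "(\<integral>v. gauss v * (v \<bullet> R v - trace (matrix (A v))) \<partial>lborel) = 0"
    unfolding eq by (simp add: Bochner_Integration.integral_sum Bochner_Integration.integral_diff ibp)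
qed

lemma integral_change_of_variables_real:
  fixes f :: "real^'m::{finite,wellorder} \<Rightarrow> real" and g :: "real^'m::_ \<Rightarrow> real^'m::_"
  assumes S: "S \<in> sets lebesgue" and g': "\<And>x. (g has_derivative g' x) (at x)" and inj: "inj g"
    and f: "f absolutely_integrable_on (g ` S)"
  shows "set_integrable lebesgue S (\<lambda>x. \<bar>det (matrix (g' x))\<bar> * f (g x))"
    and "set_lebesgue_integral lebesgue S (\<lambda>x. \<bar>det (matrix (g' x))\<bar> * f (g x))
      = set_lebesgue_integral lebesgue (g ` S) f"
proof -
  \<comment> \<open>The general theorem concerns vector-valued functions, so scalars pass through
    \<open>real^1\<close>; the value \<open>b\<close> to be used is the integral of \<open>f\<close>
    over the image.\<close>
  have "(\<lambda>x. \<bar>det (matrix (g' x))\<bar> *\<^sub>R vec (f (g x)) :: real^1) absolutely_integrable_on S \<and>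
      integral S (\<lambda>x. \<bar>det (matrix (g' x))\<bar> *\<^sub>R vec (f (g x)) :: real^1) = vec b
    \<longleftrightarrow> (\<lambda>x. vec (f x) :: real^1) absolutely_integrable_on (g ` S) \<and>
      integral (g ` S) (\<lambda>x. vec (f x) :: real^1) = vec b" for b
    by (rule has_absolute_integral_change_of_variables[OF S])
      (use g' inj in \<open>auto intro: has_derivative_at_withinI inj_on_subset\<close>)
  then have "(\<lambda>x. \<bar>det (matrix (g' x))\<bar> * f (g x)) absolutely_integrable_on S \<and>
      integral S (\<lambda>x. \<bar>det (matrix (g' x))\<bar> * f (g x)) = integral (g ` S) f"
    using f by (simp add: absolutely_integrable_on_1_iff integral_on_1_eq)
  then show "set_integrable lebesgue S (\<lambda>x. \<bar>det (matrix (g' x))\<bar> * f (g x))"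
    and "set_lebesgue_integral lebesgue S (\<lambda>x. \<bar>det (matrix (g' x))\<bar> * f (g x))
      = set_lebesgue_integral lebesgue (g ` S) f"
    using f by (auto simp: set_lebesgue_integral_eq_integral)
qed

lemma gaussian_transport_bound_wellorder:
  fixes \<Phi> :: "real^'m::{finite,wellorder} \<Rightarrow> real^'m::_"
  assumes \<Phi>': "\<And>v. (\<Phi> has_derivative (\<lambda>b. b + A v b)) (at v)" and bij: "bij \<Phi>"
    and Rb: "\<And>v. norm (\<Phi> v - v) \<le> B" and Ab: "\<And>v b. norm (A v b) \<le> a * norm b"
    and a: "0 \<le> a" "a \<le> 3/5" and l: "0 < l"
    and S: "S \<in> sets borel" "\<Phi> ` S \<in> sets borel"
  shows "measure std_gaussian S - measure std_gaussian (\<Phi> ` S)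
    \<le> (B\<^sup>2 / 2 + 5/4 * real CARD('m) * a\<^sup>2) / l + l / 2"
proof -
  let ?c = "B\<^sup>2 / 2 + 5/4 * real CARD('m) * a\<^sup>2"
  define R where "R v = \<Phi> v - v" for v
  define J where "J v = det (matrix (\<lambda>b. b + A v b))" for v
  have R': "(R has_derivative A v) (at v)" for v
    unfolding R_def by (auto intro!: derivative_eq_intros \<Phi>')
  have lin: "linear (A v)" for v using has_derivative_linear[OF R'] .
  have mat: "matrix (\<lambda>b. b + A v b) = mat 1 + matrix (A v)" for v
    by (simp add: matrix_def mat_def axis_def vec_eq_iff)
  have Mb: "norm (matrix (A v) *v x) \<le> a * norm x" for v x
    using Ab lin by (simp add: matrix_works)
  have J: "0 < J v" "trace (matrix (A v)) - 5/4 * real CARD('m) * a\<^sup>2 \<le> ln (J v)" for v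
    using ln_det_id_plus_ge[OF Mb a] unfolding J_def mat by auto
  have inj: "inj \<Phi>" and surj: "surj \<Phi>" using bij by (auto simp: bij_def)
  have ga: "gauss absolutely_integrable_on X" if "X \<in> sets borel" for X :: "(real^'m::_) set"
    using integrable_mult_indicator[OF _ integrable_gauss, of X] that
    by (simp add: set_integrable_def integrable_completion)
  have cov: "set_integrable lebesgue X (\<lambda>x. J x * gauss (\<Phi> x))"
     "set_lebesgue_integral lebesgue X (\<lambda>x. J x * gauss (\<Phi> x)) = measure std_gaussian (\<Phi> ` X)"
    if X: "X \<in> sets borel" "\<Phi> ` X \<in> sets borel" for X
  proof -
    have "X \<in> sets lebesgue" using X by auto
    note C = integral_change_of_variables_real[OF this \<Phi>' inj ga[OF X(2)]]
    have [simp]: "\<bar>det (matrix (\<lambda>b. b + A x b))\<bar> = J x" for x using J(1)[of x] by (simp add: J_def)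
    show "set_integrable lebesgue X (\<lambda>x. J x * gauss (\<Phi> x))" using C(1) by simp
    have "set_lebesgue_integral lebesgue (\<Phi> ` X) gauss = measure std_gaussian (\<Phi> ` X)"
      using X(2) by (simp add: measure_std_gaussian set_lebesgue_integral_def integral_completion)
    then show "set_lebesgue_integral lebesgue X (\<lambda>x. J x * gauss (\<Phi> x)) = measure std_gaussian (\<Phi> ` X)"
      using C(2) by simp
  qed
  \<comment> \<open>A pointwise majorant with a computable integral: the pulled back density and
    \<open>gauss\<close> both have mass 1, the divergence term has mean 0, and only
    \<open>?c / l + l / 2\<close> remains. Here \<open>?c\<close> collects the bounds on
    \<open>(norm (R v))\<^sup>2 / 2\<close> and on \<open>trace - ln det\<close>.\<close>
  define W where "W v = (J v * gauss (\<Phi> v) - gauss v + gauss v * (v \<bullet> R v - trace (matrix (A v)))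
      + ?c * gauss v) / l + l / 2 * gauss v" for v
  have W: "max 0 (gauss v - J v * gauss (\<Phi> v)) \<le> W v" for v
  proof -
    define r where "r = J v * gauss (\<Phi> v) / gauss v"
    have r: "r > 0" "J v * gauss (\<Phi> v) = r * gauss v" using J(1)[of v] gauss_pos[of v]
      by (auto simp: r_def less_imp_neq[symmetric])
    have n2: "(norm (\<Phi> v))\<^sup>2 = (norm v)\<^sup>2 + 2 * (v \<bullet> R v) + (norm (R v))\<^sup>2"
      unfolding R_def power2_norm_eq_inner by (simp add: algebra_simps inner_commute)
    have "r = J v * exp (- (v \<bullet> R v) - (norm (R v))\<^sup>2 / 2)"
    proof -
      have "r = J v * (exp (- (norm (\<Phi> v))\<^sup>2 / 2) / exp (- (norm v)\<^sup>2 / 2))"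
        by (simp add: r_def gauss_def)
      also have "exp (- (norm (\<Phi> v))\<^sup>2 / 2) / exp (- (norm v)\<^sup>2 / 2)
          = exp (- (v \<bullet> R v) - (norm (R v))\<^sup>2 / 2)"
        unfolding exp_diff[symmetric] n2 by (simp add: field_simps)
      finally show ?thesis .
    qed
    then have "ln r = ln (J v) - (v \<bullet> R v) - (norm (R v))\<^sup>2 / 2"
      using J(1)[of v] by (simp add: ln_mult)
    moreover have "(norm (R v))\<^sup>2 \<le> B\<^sup>2" using Rb[of v] unfolding R_def by (intro power_mono) auto
    ultimately have "- ln r \<le> (v \<bullet> R v) - trace (matrix (A v)) + ?c" using J(2)[of v] by simp
    then have "(r - 1 - ln r) / l + l / 2 \<le>
       (r - 1 + ((v \<bullet> R v) - trace (matrix (A v)) + ?c)) / l + l / 2"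
      using l by (intro add_right_mono divide_right_mono) auto
    then have "max 0 (1 - r) \<le> (r - 1 + ((v \<bullet> R v) - trace (matrix (A v)) + ?c)) / l + l / 2"
      using AM_GM_neg_log[OF r(1) l] by linarith
    then have "gauss v * max 0 (1 - r) \<le>
        gauss v * ((r - 1 + ((v \<bullet> R v) - trace (matrix (A v)) + ?c)) / l + l / 2)"
      by (intro mult_left_mono) auto
    also have "gauss v * max 0 (1 - r) = max 0 (gauss v - J v * gauss (\<Phi> v))"
      unfolding r(2) using gauss_pos[of v] by (simp add: max_mult_distrib_left algebra_simps)
    also have "gauss v * ((r - 1 + ((v \<bullet> R v) - trace (matrix (A v)) + ?c)) / l + l / 2) = W v"
      unfolding W_def r(2) using l by (simp add: field_simps)
    finally show ?thesis .
  qed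
  \<comment> \<open>Surjectivity of \<open>\<Phi>\<close> gives total mass 1. As
    \<open>\<Phi>\<close> is merely differentiable, integrability of the pulled back density,
    measurability included, is taken from the change of variables.\<close>
  have UN: "set_integrable lebesgue UNIV (\<lambda>x. J x * gauss (\<Phi> x))"
    "set_lebesgue_integral lebesgue UNIV (\<lambda>x. J x * gauss (\<Phi> x)) = 1"
    using cov[of UNIV] surj prob_space.prob_space[OF prob_space_std_gaussian] by auto
  have i1: "integrable lebesgue (\<lambda>x. J x * gauss (\<Phi> x))" "(\<integral>x. J x * gauss (\<Phi> x) \<partial>lebesgue) = 1"
    using UN by (auto simp: set_integrable_def set_lebesgue_integral_def)
  have i2: "integrable lebesgue (gauss :: real^'m::_ \<Rightarrow> real)" "(\<integral>(x::real^'m::_). gauss x \<partial>lebesgue) = 1"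
    using integrable_gauss integral_gauss by (auto simp: integrable_completion integral_completion)
  have i3: "integrable lebesgue (\<lambda>v. gauss v * (v \<bullet> R v - trace (matrix (A v))))"
    "(\<integral>v. gauss v * (v \<bullet> R v - trace (matrix (A v))) \<partial>lebesgue) = 0"
    using gauss_trace_ibp[OF R' _ Ab, of B] Rb
    by (auto simp: R_def integrable_completion integral_completion dest: borel_measurable_integrable)
  have iW: "integrable lebesgue W" "(\<integral>v. W v \<partial>lebesgue) = ?c / l + l / 2"
    unfolding W_def using i1 i2 i3 by (simp_all del: right_diff_distrib right_diff_distrib')
  have iS: "integrable lebesgue (\<lambda>v. indicator S v * gauss v)"
    "integrable lebesgue (\<lambda>v. indicator S v * (J v * gauss (\<Phi> v)))"
    using integrable_mult_indicator[OF _ i2(1), of S] integrable_mult_indicator[OF _ i1(1), of S] S by auto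
  have "measure std_gaussian S - measure std_gaussian (\<Phi> ` S)
     = (\<integral>v. indicator S v * gauss v \<partial>lebesgue) - (\<integral>v. indicator S v * (J v * gauss (\<Phi> v)) \<partial>lebesgue)"
    using S cov(2)[OF S] by (simp add: measure_std_gaussian set_lebesgue_integral_def integral_completion)
  also have "\<dots> = (\<integral>v. indicator S v * gauss v - indicator S v * (J v * gauss (\<Phi> v)) \<partial>lebesgue)"
    by (rule Bochner_Integration.integral_diff[OF iS, symmetric])
  also have "\<dots> \<le> (\<integral>v. W v \<partial>lebesgue)"
  proof (intro integral_mono Bochner_Integration.integrable_diff iS iW(1))
    fix v show "indicator S v * gauss v - indicator S v * (J v * gauss (\<Phi> v)) \<le> W v"
      using W[of v] by (simp split: split_indicator)
  qed
  finally show ?thesis unfolding iW(2) .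
qed

text \<open>The change of variables theorem of the library needs a well-ordered index type; this type
  provides one of the same cardinality as a given finite type.\<close>

typedef 'n idx = "{..<CARD('n::finite)}" morphisms rep_idx Abs_idx
  by (intro exI[of _ 0]) simp

instantiation idx :: (finite) wellorder
begin

definition less_eq_idx :: "'a idx \<Rightarrow> 'a idx \<Rightarrow> bool" where "less_eq_idx i j \<longleftrightarrow> rep_idx i \<le> rep_idx j"
definition less_idx :: "'a idx \<Rightarrow> 'a idx \<Rightarrow> bool" where "less_idx i j \<longleftrightarrow> rep_idx i < rep_idx j"

instance
proof
  fix P :: "'a idx \<Rightarrow> bool" and i
  assume step: "\<And>x. (\<And>y. y < x \<Longrightarrow> P y) \<Longrightarrow> P x"
  show "P i"
    by (induction i rule: measure_induct_rule[of rep_idx]) (use step in \<open>auto simp: less_idx_def\<close>)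
qed (auto simp: less_eq_idx_def less_idx_def rep_idx_inject)

end

lemma bij_betw_rep_idx: "bij_betw (rep_idx :: 'n::finite idx \<Rightarrow> nat) UNIV {..<CARD('n)}"
  using type_definition.Rep_range[OF type_definition_idx]
  by (auto simp: bij_betw_def inj_on_def rep_idx_inject)

instance idx :: (finite) finite
  by standard (use bij_betw_finite[OF bij_betw_rep_idx] in auto)

lemma card_idx [simp]: "CARD('n::finite idx) = CARD('n)"
  using bij_betw_same_card[OF bij_betw_rep_idx] by simp

text \<open>Conjugation with a relabelling \<open>p\<close> of the coordinates, a linear isometry
  that maps the Gaussian to the Gaussian; hypotheses and bound are invariant under it.\<close>

lemma gaussian_transport_bound:
  fixes \<Phi> :: "real^'n \<Rightarrow> real^'n"
  assumes \<Phi>': "\<And>v. (\<Phi> has_derivative (\<lambda>b. b + A v b)) (at v)" and bij: "bij \<Phi>"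
    and Rb: "\<And>v. norm (\<Phi> v - v) \<le> B" and Ab: "\<And>v b. norm (A v b) \<le> a * norm b"
    and a: "0 \<le> a" "a \<le> 3/5" and l: "0 < l"
    and S: "S \<in> sets borel" "\<Phi> ` S \<in> sets borel"
  shows "measure std_gaussian S - measure std_gaussian (\<Phi> ` S)
    \<le> (B\<^sup>2 / 2 + 5/4 * real CARD('n) * a\<^sup>2) / l + l / 2"
proof -
  obtain e :: "'n idx \<Rightarrow> 'n" where e: "bij e"
    using finite_same_card_bij[of "UNIV :: 'n idx set" "UNIV :: 'n set"] by auto
  define p :: "real^'n \<Rightarrow> real^'n idx" where "p x = (\<chi> i. x $ e i)" for x
  define p' :: "real^'n idx \<Rightarrow> real^'n" where "p' y = (\<chi> j. y $ inv e j)" for y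
  have inv: "p' (p x) = x" "p (p' y) = y" for x y
    using e by (auto simp: p_def p'_def vec_eq_iff bij_def surj_f_inv_f)
  have lin: "linear p" "linear p'" by (auto simp: p_def p'_def linear_iff vec_eq_iff)
  then have bl: "bounded_linear p" "bounded_linear p'" by (auto simp: linear_conv_bounded_linear)
  have norm_p: "norm (p x) = norm x" for x
    unfolding norm_vec_def L2_set_def p_def
    using sum.reindex_bij_betw[OF e, of "\<lambda>j. (norm (x $ j))\<^sup>2"] by simp
  have norm_p': "norm (p' y) = norm y" for y using norm_p[of "p' y"] inv by simp
  have [measurable]: "p \<in> borel_measurable borel" "p' \<in> borel_measurable borel"
    using bl by (auto intro!: borel_measurable_continuous_onI linear_continuous_on)
  \<comment> \<open>Boxes determine Lebesgue measure, and relabelling permutes the side lengths of a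
    box.\<close>
  have lb: "(lborel :: (real^'n idx) measure) = distr lborel borel p"
  proof (rule lborel_eqI)
    fix x y :: "real^'n idx" assume le: "\<And>b. b \<in> Basis \<Longrightarrow> x \<bullet> b \<le> y \<bullet> b"
    have pre: "p -` box x y = box (p' x) (p' y)"
    proof (intro set_eqI iffI)
      fix z assume "z \<in> p -` box x y"
      then have z: "x $ i < z $ e i \<and> z $ e i < y $ i" for i by (auto simp: p_def mem_box_cart)
      show "z \<in> box (p' x) (p' y)"
        using z[of "inv e _"] e by (auto simp: p'_def mem_box_cart bij_def surj_f_inv_f)
    next
      fix z assume "z \<in> box (p' x) (p' y)"
      then have z: "x $ inv e j < z $ j \<and> z $ j < y $ inv e j" for j by (auto simp: p'_def mem_box_cart)
      show "z \<in> p -` box x y" using z[of "e _"] e by (auto simp: p_def mem_box_cart bij_def)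
    qed
    have le1: "x $ i \<le> y $ i" for i using le[of "axis i 1"] by (auto simp: inner_axis Basis_vec_def)
    have "emeasure (distr lborel borel p) (box x y) = emeasure lborel (box (p' x) (p' y))"
      by (subst emeasure_distr) (auto simp: pre)
    also have "\<dots> = ennreal (\<Prod>b\<in>Basis. (p' y - p' x) \<bullet> b)"
      by (rule emeasure_lborel_box) (auto simp: Basis_vec_def p'_def inner_axis le1)
    also have "(\<Prod>b\<in>Basis. (p' y - p' x) \<bullet> b) = (\<Prod>j\<in>UNIV. (y - x) $ inv e j)"
      by (simp add: Basis_vec_def axis_eq_axis p'_def inner_axis
         UNION_singleton_eq_range prod.reindex inj_on_def)
    also have "\<dots> = (\<Prod>i\<in>UNIV. (y - x) $ i)"
      using prod.reindex_bij_betw[OF bij_imp_bij_inv[OF e], of "\<lambda>i. (y - x) $ i"] .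
    also have "\<dots> = (\<Prod>b\<in>Basis. (y - x) \<bullet> b)"
      by (simp add: Basis_vec_def axis_eq_axis inner_axis
         UNION_singleton_eq_range prod.reindex inj_on_def)
    finally show "emeasure (distr lborel borel p) (box x y) = ennreal (\<Prod>b\<in>Basis. (y - x) \<bullet> b)" .
  qed simp
  have gp: "gauss (p x) = gauss x" for x by (simp add: gauss_def norm_p)
  have dist: "std_gaussian = distr (std_gaussian :: (real^'n) measure) borel p"
    unfolding std_gaussian_eq
    by (subst lb, subst density_distr) (simp_all add: gp)
  have im: "measure std_gaussian (p ` X) = measure std_gaussian X \<and> p ` X \<in> sets borel"
    if "X \<in> sets borel" for X
  proof -
    have eq: "p ` X = p' -` X" using inv by (auto simp: image_iff) metis
    have s: "p' -` X \<in> sets borel"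
      using measurable_sets[OF \<open>p' \<in> borel_measurable borel\<close> that] by simp
    have "measure std_gaussian (p' -` X) = measure std_gaussian (p -` (p' -` X))"
      by (subst dist, subst measure_distr) (use s in auto)
    also have "p -` (p' -` X) = X" by (auto simp: inv)
    finally show ?thesis using eq s by simp
  qed
  define \<Psi> where "\<Psi> = p \<circ> \<Phi> \<circ> p'"
  have "bij p" "bij p'" using inv by (metis bij_betw_byWitness subset_UNIV)+
  then have bij\<Psi>: "bij \<Psi>" unfolding \<Psi>_def using bij by (auto intro: bij_comp)
  have im\<Psi>: "\<Psi> ` (p ` S) = p ` (\<Phi> ` S)" by (auto simp: \<Psi>_def image_image inv)
  have "measure std_gaussian (p ` S) - measure std_gaussian (\<Psi> ` (p ` S))
      \<le> (B\<^sup>2 / 2 + 5/4 * real CARD('n idx) * a\<^sup>2) / l + l / 2"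
  proof (rule gaussian_transport_bound_wellorder[where A = "\<lambda>v b. p (A (p' v) (p' b))"])
    fix v
    have "(\<Psi> has_derivative (\<lambda>b. p (p' b + A (p' v) (p' b)))) (at v)"
      unfolding \<Psi>_def comp_def
      by (rule bounded_linear.has_derivative[OF bl(1)])
        (rule has_derivative_compose[OF bounded_linear_imp_has_derivative[OF bl(2)] \<Phi>'])
    then show "(\<Psi> has_derivative (\<lambda>b. b + p (A (p' v) (p' b)))) (at v)"
      by (simp add: linear_add[OF lin(1)] inv)
    show "norm (\<Psi> v - v) \<le> B"
    proof -
      have "\<Psi> v - v = p (\<Phi> (p' v) - p' v)" by (simp add: \<Psi>_def linear_diff[OF lin(1)] inv)
      then show ?thesis using Rb[of "p' v"] by (simp add: norm_p)
    qed
    show "norm (p (A (p' v) (p' b))) \<le> a * norm b" for b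
      using Ab[of "p' v" "p' b"] by (simp add: norm_p norm_p')
  qed (use a l S im im\<Psi> bij\<Psi> in auto)
  then show ?thesis using im S im\<Psi> by simp
qed

section \<open>Perturbations of the identity in Banach spaces\<close>

text \<open>The inverse of \<open>id + M\<close>, applied alike to the nonlinear equations and to
  their linearizations.\<close>

definition resolvent :: "('p::banach \<Rightarrow> 'p) \<Rightarrow> 'p \<Rightarrow> 'p" where
  "resolvent M p = (THE q. q + M q = p)"

context
  fixes M :: "'p::banach \<Rightarrow> 'p" and c :: real
  assumes contr: "\<And>x y. norm (M x - M y) \<le> c * norm (x - y)" and c: "0 \<le> c" "c < 1"
begin

text \<open>A reverse triangle inequality from which both uniqueness of solutions and their
  Lipschitz dependence on the data are read off.\<close>

lemma id_plus_contraction_expansive: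
  "norm (x - y) \<le> norm ((x + M x) - (y + M y)) / (1 - c)"
proof -
  have "norm (x - y) \<le> norm ((x + M x) - (y + M y)) + norm (M x - M y)"
    using norm_triangle_ineq[of "(x + M x) - (y + M y)" "- (M x - M y)"] by (simp only: norm_minus_cancel) simp
  then have "norm (x - y) * (1 - c) \<le> norm ((x + M x) - (y + M y))"
    using contr[of x y] by (simp add: algebra_simps)
  then show ?thesis using c by (simp add: pos_le_divide_eq)
qed

lemma resolvent_unique:
  assumes "q + M q = p"
  shows "resolvent M p = q"
  unfolding resolvent_def
proof (rule the_equality[where P = "\<lambda>q. q + M q = p", OF assms])
  fix r assume "r + M r = p"
  then show "r = q" using id_plus_contraction_expansive[of r q] assms by simp
qed

lemma resolvent_eq: "resolvent M p + M (resolvent M p) = p"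
proof -
  have "\<exists>!q. p - M q = q"
    using contr by (intro banach_fix_type[OF c]) (simp add: dist_norm norm_minus_commute)
  then obtain q where "q + M q = p" by (metis diff_add_cancel)
  then show ?thesis using resolvent_unique by metis
qed

lemma resolvent_lipschitz: "norm (resolvent M p - resolvent M p') \<le> norm (p - p') / (1 - c)"
  using id_plus_contraction_expansive[of "resolvent M p" "resolvent M p'"] by (simp add: resolvent_eq)

end

lemma resolvent_linear_bound:
  fixes M :: "'p::banach \<Rightarrow> 'p"
  assumes lin: "linear M" and b: "\<And>x. norm (M x) \<le> c * norm x" and c: "0 \<le> c" "c < 1"
  shows "bounded_linear (resolvent M)" and "norm (resolvent M p) \<le> norm p / (1 - c)"
proof -
  have contr: "norm (M x - M y) \<le> c * norm (x - y)" for x y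
    using b[of "x - y"] by (simp add: linear_diff[OF lin])
  note eq = resolvent_eq[OF contr c] and un = resolvent_unique[OF contr c]
    and lip = resolvent_lipschitz[OF contr c]
  have 0: "resolvent M 0 = 0" using un[of 0 0] linear_0[OF lin] by simp
  show bound: "norm (resolvent M p) \<le> norm p / (1 - c)" for p using lip[of p 0] 0 by simp
  show "bounded_linear (resolvent M)"
  proof (rule bounded_linear_intro[where K = "1 / (1 - c)"])
    fix x y r
    show "resolvent M (x + y) = resolvent M x + resolvent M y"
      using eq[of x] eq[of y] by (intro un) (simp add: linear_add[OF lin] algebra_simps)
    show "resolvent M (r *\<^sub>R x) = r *\<^sub>R resolvent M x"
      using eq[of x] by (intro un) (simp add: linear_scale[OF lin] flip: scaleR_add_right)
  qed (use bound in simp)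
qed

text \<open>The rule for the derivative of an inverse at a point: the inverse is continuous because
  it is Lipschitz, and \<open>id + M'\<close> is inverted by \<open>resolvent M'\<close> because
  \<open>M'\<close> obeys the same bound \<open>c\<close>.\<close>

lemma resolvent_has_derivative:
  fixes M :: "'p::banach \<Rightarrow> 'p"
  assumes contr: "\<And>x y. norm (M x - M y) \<le> c * norm (x - y)" and c: "0 \<le> c" "c < 1"
    and M': "(M has_derivative M') (at (resolvent M p))" and b: "\<And>x. norm (M' x) \<le> c * norm x"
  shows "(resolvent M has_derivative resolvent M') (at p)"
proof (rule has_derivative_inverse_basic[where f = "\<lambda>q. q + M q" and f' = "\<lambda>q. q + M' q" and T = UNIV])
  have lin: "linear M'" using has_derivative_linear[OF M'] .
  show "bounded_linear (resolvent M')" by (rule resolvent_linear_bound[OF lin b c])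
  have contr': "norm (M' x - M' y) \<le> c * norm (x - y)" for x y
    using b[of "x - y"] by (simp add: linear_diff[OF lin])
  show "resolvent M' \<circ> (\<lambda>q. q + M' q) = id"
    by (auto simp: fun_eq_iff intro!: resolvent_unique[OF contr' c])
  have "(1 / (1 - c))-lipschitz_on UNIV (resolvent M)"
    using resolvent_lipschitz[OF contr c] c by (auto intro!: lipschitz_onI simp: dist_norm)
  then show "continuous (at p) (resolvent M)"
    using lipschitz_on_continuous_on continuous_on_eq_continuous_at open_UNIV by blast
  show "((\<lambda>q. q + M q) has_derivative (\<lambda>q. q + M' q)) (at (resolvent M p))"
    by (intro derivative_intros M')
qed (use resolvent_eq[OF contr c] in auto)

text \<open>A path \<open>q\<close> with initial position \<open>x\<close> and velocity \<open>v\<close> solves \<open>q + K (N q) = \<iota> x + T \<theta> v\<close>: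
  \<open>\<iota> x\<close> is the constant path, \<open>\<theta> v\<close> the linear path from \<open>0\<close> to \<open>v\<close>, \<open>N\<close> is composition with the
  gradient, \<open>K\<close> is twofold integration in time, and \<open>ev\<close> is the endpoint.\<close>

locale path_equation =
  fixes K :: "'p::banach \<Rightarrow> 'p" and N :: "'p \<Rightarrow> 'p" and N' :: "'p \<Rightarrow> 'p \<Rightarrow> 'p"
    and \<iota> \<theta> :: "'a::real_normed_vector \<Rightarrow> 'p" and ev :: "'p \<Rightarrow> 'a" and T L LH :: real
  assumes K: "bounded_linear K" and K_le: "\<And>p. norm (K p) \<le> T\<^sup>2 * norm p"
    and N': "\<And>q. (N has_derivative N' q) (at q)"
    and N'_le: "\<And>q d. norm (N' q d) \<le> L * norm d"
    and N'_lip: "\<And>q r d. norm (N' q d - N' r d) \<le> LH * norm (q - r) * norm d"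
    and \<iota>: "bounded_linear \<iota>" and \<theta>: "bounded_linear \<theta>" and ev: "bounded_linear ev"
    and ev_\<iota>: "\<And>x. ev (\<iota> x) = x" and ev_\<theta>: "\<And>x. ev (\<theta> x) = x"
    and \<iota>_le: "\<And>x. norm (\<iota> x) \<le> norm x" and \<theta>_le: "\<And>x. norm (\<theta> x) \<le> norm x"
    and \<iota>\<theta>_le: "\<And>x. norm (\<iota> x - \<theta> x) \<le> norm x" and ev_le: "\<And>p. norm (ev p) \<le> norm p"
    and T: "0 < T" and L: "0 \<le> L" and LH: "0 \<le> LH" and LT: "L * T\<^sup>2 \<le> 1/6"
begin

section \<open>Initial and boundary value problems for paths\<close>

definition ivp :: "'a \<Rightarrow> 'a \<Rightarrow> 'p" where
  "ivp x v = resolvent (\<lambda>q. K (N q)) (\<iota> x + T *\<^sub>R \<theta> v)"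

definition endpoint :: "'a \<Rightarrow> 'a \<Rightarrow> 'a" where
  "endpoint x v = ev (ivp x v)"

text \<open>The Green operator of the two-point problem: subtracting the linear path to the final
  value makes \<open>K0 p\<close> vanish at the endpoint. The subtraction at most doubles the
  norm.\<close>

definition K0 :: "'p \<Rightarrow> 'p" where
  "K0 p = K p - \<theta> (ev (K p))"

definition bvp :: "'a \<Rightarrow> 'a \<Rightarrow> 'p" where
  "bvp x z = resolvent (\<lambda>q. K0 (N q)) (\<iota> x + \<theta> (z - x))"

text \<open>The endpoint relation \<open>z = x + T *\<^sub>R v - ev (K (N q))\<close> solved for
  \<open>v\<close> along the boundary value path.\<close>

definition velocity :: "'a \<Rightarrow> 'a \<Rightarrow> 'a" where
  "velocity x z = (z - x + ev (K (N (bvp x z)))) /\<^sub>R T"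

definition endpoint' :: "'a \<Rightarrow> 'a \<Rightarrow> 'a \<Rightarrow> 'a" where
  "endpoint' x v b = ev (resolvent (\<lambda>d. K (N' (ivp x v) d)) (T *\<^sub>R \<theta> b))"

definition bvp' :: "'a \<Rightarrow> 'a \<Rightarrow> 'a \<Rightarrow> 'p" where
  "bvp' x z b = resolvent (\<lambda>d. K0 (N' (bvp x z) d)) (\<theta> b)"

definition velocity' :: "'a \<Rightarrow> 'a \<Rightarrow> 'a \<Rightarrow> 'a" where
  "velocity' x z b = (b + ev (K (N' (bvp x z) (bvp' x z b)))) /\<^sub>R T"

lemmas lin_simps = linear_add linear_diff linear_scale
lemmas linK = bounded_linear.linear[OF K]
lemmas lin\<iota> = bounded_linear.linear[OF \<iota>]
lemmas lin\<theta> = bounded_linear.linear[OF \<theta>]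
lemmas linev = bounded_linear.linear[OF ev]

lemma linN': "linear (N' q)"
  using has_derivative_linear[OF N'] .

lemma N_lip: "norm (N q - N r) \<le> L * norm (q - r)"
proof -
  have "onorm (N' q) \<le> L" for q by (rule onorm_bound[OF L N'_le])
  then show ?thesis
    using differentiable_bound[of UNIV N N' L q r] N' by (auto intro: has_derivative_at_withinI)
qed

lemma K0: "bounded_linear K0"
  unfolding K0_def using K \<theta> ev
  by (intro bounded_linear_sub bounded_linear_compose[OF \<theta>] bounded_linear_compose[OF ev] K)

lemmas linK0 = bounded_linear.linear[OF K0]

lemma K0_le: "norm (K0 p) \<le> 2 * T\<^sup>2 * norm p"
proof -
  have "norm (K0 p) \<le> norm (K p) + norm (\<theta> (ev (K p)))" unfolding K0_def by (rule norm_triangle_ineq4)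
  also have "norm (\<theta> (ev (K p))) \<le> norm (K p)" using \<theta>_le ev_le order_trans by blast
  finally show ?thesis using K_le[of p] by linarith
qed

lemma evK_le: "norm (ev (K p)) \<le> T\<^sup>2 * norm p"
  using ev_le K_le order_trans by blast

text \<open>All contraction constants come from here: \<open>1/6\<close> for \<open>K\<close>, and
  \<open>1/3\<close> for \<open>K0\<close>, whose bound is twice as large.\<close>

lemma KL_le: assumes "norm a \<le> L * b" "0 \<le> b" shows "T\<^sup>2 * norm a \<le> 1/6 * b"
proof -
  have "T\<^sup>2 * norm a \<le> T\<^sup>2 * (L * b)" using assms by (intro mult_left_mono) auto
  also have "\<dots> = L * T\<^sup>2 * b" by simp
  also have "\<dots> \<le> 1/6 * b" using LT assms(2) by (rule mult_right_mono)
  finally show ?thesis .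
qed

lemma KN_contr: "norm (K (N q) - K (N r)) \<le> 1/6 * norm (q - r)"
  using K_le[of "N q - N r"] KL_le[OF N_lip, of q r] by (simp add: linear_diff[OF linK])

lemma K0N_contr: "norm (K0 (N q) - K0 (N r)) \<le> 1/3 * norm (q - r)"
  using K0_le[of "N q - N r"] KL_le[OF N_lip, of q r] by (simp add: linear_diff[OF linK0])

lemma KN'_le: "norm (K (N' q d)) \<le> 1/6 * norm d"
  using K_le[of "N' q d"] KL_le[OF N'_le, of d q] by simp

lemma K0N'_le: "norm (K0 (N' q d)) \<le> 1/3 * norm d"
  using K0_le[of "N' q d"] KL_le[OF N'_le, of d q] by simp

lemma ivp_eq: "ivp x v + K (N (ivp x v)) = \<iota> x + T *\<^sub>R \<theta> v"
  unfolding ivp_def by (rule resolvent_eq[OF KN_contr]) auto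

lemma ivp_unique: "q + K (N q) = \<iota> x + T *\<^sub>R \<theta> v \<Longrightarrow> ivp x v = q"
  unfolding ivp_def by (rule resolvent_unique[OF KN_contr]) auto

lemma bvp_eq: "bvp x z + K0 (N (bvp x z)) = \<iota> x + \<theta> (z - x)"
  unfolding bvp_def by (rule resolvent_eq[OF K0N_contr]) auto

lemma bvp_unique: "q + K0 (N q) = \<iota> x + \<theta> (z - x) \<Longrightarrow> bvp x z = q"
  unfolding bvp_def by (rule resolvent_unique[OF K0N_contr]) auto

lemma endpoint_eq: "endpoint x v + ev (K (N (ivp x v))) = x + T *\<^sub>R v"
  using arg_cong[OF ivp_eq[of x v], of ev]
  by (simp add: endpoint_def lin_simps[OF linev] ev_\<iota> ev_\<theta>)

text \<open>Moving the correction \<open>\<theta> (ev (K (N q)))\<close> to the right side turns the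
  boundary value equation into the initial value equation with this very velocity. Read backwards,
  the same step shows that the two maps are inverse to each other, with no recourse to an inverse
  function theorem.\<close>

lemma endpoint_velocity: "endpoint x (velocity x z) = z"
proof -
  let ?q = "bvp x z"
  have "ev ?q + ev (K0 (N ?q)) = z"
    using arg_cong[OF bvp_eq[of x z], of ev] by (simp add: lin_simps[OF linev] ev_\<iota> ev_\<theta>)
  then have z: "ev ?q = z" by (simp add: K0_def lin_simps[OF linev] ev_\<theta>)
  have "?q + K (N ?q) = \<iota> x + \<theta> (z - x) + \<theta> (ev (K (N ?q)))"
    using bvp_eq[of x z] by (simp add: K0_def algebra_simps)
  also have "\<dots> = \<iota> x + T *\<^sub>R \<theta> (velocity x z)"
    using T by (simp add: velocity_def lin_simps[OF lin\<theta>])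
  finally show ?thesis using ivp_unique z by (metis endpoint_def)
qed

lemma velocity_endpoint: "velocity x (endpoint x v) = v"
proof -
  let ?q = "ivp x v"
  have "T *\<^sub>R v = endpoint x v - x + ev (K (N ?q))" using endpoint_eq[of x v] by (simp add: algebra_simps)
  then have "T *\<^sub>R \<theta> v = \<theta> (endpoint x v - x) + \<theta> (ev (K (N ?q)))"
    by (metis linear_add[OF lin\<theta>] linear_scale[OF lin\<theta>])
  then have "?q + K0 (N ?q) = \<iota> x + \<theta> (endpoint x v - x)"
    using ivp_eq[of x v] by (simp add: K0_def algebra_simps)
  then have "bvp x (endpoint x v) = ?q" by (rule bvp_unique)
  then show ?thesis using endpoint_eq[of x v] T by (simp add: velocity_def algebra_simps)
qed

text \<open>The factor is \<open>1 / (1 - 1/6)\<close>. Joint dependence on position and velocity is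
  included because the measurability of the kernel rests on it.\<close>

lemma endpoint_lipschitz:
  "norm (endpoint x v - endpoint y w) \<le> 6/5 * (norm (x - y) + T * norm (v - w))"
proof -
  have "norm (endpoint x v - endpoint y w) \<le> norm (ivp x v - ivp y w)"
    unfolding endpoint_def using ev_le[of "ivp x v - ivp y w"] by (simp add: lin_simps[OF linev])
  also have "\<dots> \<le> norm ((\<iota> x + T *\<^sub>R \<theta> v) - (\<iota> y + T *\<^sub>R \<theta> w)) / (1 - 1/6)"
    unfolding ivp_def by (rule resolvent_lipschitz[OF KN_contr]) auto
  also have "(\<iota> x + T *\<^sub>R \<theta> v) - (\<iota> y + T *\<^sub>R \<theta> w) = \<iota> (x - y) + T *\<^sub>R \<theta> (v - w)"
    by (simp add: lin_simps[OF lin\<iota>] lin_simps[OF lin\<theta>] algebra_simps)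
  also have "norm \<dots> \<le> norm (x - y) + T * norm (v - w)"
  proof (rule order_trans[OF norm_triangle_ineq add_mono[OF \<iota>_le]])
    show "norm (T *\<^sub>R \<theta> (v - w)) \<le> T * norm (v - w)"
      using T by (simp add: \<theta>_le)
  qed
  finally show ?thesis by (simp add: divide_right_mono)
qed

text \<open>With the endpoint held fixed, the data differ by a path that falls linearly from
  \<open>x - y\<close> to 0, so by at most \<open>norm (x - y)\<close>; the factor is
  \<open>1 / (1 - 1/3)\<close>.\<close>

lemma bvp_lipschitz: "norm (bvp x z - bvp y z) \<le> 3/2 * norm (x - y)"
proof -
  have "norm (bvp x z - bvp y z) \<le> norm ((\<iota> x + \<theta> (z - x)) - (\<iota> y + \<theta> (z - y))) / (1 - 1/3)"
    unfolding bvp_def by (rule resolvent_lipschitz[OF K0N_contr]) auto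
  also have "(\<iota> x + \<theta> (z - x)) - (\<iota> y + \<theta> (z - y)) = \<iota> (x - y) - \<theta> (x - y)"
    by (simp add: lin_simps[OF lin\<iota>] lin_simps[OF lin\<theta>])
  finally show ?thesis using \<iota>\<theta>_le[of "x - y"] by simp
qed

text \<open>The constant is \<open>1 + 1/6 * 3/2\<close>: the straight line contributes 1, the
  gradient along the two paths the rest.\<close>

lemma velocity_lipschitz: "norm (velocity y z - velocity x z) \<le> 5/4 / T * norm (x - y)"
proof -
  have "velocity y z - velocity x z = ((x - y) + ev (K (N (bvp y z) - N (bvp x z)))) /\<^sub>R T"
    by (simp add: velocity_def lin_simps[OF linev] lin_simps[OF linK] algebra_simps)
  moreover have "norm ((x - y) + ev (K (N (bvp y z) - N (bvp x z)))) \<le> 5/4 * norm (x - y)"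
  proof -
    have "norm (ev (K (N (bvp y z) - N (bvp x z)))) \<le> 1/6 * norm (bvp y z - bvp x z)"
      using evK_le[of "N (bvp y z) - N (bvp x z)"] KL_le[OF N_lip, of "bvp y z" "bvp x z"] by simp
    also have "\<dots> \<le> 1/6 * (3/2 * norm (x - y))"
      using bvp_lipschitz[of y z x] by (simp add: norm_minus_commute)
    finally show ?thesis using norm_triangle_ineq[of "x - y" "ev (K (N (bvp y z) - N (bvp x z)))"]
      by simp
  qed
  ultimately show ?thesis using T
    by (simp add: divide_simps mult.commute[of T] flip: divide_inverse_commute)
qed

section \<open>Derivatives in velocity and endpoint\<close>

lemma endpoint_has_derivative: "(endpoint x has_derivative endpoint' x v) (at v)"
proof -
  have KN': "((\<lambda>q. K (N q)) has_derivative (\<lambda>d. K (N' (ivp x v) d))) (at (ivp x v))"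
    by (rule bounded_linear.has_derivative[OF K N'])
  have "(resolvent (\<lambda>q. K (N q)) has_derivative resolvent (\<lambda>d. K (N' (ivp x v) d)))
      (at (\<iota> x + T *\<^sub>R \<theta> v))"
    by (rule resolvent_has_derivative[OF KN_contr]) (use KN' KN'_le in \<open>auto simp: ivp_def\<close>)
  moreover have "((\<lambda>v. \<iota> x + T *\<^sub>R \<theta> v) has_derivative (\<lambda>b. T *\<^sub>R \<theta> b)) (at v)"
    by (auto intro!: derivative_eq_intros bounded_linear_imp_has_derivative[OF \<theta>])
  ultimately have "((\<lambda>v. ivp x v) has_derivative
      (\<lambda>b. resolvent (\<lambda>d. K (N' (ivp x v) d)) (T *\<^sub>R \<theta> b))) (at v)"
    unfolding ivp_def by (rule has_derivative_compose[rotated])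
  from bounded_linear.has_derivative[OF ev this] show ?thesis
    by (simp add: endpoint_def[abs_def] endpoint'_def[abs_def])
qed

lemma endpoint'_le: "norm (endpoint' x v b) \<le> 6/5 * T * norm b"
proof -
  have lin: "linear (\<lambda>d. K (N' (ivp x v) d))"
    using linear_compose[OF linN' linK] by (simp add: o_def)
  have "norm (endpoint' x v b) \<le> norm (resolvent (\<lambda>d. K (N' (ivp x v) d)) (T *\<^sub>R \<theta> b))"
    unfolding endpoint'_def by (rule ev_le)
  also have "\<dots> \<le> norm (T *\<^sub>R \<theta> b) / (1 - 1/6)"
    by (rule resolvent_linear_bound[OF lin KN'_le]) auto
  also have "\<dots> \<le> 6/5 * T * norm b" using T mult_left_mono[OF \<theta>_le[of b], of T] by simp
  finally show ?thesis .
qed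

lemma linK0N': "linear (\<lambda>d. K0 (N' q d))"
  using linear_compose[OF linN' linK0] by (simp add: o_def)

lemma bvp_has_derivative: "(bvp x has_derivative bvp' x z) (at z)"
proof -
  have KN': "((\<lambda>q. K0 (N q)) has_derivative (\<lambda>d. K0 (N' (bvp x z) d))) (at (bvp x z))"
    by (rule bounded_linear.has_derivative[OF K0 N'])
  have "(resolvent (\<lambda>q. K0 (N q)) has_derivative resolvent (\<lambda>d. K0 (N' (bvp x z) d)))
      (at (\<iota> x + \<theta> (z - x)))"
    by (rule resolvent_has_derivative[OF K0N_contr]) (use KN' K0N'_le in \<open>auto simp: bvp_def\<close>)
  moreover have "((\<lambda>z. \<iota> x + \<theta> (z - x)) has_derivative \<theta>) (at z)"
    by (auto intro!: derivative_eq_intros bounded_linear.has_derivative[OF \<theta>])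
  ultimately show ?thesis
    unfolding bvp_def[abs_def] bvp'_def[abs_def] by (rule has_derivative_compose[rotated])
qed

lemma velocity_has_derivative: "(velocity x has_derivative velocity' x z) (at z)"
proof -
  have "((\<lambda>z. ev (K (N (bvp x z)))) has_derivative
      (\<lambda>b. ev (K (N' (bvp x z) (bvp' x z b))))) (at z)"
    by (rule bounded_linear.has_derivative[OF ev bounded_linear.has_derivative[OF K]],
        rule has_derivative_compose[OF bvp_has_derivative N'])
  then show ?thesis unfolding velocity_def[abs_def] velocity'_def[abs_def]
    by (auto intro!: derivative_eq_intros)
qed

lemma bvp'_le: "norm (bvp' x z b) \<le> 3/2 * norm b"
proof -
  have "norm (bvp' x z b) \<le> norm (\<theta> b) / (1 - 1/3)"
    unfolding bvp'_def by (rule resolvent_linear_bound[OF linK0N' K0N'_le]) auto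
  then show ?thesis using \<theta>_le[of b] by simp
qed

lemma bvp'_eq: "bvp' x z b + K0 (N' (bvp x z) (bvp' x z b)) = \<theta> b"
  unfolding bvp'_def
proof (rule resolvent_eq[where c = "1/3"])
  show "norm (K0 (N' (bvp x z) d) - K0 (N' (bvp x z) e)) \<le> 1/3 * norm (d - e)" for d e
    unfolding linear_diff[OF linK0N', symmetric] by (rule K0N'_le)
qed auto

lemma N'_bvp_diff:
  "norm (N' (bvp y z) (bvp' x z b) - N' (bvp x z) (bvp' x z b)) \<le> 9/4 * LH * norm (x - y) * norm b"
proof -
  have "norm (N' (bvp y z) (bvp' x z b) - N' (bvp x z) (bvp' x z b))
      \<le> LH * norm (bvp y z - bvp x z) * norm (bvp' x z b)" by (rule N'_lip)
  also have "\<dots> \<le> LH * (3/2 * norm (x - y)) * (3/2 * norm b)"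
    using bvp_lipschitz[of y z x] bvp'_le LH
    by (intro mult_mono mult_nonneg_nonneg) (auto simp: norm_minus_commute)
  finally show ?thesis by (simp add: mult.assoc)
qed

text \<open>The difference of two linearized solutions solves the linearized equation along
  \<open>bvp y z\<close>, with the change of the Hessian along the paths as source. The constant is
  \<open>3/2 * 2 * 9/4\<close>: resolvent, norm of \<open>K0\<close>, size of the source.\<close>

lemma bvp'_lipschitz: "norm (bvp' y z b - bvp' x z b) \<le> 27/4 * T\<^sup>2 * LH * norm (x - y) * norm b"
proof -
  let ?d = "bvp' y z b - bvp' x z b"
  let ?e = "N' (bvp y z) (bvp' x z b) - N' (bvp x z) (bvp' x z b)"
  have "?d + K0 (N' (bvp y z) ?d) = - K0 ?e"
    using bvp'_eq[of y z b] bvp'_eq[of x z b]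
    by (simp add: linear_diff[OF linN'] linear_diff[OF linK0] algebra_simps)
  then have "norm ?d \<le> norm (K0 ?e) + norm (K0 (N' (bvp y z) ?d))"
    by (metis add_diff_cancel_right' norm_minus_cancel norm_triangle_ineq4)
  also have "norm (K0 (N' (bvp y z) ?d)) \<le> 1/3 * norm ?d" by (rule K0N'_le)
  finally have "norm ?d \<le> 3/2 * norm (K0 ?e)" by simp
  also have "norm (K0 ?e) \<le> 2 * T\<^sup>2 * (9/4 * LH * norm (x - y) * norm b)"
    by (rule order_trans[OF K0_le mult_left_mono[OF N'_bvp_diff]]) simp
  finally show ?thesis by (simp add: mult_ac)
qed

text \<open>The constant is \<open>1/6 * 27/4 + 9/4\<close>, for the change of the linearized path
  and the change of the Hessian; division by \<open>T\<close> leaves one factor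
  \<open>T\<close>.\<close>

lemma velocity'_lipschitz:
  "norm (velocity' y z b - velocity' x z b) \<le> 27/8 * T * LH * norm (x - y) * norm b"
proof -
  let ?d = "bvp' y z b - bvp' x z b"
  let ?e = "N' (bvp y z) (bvp' x z b) - N' (bvp x z) (bvp' x z b)"
  have "velocity' y z b - velocity' x z b = (ev (K (N' (bvp y z) ?d)) + ev (K ?e)) /\<^sub>R T"
    by (simp add: velocity'_def linear_diff[OF linN'] linear_diff[OF linK] linear_diff[OF linev]
        algebra_simps)
  moreover have "norm (ev (K (N' (bvp y z) ?d)) + ev (K ?e))
      \<le> 1/6 * norm ?d + T\<^sup>2 * norm ?e"
    using norm_triangle_ineq[of "ev (K (N' (bvp y z) ?d))" "ev (K ?e)"] evK_le[of ?e]
      ev_le[of "K (N' (bvp y z) ?d)"] KN'_le[of "bvp y z" ?d] by linarith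
  moreover have "\<dots> \<le> 1/6 * (27/4 * T\<^sup>2 * LH * norm (x - y) * norm b)
      + T\<^sup>2 * (9/4 * LH * norm (x - y) * norm b)"
    using bvp'_lipschitz N'_bvp_diff by (intro add_mono mult_left_mono) auto
  ultimately have "norm (velocity' y z b - velocity' x z b) = inverse T * norm (ev (K (N' (bvp y z) ?d)) + ev (K ?e))"
    and le: "norm (ev (K (N' (bvp y z) ?d)) + ev (K ?e)) \<le> 27/8 * T\<^sup>2 * LH * norm (x - y) * norm b"
    using T by (simp, linarith)
  then have "norm (velocity' y z b - velocity' x z b)
     \<le> (27/8 * T\<^sup>2 * LH * norm (x - y) * norm b) / T"
    using T mult_left_mono[OF le, of "inverse T"] by (simp add: field_simps)
  also have "\<dots> = 27/8 * T * LH * norm (x - y) * norm b" using T by (simp add: power2_eq_square)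
  finally show ?thesis .
qed

lemma velocity'_endpoint': "velocity' x (endpoint x v) (endpoint' x v b) = b"
proof -
  have "((\<lambda>v. velocity x (endpoint x v)) has_derivative
      (\<lambda>b. velocity' x (endpoint x v) (endpoint' x v b))) (at v)"
    by (rule has_derivative_compose[OF endpoint_has_derivative velocity_has_derivative])
  moreover have "((\<lambda>v. velocity x (endpoint x v)) has_derivative (\<lambda>b. b)) (at v)"
    by (simp add: velocity_endpoint)
  ultimately show ?thesis by (metis has_derivative_unique)
qed

section \<open>The one-shot coupling of velocities\<close>

definition coupling :: "'a \<Rightarrow> 'a \<Rightarrow> 'a \<Rightarrow> 'a" where
  "coupling x y v = velocity y (endpoint x v)"

lemma endpoint_coupling: "endpoint y (coupling x y v) = endpoint x v"
  by (simp add: coupling_def endpoint_velocity)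

lemma bij_coupling: "bij (coupling x y)"
  by (rule bij_betw_byWitness[where f' = "coupling y x"])
    (auto simp: coupling_def endpoint_velocity velocity_endpoint)

lemma coupling_dist: "norm (coupling x y v - v) \<le> 5/4 / T * norm (x - y)"
  using velocity_lipschitz[of y "endpoint x v" x] by (simp add: coupling_def velocity_endpoint)

text \<open>Since \<open>velocity' x\<close> undoes \<open>endpoint' x\<close>, subtracting the
  identity leaves the difference of \<open>velocity' y\<close> and \<open>velocity' x\<close> at the
  same endpoint, applied to \<open>endpoint' x v b\<close>. The constant is
  \<open>27/8 * 6/5\<close>.\<close>

lemma coupling_has_derivative:
  obtains A where "\<And>v. (coupling x y has_derivative (\<lambda>b. b + A v b)) (at v)"
    and "\<And>v b. norm (A v b) \<le> 81/20 * T\<^sup>2 * LH * norm (x - y) * norm b"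
proof
  fix v
  let ?z = "endpoint x v" and ?E = "endpoint' x v"
  let ?A = "\<lambda>v b. velocity' y (endpoint x v) (endpoint' x v b)
      - velocity' x (endpoint x v) (endpoint' x v b)"
  have "(coupling x y has_derivative (\<lambda>b. velocity' y ?z (?E b))) (at v)"
    unfolding coupling_def
    by (rule has_derivative_compose[OF endpoint_has_derivative velocity_has_derivative])
  then show "(coupling x y has_derivative (\<lambda>b. b + ?A v b)) (at v)"
    by (simp add: velocity'_endpoint')
  fix b
  have "norm (?A v b) \<le> 27/8 * T * LH * norm (x - y) * norm (?E b)"
    by (rule velocity'_lipschitz)
  also have "\<dots> \<le> 27/8 * T * LH * norm (x - y) * (6/5 * T * norm b)"
    using T LH by (intro mult_left_mono endpoint'_le) auto
  finally show "norm (?A v b) \<le> 81/20 * T\<^sup>2 * LH * norm (x - y) * norm b"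
    by (simp add: power2_eq_square mult_ac)
qed

end

section \<open>Paths as bounded continuous functions\<close>

instance bcontfun :: (metric_space, banach) banach ..

lemma apply_Bcontfun:
  "continuous_on UNIV f \<Longrightarrow> (\<And>s. norm (f s) \<le> B) \<Longrightarrow> apply_bcontfun (Bcontfun f) = f"
  by (rule Bcontfun_inverse) (rule bcontfun_normI)

lemma bounded_linear_bcontfun:
  fixes f :: "'b::real_normed_vector \<Rightarrow> ('s::topological_space \<Rightarrow>\<^sub>C 'a::real_normed_vector)"
  assumes "\<And>x y s. f (x + y) s = f x s + f y s" and "\<And>r x s. f (r *\<^sub>R x) s = r *\<^sub>R f x s"
    and "\<And>x s. norm (f x s) \<le> norm x * C"
  shows "bounded_linear f"
  by (rule bounded_linear_intro[where K = C]) (auto intro!: bcontfun_eqI norm_bound assms simp: assms)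

text \<open>The bounds on the second and third derivative of the potential enter only as boundedness
  and Lipschitz continuity of \<open>H\<close>.\<close>

locale smooth_gradient =
  fixes g :: "'a::euclidean_space \<Rightarrow> 'a" and H :: "'a \<Rightarrow> 'a \<Rightarrow> 'a" and L LH :: real
  assumes g': "\<And>x. (g has_derivative H x) (at x)"
    and H_le: "\<And>x u. norm (H x u) \<le> L * norm u"
    and H_lip: "\<And>x y u. norm (H x u - H y u) \<le> LH * norm (x - y) * norm u"
    and L: "0 \<le> L" and LH: "0 \<le> LH"
begin

lemma linH: "linear (H x)"
  using has_derivative_linear[OF g'] .

lemma g_lip: "norm (g x - g y) \<le> L * norm (x - y)"
  using differentiable_bound[of UNIV g H L x y] g' onorm_bound[OF L H_le]
  by (auto intro: has_derivative_at_withinI)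

lemma continuous_g: "continuous_on S g"
  using g' by (meson has_derivative_continuous_on has_derivative_at_withinI)

text \<open>The remainder is uniform in \<open>x\<close> and \<open>y\<close>; this is what makes
  composition with \<open>g\<close> differentiable in the supremum norm.\<close>

lemma g_taylor: "norm (g y - g x - H x (y - x)) \<le> LH * norm (y - x) * norm (y - x)"
proof -
  have "norm (g y - g x - H x (y - x)) \<le> norm (y - x) * (LH * norm (y - x))"
  proof (rule differentiable_bound_linearization[where S = "cball x (norm (y - x))" and f' = H and ?x0.0 = x])
    show "x + t *\<^sub>R (y - x) \<in> cball x (norm (y - x))" if "t \<in> {0..1}" for t
      using that by (auto simp: dist_norm mult_left_le_one_le)
    show "onorm (H z - H x) \<le> LH * norm (y - x)" if "z \<in> cball x (norm (y - x))" for z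
    proof (rule onorm_bound)
      show "norm ((H z - H x) u) \<le> LH * norm (y - x) * norm u" for u
        unfolding minus_apply using that LH by (intro order_trans[OF H_lip] mult_right_mono mult_left_mono)
          (auto simp: dist_norm norm_minus_commute)
    qed (use LH in simp)
  qed (use g' in \<open>auto intro: has_derivative_at_withinI\<close>)
  then show ?thesis by (simp add: mult_ac)
qed

text \<open>The time domain is left open: \<open>real\<close> serves the flow,
  \<open>nat discrete\<close> the scheme.\<close>

definition compose_g :: "('s::metric_space \<Rightarrow>\<^sub>C 'a) \<Rightarrow> ('s \<Rightarrow>\<^sub>C 'a)" where
  "compose_g q = Bcontfun (\<lambda>s. g (q s))"

definition compose_H :: "('s::metric_space \<Rightarrow>\<^sub>C 'a) \<Rightarrow> ('s \<Rightarrow>\<^sub>C 'a) \<Rightarrow> ('s \<Rightarrow>\<^sub>C 'a)" where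
  "compose_H q d = Bcontfun (\<lambda>s. H (q s) (d s))"

lemma compose_g_apply: "compose_g q s = g (q s)"
proof -
  have "norm (g (q s)) \<le> norm (g 0) + L * norm q" for s
  proof -
    have "norm (g (q s)) \<le> norm (g 0) + norm (g (q s) - g 0)" using norm_triangle_sub by blast
    also have "norm (g (q s) - g 0) \<le> L * norm q"
      by (rule order_trans[OF g_lip]) (use L norm_bounded[of q s] in \<open>simp add: mult_left_mono\<close>)
    finally show ?thesis by simp
  qed
  moreover have "continuous_on UNIV (\<lambda>s. g (q s))"
    by (rule continuous_on_compose2[OF continuous_g[of UNIV]]) auto
  ultimately show ?thesis unfolding compose_g_def by (subst apply_Bcontfun) auto
qed

lemma continuous_H_pair: "continuous_on UNIV (\<lambda>s. H (p s) (d s))"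
  if p: "continuous_on UNIV p" and d: "continuous_on UNIV d" for p d :: "'s::metric_space \<Rightarrow> 'a"
proof -
  have "((\<lambda>s. H (p s) (d s)) \<longlongrightarrow> H (p t) (d t)) (at t)" for t
  proof -
    have pt: "(p \<longlongrightarrow> p t) (at t)" and dt: "(d \<longlongrightarrow> d t) (at t)"
      using p d by (auto simp: continuous_on_def)
    have "((\<lambda>s. H (p s) (d s) - H (p t) (d t)) \<longlongrightarrow> 0) (at t)"
    proof (rule Lim_null_comparison)
      show "\<forall>\<^sub>F s in at t. norm (H (p s) (d s) - H (p t) (d t))
          \<le> LH * norm (p s - p t) * norm (d s) + L * norm (d s - d t)"
      proof (intro always_eventually allI)
        fix s
        have "norm (H (p s) (d s) - H (p t) (d t)) = norm ((H (p s) (d s) - H (p t) (d s)) + H (p t) (d s - d t))"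
          by (simp add: linear_diff[OF linH])
        then show "norm (H (p s) (d s) - H (p t) (d t))
            \<le> LH * norm (p s - p t) * norm (d s) + L * norm (d s - d t)"
          using norm_triangle_ineq[of "H (p s) (d s) - H (p t) (d s)" "H (p t) (d s - d t)"]
            H_lip[of "p s" "d s" "p t"] H_le[of "p t" "d s - d t"] by linarith
      qed
      have "((\<lambda>s. LH * norm (p s - p t) * norm (d s) + L * norm (d s - d t)) \<longlongrightarrow>
          LH * norm (p t - p t) * norm (d t) + L * norm (d t - d t)) (at t)"
        by (intro tendsto_intros pt dt)
      then show "((\<lambda>s. LH * norm (p s - p t) * norm (d s) + L * norm (d s - d t)) \<longlongrightarrow> 0) (at t)"
        by simp
    qed
    then show ?thesis by (simp add: LIM_zero_iff)
  qed
  then show ?thesis by (simp add: continuous_on_def)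
qed

lemma compose_H_apply: "compose_H q d s = H (q s) (d s)"
proof -
  have "norm (H (q s) (d s)) \<le> L * norm d" for s
    by (rule order_trans[OF H_le]) (use L norm_bounded[of d s] in \<open>simp add: mult_left_mono\<close>)
  then show ?thesis unfolding compose_H_def by (subst apply_Bcontfun) (auto intro: continuous_H_pair)
qed

lemma compose_H_le: "norm (compose_H q d) \<le> L * norm d"
proof (rule norm_bound)
  show "norm (compose_H q d s) \<le> L * norm d" for s
    unfolding compose_H_apply
    by (rule order_trans[OF H_le]) (use L norm_bounded[of d s] in \<open>simp add: mult_left_mono\<close>)
qed

lemma compose_H_lip: "norm (compose_H q d - compose_H r d) \<le> LH * norm (q - r) * norm d"
proof (rule norm_bound)
  fix s
  have "norm (H (q s) (d s) - H (r s) (d s)) \<le> LH * norm (q s - r s) * norm (d s)" by (rule H_lip)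
  also have "\<dots> \<le> LH * norm (q - r) * norm d"
    using LH norm_bounded[of "q - r" s] norm_bounded[of d s] by (intro mult_mono) (auto intro: mult_left_mono)
  finally show "norm ((compose_H q d - compose_H r d) s) \<le> LH * norm (q - r) * norm d"
    by (simp add: compose_H_apply)
qed

lemma compose_g_has_derivative: "(compose_g has_derivative compose_H q) (at q)"
  unfolding has_derivative_at_alt
proof (intro conjI allI impI)
  show "bounded_linear (compose_H q)"
    using compose_H_le[of q]
    by (intro bounded_linear_intro[where K = L] bcontfun_eqI)
      (auto simp: compose_H_apply linear_add[OF linH] linear_scale[OF linH] mult.commute)
  fix e :: real assume e: "e > 0"
  show "\<exists>d>0. \<forall>r. norm (r - q) < d \<longrightarrow>
      norm (compose_g r - compose_g q - compose_H q (r - q)) \<le> e * norm (r - q)"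
  \<comment> \<open>The summand 1 covers the case \<open>LH = 0\<close>.\<close>
  proof (intro exI[of _ "e / (LH + 1)"] conjI allI impI)
    show "0 < e / (LH + 1)" using e LH by simp
    fix r assume r: "norm (r - q) < e / (LH + 1)"
    show "norm (compose_g r - compose_g q - compose_H q (r - q)) \<le> e * norm (r - q)"
    proof (rule norm_bound)
      fix s
      have "norm (g (r s) - g (q s) - H (q s) (r s - q s)) \<le> LH * norm (r s - q s) * norm (r s - q s)"
        by (rule g_taylor)
      also have "\<dots> \<le> LH * norm (r - q) * norm (r - q)"
        using LH norm_bounded[of "r - q" s] by (intro mult_mono) (auto intro: mult_left_mono)
      also have "\<dots> \<le> e * norm (r - q)"
      proof (rule mult_right_mono)
        have "LH * norm (r - q) \<le> (LH + 1) * norm (r - q)" by (simp add: mult_right_mono)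
        also have "\<dots> \<le> e" using r LH by (simp add: field_simps)
        finally show "LH * norm (r - q) \<le> e" .
      qed simp
      finally show "norm ((compose_g r - compose_g q - compose_H q (r - q)) s) \<le> e * norm (r - q)"
        by (simp add: compose_g_apply compose_H_apply)
    qed
  qed
qed

definition ramp :: "('s::metric_space \<Rightarrow> real) \<Rightarrow> 'a \<Rightarrow> ('s \<Rightarrow>\<^sub>C 'a)" where
  "ramp \<tau> b = Bcontfun (\<lambda>s. \<tau> s *\<^sub>R b)"

lemma ramp_apply:
  assumes "continuous_on UNIV \<tau>" and "\<And>s. 0 \<le> \<tau> s" "\<And>s. \<tau> s \<le> 1"
  shows "ramp \<tau> b s = \<tau> s *\<^sub>R b"
  unfolding ramp_def using assms
  by (subst apply_Bcontfun[of _ "norm b"])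
    (auto intro!: continuous_intros mult_left_le_one_le)

text \<open>Flow and scheme differ only in the time domain, the integration operator
  \<open>K\<close>, the normalized time \<open>\<tau>\<close> and the final time
  \<open>e\<close>.\<close>

lemma path_equation_bcontfun:
  fixes K :: "('s::metric_space \<Rightarrow>\<^sub>C 'a) \<Rightarrow> ('s \<Rightarrow>\<^sub>C 'a)" and \<tau> :: "'s \<Rightarrow> real"
  assumes K: "bounded_linear K" "\<And>p. norm (K p) \<le> T\<^sup>2 * norm p"
    and \<tau>: "continuous_on UNIV \<tau>" "\<And>s. 0 \<le> \<tau> s" "\<And>s. \<tau> s \<le> 1" "\<tau> e = 1"
    and T: "0 < T" "L * T\<^sup>2 \<le> 1/6"
  shows "path_equation K compose_g compose_H const_bcontfun (ramp \<tau>) (\<lambda>p. p e) T L LH"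
proof (rule path_equation.intro)
  note R = ramp_apply[OF \<tau>(1-3)]
  show "bounded_linear K" by fact
  show "norm (K p) \<le> T\<^sup>2 * norm p" for p by fact
  show "bounded_linear (const_bcontfun :: 'a \<Rightarrow> ('s \<Rightarrow>\<^sub>C 'a))"
    by (rule bounded_linear_bcontfun[where C = 1]) (auto simp: const_bcontfun.rep_eq)
  show th: "norm (ramp \<tau> b) \<le> norm b" for b
    by (rule norm_bound) (use \<tau> in \<open>auto simp: R mult_left_le_one_le\<close>)
  show "bounded_linear (ramp \<tau>)"
    using \<tau> by (intro bounded_linear_bcontfun[where C = 1])
      (auto simp: R scaleR_add_right mult_left_le_one_le)
  show "bounded_linear (\<lambda>p::'s \<Rightarrow>\<^sub>C 'a. p e)"
    by (rule bounded_linear_intro[where K = 1]) (auto simp: norm_bounded)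
  show "norm (const_bcontfun x :: 's \<Rightarrow>\<^sub>C 'a) \<le> norm x" for x :: 'a
    by (rule norm_bound) (simp add: const_bcontfun.rep_eq)
  show "norm (const_bcontfun x - ramp \<tau> x) \<le> norm x" for x
  proof (rule norm_bound)
    fix s
    have "(const_bcontfun x - ramp \<tau> x) s = (1 - \<tau> s) *\<^sub>R x"
      by (simp add: const_bcontfun.rep_eq R scaleR_diff_left)
    then show "norm ((const_bcontfun x - ramp \<tau> x) s) \<le> norm x"
      using \<tau>(2,3)[of s] by (simp add: mult_left_le_one_le)
  qed
qed (use compose_g_has_derivative compose_H_le compose_H_lip L LH T \<tau>(4) ramp_apply[OF \<tau>(1-3)] in
  \<open>auto simp: const_bcontfun.rep_eq norm_bounded\<close>)

end

section \<open>The exact Hamiltonian flow\<close>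

lemma at_within_atLeast_eq:
  fixes t b :: real assumes "t < b"
  shows "at t within {a..} = at t within {a..b}"
  by (rule at_within_nhd[of t "{..<b}"]) (use assms in auto)

text \<open>Integration gains a factor \<open>1 / l\<close> against the weight
  \<open>exp (l * s)\<close>, however long the interval is.\<close>

lemma norm_integral_exp_le:
  fixes \<phi> :: "real \<Rightarrow> 'b::banach"
  assumes \<phi>: "continuous_on {0..t} \<phi>" and b: "\<And>s. 0 \<le> s \<Longrightarrow> s \<le> t \<Longrightarrow> norm (\<phi> s) \<le> C * exp (l * s)"
    and t: "0 \<le> t" and l: "0 < l" and C: "0 \<le> C"
  shows "norm (integral {0..t} \<phi>) \<le> C * exp (l * t) / l"
proof -
  have hi: "((\<lambda>s. C * exp (l * s)) has_integral (C * exp (l * t) / l - C * exp (l * 0) / l)) {0..t}"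
    by (rule fundamental_theorem_of_calculus[OF t])
      (use l in \<open>auto intro!: derivative_eq_intros simp flip: has_real_derivative_iff_has_vector_derivative\<close>)
  have "norm (integral {0..t} \<phi>) \<le> integral {0..t} (\<lambda>s. C * exp (l * s))"
    using \<phi> b hi by (intro integral_norm_bound_integral) (auto intro: integrable_continuous_real)
  also have "\<dots> = C * exp (l * t) / l - C / l" using integral_unique[OF hi] by simp
  also have "\<dots> \<le> C * exp (l * t) / l" using C l by simp
  finally show ?thesis .
qed

text \<open>Picard iteration in the exponentially weighted supremum norm, which makes it a contraction on
  the whole half-line.\<close>

lemma lipschitz_ode_global_solution:
  fixes f :: "'b::banach \<Rightarrow> 'b"
  assumes lip: "\<And>x y. norm (f x - f y) \<le> M * norm (x - y)" and M: "0 \<le> M"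
  obtains z where "z 0 = z0"
    and "\<And>t. 0 \<le> t \<Longrightarrow> (z has_vector_derivative f (z t)) (at t within {0..})"
proof -
  \<comment> \<open>This makes \<open>M / l\<close> at most \<open>1/2\<close> and keeps
    \<open>l\<close> positive when \<open>M = 0\<close>.\<close>
  define l where "l = 2 * M + 1"
  have l: "0 < l" "2 * M \<le> l" using M by (auto simp: l_def)
  have cf: "continuous_on S f" for S
    by (rule lipschitz_on_continuous_on[of M], rule lipschitz_onI)
      (use lip M in \<open>auto simp: dist_norm\<close>)
  \<comment> \<open>The unknown \<open>u\<close> stands for the damped path
    \<open>exp (- l * t) *\<^sub>R z t\<close>, which is bounded even where \<open>z\<close> grows
    exponentially.\<close>
  define h where "h u s = f (exp (l * s) *\<^sub>R apply_bcontfun u s)" for u :: "real \<Rightarrow>\<^sub>C 'b" and s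
  have ch: "continuous_on S (h u)" for u S
    unfolding h_def by (rule continuous_on_compose2[OF cf[of UNIV]]) (auto intro!: continuous_intros)
  \<comment> \<open>Clamping time at 0 continues the path by the constant \<open>z0\<close>, so the
    iteration acts on functions on the whole line.\<close>
  define G where "G u t = exp (- l * max 0 t) *\<^sub>R (z0 + integral {0..max 0 t} (h u))" for u t
  have cint: "continuous_on UNIV (\<lambda>t. integral {0..max 0 t} (h u))" for u
  proof -
    have "isCont (\<lambda>t. integral {0..max 0 t} (h u)) t" for t
    proof -
      have "continuous_on {0..\<bar>t\<bar> + 1} (\<lambda>t. integral {0..t} (h u))"
        by (intro indefinite_integral_continuous_1 integrable_continuous_real ch)
      then have "continuous_on {-1 - \<bar>t\<bar><..<\<bar>t\<bar> + 1} (\<lambda>t. integral {0..max 0 t} (h u))"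
        by (rule continuous_on_compose2) (auto intro!: continuous_intros)
      then show ?thesis by (rule continuous_on_interior) auto
    qed
    then show ?thesis by (simp add: continuous_at_imp_continuous_on)
  qed
  have cG: "continuous_on UNIV (G u)" for u
    unfolding G_def by (intro continuous_intros cint)
  have hb: "norm (h u s) \<le> (norm (f 0) + M * norm u) * exp (l * s)" if "0 \<le> s" for u s
  proof -
    have "norm (h u s) \<le> norm (f 0) + norm (h u s - f 0)" using norm_triangle_sub by blast
    also have "norm (h u s - f 0) \<le> M * (exp (l * s) * norm u)"
      unfolding h_def by (rule order_trans[OF lip]) (use M norm_bounded[of u s] in \<open>auto intro!: mult_left_mono\<close>)
    finally have "norm (h u s) \<le> norm (f 0) + M * (exp (l * s) * norm u)" by simp
    moreover have "norm (f 0) * 1 \<le> norm (f 0) * exp (l * s)"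
      using that l by (intro mult_left_mono) auto
    ultimately show ?thesis by (simp add: algebra_simps)
  qed
  have hd: "norm (h u s - h w s) \<le> M * norm (u - w) * exp (l * s)" for u w s
  proof -
    have "norm (h u s - h w s) \<le> M * norm (exp (l * s) *\<^sub>R ((u - w) s))"
      unfolding h_def by (rule order_trans[OF lip]) (simp add: scaleR_diff_right)
    also have "\<dots> \<le> M * (exp (l * s) * norm (u - w))"
      using M norm_bounded[of "u - w" s] by (auto intro!: mult_left_mono simp del: minus_bcontfun.rep_eq)
    finally show ?thesis by (simp add: mult_ac)
  qed
  have Gb: "norm (G u t) \<le> norm z0 + (norm (f 0) + M * norm u) / l" for u t
  proof -
    let ?t = "max 0 t" and ?C = "norm (f 0) + M * norm u"
    have "norm (integral {0..?t} (h u)) \<le> ?C * exp (l * ?t) / l"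
      using hb ch M l by (intro norm_integral_exp_le) auto
    then have "norm (z0 + integral {0..?t} (h u)) \<le> norm z0 + ?C * exp (l * ?t) / l"
      using norm_triangle_ineq[of z0 "integral {0..?t} (h u)"] by linarith
    then have "norm (G u t) \<le> exp (- l * ?t) * (norm z0 + ?C * exp (l * ?t) / l)"
      unfolding G_def by simp
    also have "\<dots> = exp (- l * ?t) * norm z0 + ?C / l"
      by (simp add: exp_minus field_simps)
    also have "exp (- l * ?t) * norm z0 \<le> 1 * norm z0" using l by (intro mult_right_mono) auto
    finally show ?thesis by simp
  qed
  define G' where "G' u = Bcontfun (G u)" for u
  have G': "apply_bcontfun (G' u) = G u" for u unfolding G'_def by (rule apply_Bcontfun[OF cG Gb])
  have "\<exists>!u. G' u = u"
  proof (rule banach_fix_type[of "1/2"])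
    have "norm (G' u - G' w) \<le> 1/2 * norm (u - w)" for u w
    proof (rule norm_bound)
      fix t :: real
      let ?t = "max 0 t"
      have i: "h u integrable_on {0..?t}" for u by (intro integrable_continuous_real ch)
      have I1: "norm (integral {0..?t} (\<lambda>s. h u s - h w s)) \<le> M * norm (u - w) * exp (l * ?t) / l"
        using hd M l by (intro norm_integral_exp_le continuous_intros ch) auto
      have I2: "(G' u - G' w) t = exp (- l * ?t) *\<^sub>R integral {0..?t} (\<lambda>s. h u s - h w s)"
        using i by (simp add: G' G_def Henstock_Kurzweil_Integration.integral_diff scaleR_diff_right scaleR_add_right)
      have "norm ((G' u - G' w) t) \<le> exp (- l * ?t) * (M * norm (u - w) * exp (l * ?t) / l)"
        unfolding I2 norm_scaleR abs_exp_cancel by (rule mult_left_mono[OF I1]) simp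
      also have "\<dots> = M / l * norm (u - w)" by (simp add: exp_minus field_simps)
      also have "\<dots> \<le> 1/2 * norm (u - w)" using l by (intro mult_right_mono) (auto simp: field_simps)
      finally show "norm ((G' u - G' w) t) \<le> 1/2 * norm (u - w)" .
    qed
    then show "\<forall>u w. dist (G' u) (G' w) \<le> 1/2 * dist u w" by (simp add: dist_norm)
  qed auto
  then obtain u where u: "G' u = u" by blast
  define z where "z t = z0 + integral {0..t} (h u)" for t
  have zu: "h u t = f (z t)" if "0 \<le> t" for t
  proof -
    have "u t = exp (- l * t) *\<^sub>R z t" using G'[of u] that u by (simp add: G_def z_def)
    then have "exp (l * t) *\<^sub>R u t = z t" by (simp add: exp_minus)
    then show ?thesis by (simp add: h_def)
  qed
  show thesis
  proof (rule that[of z])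
    show "z 0 = z0" by (simp add: z_def)
    fix t :: real assume t: "0 \<le> t"
    have "((\<lambda>t. integral {0..t} (h u)) has_vector_derivative h u t) (at t within {0..t + 1})"
      using t by (intro integral_has_vector_derivative ch) auto
    then have "(z has_vector_derivative h u t) (at t within {0..t + 1})"
      unfolding z_def by (auto intro!: derivative_eq_intros)
    then show "(z has_vector_derivative f (z t)) (at t within {0..})"
      using zu[OF t] at_within_atLeast_eq[of t "t + 1" 0] by simp
  qed
qed

text \<open>Paths on \<open>{0..T}\<close> become bounded continuous functions on the line by
  freezing them outside the interval.\<close>

definition cutoff :: "real \<Rightarrow> real \<Rightarrow> real" where
  "cutoff T t = max 0 (min T t)"

lemma cutoff_id: "0 \<le> t \<Longrightarrow> t \<le> T \<Longrightarrow> cutoff T t = t"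
  by (simp add: cutoff_def)

lemma cutoff_bounds: "0 \<le> T \<Longrightarrow> 0 \<le> cutoff T t \<and> cutoff T t \<le> T"
  by (auto simp: cutoff_def)

lemma continuous_on_cutoff: "continuous_on S (cutoff T)"
  unfolding cutoff_def by (intro continuous_intros)

definition primitive :: "real \<Rightarrow> (real \<Rightarrow>\<^sub>C 'a::banach) \<Rightarrow> (real \<Rightarrow>\<^sub>C 'a)" where
  "primitive T p = Bcontfun (\<lambda>t. integral {0..cutoff T t} p)"

lemma primitive_apply:
  assumes T: "0 \<le> T"
  shows "primitive T p t = integral {0..cutoff T t} p"
    and "norm (primitive T p t) \<le> T * norm p"
proof -
  have b: "norm (integral {0..cutoff T t} p) \<le> T * norm p" for t
  proof -
    have "norm (integral {0..cutoff T t} p) \<le> norm p * (cutoff T t - 0)"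
      using cutoff_bounds[OF T] norm_bounded[of p] by (intro integral_bound) auto
    also have "\<dots> \<le> norm p * T" using cutoff_bounds[OF T, of t] by (intro mult_left_mono) auto
    finally show ?thesis by (simp add: mult.commute)
  qed
  have "continuous_on {0..T} (\<lambda>t. integral {0..t} p)"
    by (intro indefinite_integral_continuous_1 integrable_continuous_real) auto
  then have "continuous_on UNIV (\<lambda>t. integral {0..cutoff T t} p)"
    by (rule continuous_on_compose2) (use cutoff_bounds[OF T] in \<open>auto intro: continuous_on_cutoff\<close>)
  from apply_Bcontfun[OF this b] show eq: "primitive T p t = integral {0..cutoff T t} p"
    by (simp add: primitive_def)
  show "norm (primitive T p t) \<le> T * norm p" unfolding eq by (rule b)
qed

lemma bounded_linear_primitive:
  assumes T: "0 \<le> T"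
  shows "bounded_linear (primitive T :: (real \<Rightarrow>\<^sub>C 'a::banach) \<Rightarrow> _)"
proof (rule bounded_linear_bcontfun[where C = T])
  have i: "apply_bcontfun p integrable_on {a..b}" for p :: "real \<Rightarrow>\<^sub>C 'a" and a b
    by (intro integrable_continuous_real) auto
  show "primitive T (p + q) t = primitive T p t + primitive T q t" for p q :: "real \<Rightarrow>\<^sub>C 'a" and t
    using i by (simp add: primitive_apply(1)[OF T] Henstock_Kurzweil_Integration.integral_add)
  show "primitive T (r *\<^sub>R p) t = r *\<^sub>R primitive T p t" for r and p :: "real \<Rightarrow>\<^sub>C 'a" and t
    by (simp add: primitive_apply(1)[OF T])
  show "norm (primitive T p t) \<le> norm p * T" for p :: "real \<Rightarrow>\<^sub>C 'a" and t
    using primitive_apply(2)[OF T, of p t] by (simp add: mult.commute)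
qed

lemma (in smooth_gradient) exact_flow_path_equation:
  assumes T: "0 < T" "L * T\<^sup>2 \<le> 1/6"
  shows "path_equation (\<lambda>p. primitive T (primitive T p)) compose_g compose_H const_bcontfun
    (ramp (\<lambda>t. cutoff T t / T)) (\<lambda>p. p T) T L LH"
proof (rule path_equation_bcontfun)
  have n: "norm (primitive T p) \<le> T * norm p" for p :: "real \<Rightarrow>\<^sub>C 'a"
    by (rule norm_bound) (use primitive_apply(2)[of T p] T in simp)
  show "bounded_linear (\<lambda>p. primitive T (primitive T p :: real \<Rightarrow>\<^sub>C 'a))"
    using T by (intro bounded_linear_compose[OF bounded_linear_primitive bounded_linear_primitive]) auto
  show "norm (primitive T (primitive T p)) \<le> T\<^sup>2 * norm p" for p :: "real \<Rightarrow>\<^sub>C 'a"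
    using order_trans[OF n[of "primitive T p"] mult_left_mono[OF n[of p], of T]] T
    by (simp add: power2_eq_square mult.assoc)
qed (use T cutoff_bounds[of T] in \<open>auto intro!: continuous_intros continuous_on_cutoff simp: cutoff_id\<close>)

text \<open>Integrating the equations of motion twice shows that the clamped path of any solution
  solves the path equation. Its uniqueness then fixes the position at time \<open>T\<close>.\<close>

lemma verlet_solution_exact:
  assumes sg: "smooth_gradient (grad U) H L LH" and T: "0 < T" "L * T\<^sup>2 \<le> 1/6"
    and sol: "verlet_solution U 0 x v q w"
  shows "q T = path_equation.endpoint (\<lambda>p. primitive T (primitive T p))
    (smooth_gradient.compose_g (grad U)) const_bcontfun (smooth_gradient.ramp (\<lambda>t. cutoff T t / T)) (\<lambda>p. p T) T x v"
proof -
  interpret sg: smooth_gradient "grad U" H L LH by (fact sg)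
  interpret pe: path_equation "\<lambda>p. primitive T (primitive T p)" sg.compose_g sg.compose_H const_bcontfun
    "sg.ramp (\<lambda>t. cutoff T t / T)" "\<lambda>p. p T" T L LH by (rule sg.exact_flow_path_equation[OF T])
  have q0: "q 0 = x" "w 0 = v" and cq: "continuous_on {0..} q" and cw: "continuous_on {0..} w"
    and dq: "\<And>t. 0 \<le> t \<Longrightarrow> (q has_vector_derivative w t) (at t within {0..})"
    and dw: "\<And>t. 0 \<le> t \<Longrightarrow> (w has_vector_derivative - grad U (q t)) (at t within {0..})"
    using sol by (auto simp: verlet_solution_def floor_h_def ceil_h_def scaleR_2[symmetric])
  define p where "p = Bcontfun (\<lambda>t. q (cutoff T t))"
  have "continuous_on {0..T} q" using cq by (rule continuous_on_subset) auto
  then have "compact (q ` {0..T})" by (intro compact_continuous_image) auto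
  then obtain B where "\<And>y. y \<in> q ` {0..T} \<Longrightarrow> norm y \<le> B" by (metis bounded_iff compact_imp_bounded)
  then have B: "norm (q (cutoff T t)) \<le> B" for t using cutoff_bounds[of T t] T by auto
  have "continuous_on UNIV (\<lambda>t. q (cutoff T t))"
    by (rule continuous_on_compose2[OF cq]) (use cutoff_bounds[of T] T in \<open>auto intro: continuous_on_cutoff\<close>)
  then have p: "p t = q (cutoff T t)" for t
    unfolding p_def by (subst apply_Bcontfun) (use B in auto)
  have w: "primitive T (sg.compose_g p) t = v - w t" if t: "0 \<le> t" "t \<le> T" for t
  proof -
    have "((\<lambda>s. - grad U (q s)) has_integral (w t - w 0)) {0..t}"
      by (rule fundamental_theorem_of_calculus[OF t(1)]) (auto intro: has_vector_derivative_within_subset[OF dw])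
    from has_integral_neg[OF this] have "((\<lambda>s. grad U (q s)) has_integral (v - w t)) {0..t}" by (simp add: q0)
    then have "((\<lambda>s. sg.compose_g p s) has_integral (v - w t)) {0..t}"
      by (rule has_integral_eq[rotated]) (use t in \<open>auto simp: sg.compose_g_apply p cutoff_id\<close>)
    then show ?thesis using t T by (simp add: primitive_apply(1) cutoff_id integral_unique)
  qed
  have q: "primitive T (primitive T (sg.compose_g p)) t = x + t *\<^sub>R v - q t" if t: "0 \<le> t" "t \<le> T" for t
  proof -
    have "(w has_integral (q t - q 0)) {0..t}"
      by (rule fundamental_theorem_of_calculus[OF t(1)]) (auto intro: has_vector_derivative_within_subset[OF dq])
    from has_integral_diff[OF has_integral_const_real[of v 0 t] this]
    have "((\<lambda>s. v - w s) has_integral (x + t *\<^sub>R v - q t)) {0..t}" using t by (simp add: q0 algebra_simps)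
    then have "((\<lambda>s. primitive T (sg.compose_g p) s) has_integral (x + t *\<^sub>R v - q t)) {0..t}"
      by (rule has_integral_eq[rotated]) (use t in \<open>auto simp: w\<close>)
    then show ?thesis using t T by (simp add: primitive_apply(1)[of T "primitive T (sg.compose_g p)"] cutoff_id integral_unique)
  qed
  \<comment> \<open>Both sides of the path equation depend on time only through the cutoff, so it
    need be verified only inside the interval.\<close>
  have cutc: "primitive T r t = primitive T r (cutoff T t)" for r :: "real \<Rightarrow>\<^sub>C 'a" and t
    using T cutoff_bounds[of T t] by (simp add: primitive_apply(1) cutoff_id)
  have "pe.ivp x v = p"
  proof (rule pe.ivp_unique, rule bcontfun_eqI)
    fix t
    have "T *\<^sub>R sg.ramp (\<lambda>t. cutoff T t / T) v t = cutoff T t *\<^sub>R v"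
      using T cutoff_bounds[of T] by (subst sg.ramp_apply) (auto intro!: continuous_intros continuous_on_cutoff)
    then show "(p + primitive T (primitive T (sg.compose_g p))) t
        = (const_bcontfun x + T *\<^sub>R sg.ramp (\<lambda>t. cutoff T t / T) v) t"
      using q[of "cutoff T t"] cutoff_bounds[of T t] T
      by (simp add: p cutc[of _ t] const_bcontfun.rep_eq)
  qed
  then show ?thesis using T by (simp add: pe.endpoint_def p cutoff_id)
qed

text \<open>The path equation yields paths up to time \<open>T\<close>, whereas
  \<open>verlet_solution\<close> asks for one on the whole half-line. The first-order system in
  phase space is globally Lipschitz and provides it.\<close>

lemma verlet_solution_exact_exists:
  assumes sg: "smooth_gradient (grad U) H L LH"
  shows "\<exists>q w. verlet_solution U 0 x v q w"
proof -
  interpret sg: smooth_gradient "grad U" H L LH by (fact sg)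
  let ?f = "\<lambda>z. (snd z, - grad U (fst z))"
  have lip: "norm (?f y - ?f z) \<le> (1 + L) * norm (y - z)" for y z
  proof -
    have "norm (?f y - ?f z) \<le> norm (snd y - snd z) + norm (grad U (fst y) - grad U (fst z))"
      using norm_Pair_le[of "snd y - snd z" "- grad U (fst y) + grad U (fst z)"]
      by (simp add: norm_minus_commute)
    also have "\<dots> \<le> norm (y - z) + L * norm (y - z)"
      using norm_snd_le[of "snd (y - z)" "fst (y - z)"] norm_fst_le[of "fst (y - z)" "snd (y - z)"] sg.L
        sg.g_lip[of "fst y" "fst z"] prod.collapse[of "y - z"]
      by (intro add_mono order_trans[OF sg.g_lip] mult_left_mono) auto
    finally show ?thesis by (simp add: algebra_simps)
  qed
  obtain z where z: "z 0 = (x, v)"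
    "\<And>t. 0 \<le> t \<Longrightarrow> (z has_vector_derivative ?f (z t)) (at t within {0..})"
    using lipschitz_ode_global_solution[OF lip, of "(x, v)"] sg.L by auto
  have d1: "((\<lambda>t. fst (z t)) has_vector_derivative snd (z t)) (at t within {0..})" if "0 \<le> t" for t
    using bounded_linear.has_vector_derivative[OF bounded_linear_fst z(2)[OF that]] by simp
  have d2: "((\<lambda>t. snd (z t)) has_vector_derivative - grad U (fst (z t))) (at t within {0..})" if "0 \<le> t" for t
    using bounded_linear.has_vector_derivative[OF bounded_linear_snd z(2)[OF that]] by simp
  have c: "continuous_on {0..} (\<lambda>t. fst (z t))" "continuous_on {0..} (\<lambda>t. snd (z t))"
    using has_vector_derivative_continuous[OF d1] has_vector_derivative_continuous[OF d2]
    by (auto simp: continuous_on_eq_continuous_within)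
  have "verlet_solution U 0 x v (\<lambda>t. fst (z t)) (\<lambda>t. snd (z t))"
    using z(1) c d1 d2 by (auto simp: verlet_solution_def floor_h_def ceil_h_def scaleR_2[symmetric])
  then show ?thesis by blast
qed

section \<open>The Verlet scheme\<close>

lemma floor_div_eq:
  fixes h t :: real assumes "0 < h" "real k * h \<le> t" "t < real (Suc k) * h"
  shows "\<lfloor>t / h\<rfloor> = int k"
  using assms by (intro floor_unique) (auto simp: field_simps)

lemma floor_h_between:
  assumes h: "0 < h" and t: "real k * h < t" "t < real (Suc k) * h"
  shows "floor_h h t = real k * h" and "ceil_h h t = real (Suc k) * h" and "t \<notin> grid h"
proof -
  show "floor_h h t = real k * h"
    using floor_div_eq[OF h, of k t] t by (simp add: floor_h_pos[OF h])
  have "\<lceil>t / h\<rceil> = int (Suc k)"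
    using h t by (intro ceiling_unique) (auto simp: field_simps)
  then show "ceil_h h t = real (Suc k) * h" by (simp add: ceil_h_pos[OF h] algebra_simps)
  show "t \<notin> grid h"
  proof
    assume "t \<in> grid h"
    then obtain j :: int where j: "t = h * of_int j" by (auto simp: grid_def)
    have "of_int (int k) < real_of_int j" "real_of_int j < of_int (int (Suc k))"
      using t h by (auto simp: j mult.commute)
    then have "int k < j" "j < int (Suc k)" by (simp_all only: of_int_less_iff)
    then show False by simp
  qed
qed

lemma not_in_gridE:
  assumes h: "0 < h" and t: "0 \<le> t" "t \<notin> grid h"
  obtains k where "real k * h < t" "t < real (Suc k) * h"
proof -
  define k where "k = nat \<lfloor>t / h\<rfloor>"
  have k: "real k = of_int \<lfloor>t / h\<rfloor>" using t h by (simp add: k_def)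
  have "of_int \<lfloor>t / h\<rfloor> \<le> t / h" "t / h < of_int \<lfloor>t / h\<rfloor> + 1" by linarith+
  then have "real k * h \<le> t" "t < real (Suc k) * h" using h by (auto simp: k[symmetric] field_simps)
  moreover have "real k * h \<noteq> t"
    using t(2) rangeI[of "\<lambda>k::int. h * of_int k" "\<lfloor>t / h\<rfloor>"] by (auto simp: grid_def mult.commute k)
  ultimately show thesis using that[of k] by auto
qed

section \<open>Piecewise defined paths on the grid\<close>

definition glue :: "real \<Rightarrow> (nat \<Rightarrow> real \<Rightarrow> 'a) \<Rightarrow> real \<Rightarrow> 'a" where
  "glue h P t = P (nat \<lfloor>t / h\<rfloor>) t"

context
  fixes h :: real and P :: "nat \<Rightarrow> real \<Rightarrow> 'a::real_normed_vector"
  assumes h: "0 < h" and P: "\<And>k. continuous_on UNIV (P k)"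
    and match: "\<And>k. P k (real (Suc k) * h) = P (Suc k) (real (Suc k) * h)"
begin

lemma glue_eq:
  assumes "real k * h \<le> t" "t \<le> real (Suc k) * h"
  shows "glue h P t = P k t"
proof (cases "t < real (Suc k) * h")
  case True
  then show ?thesis using floor_div_eq[OF h assms(1)] by (simp add: glue_def)
next
  case False
  then have "t = real (Suc k) * h" using assms by simp
  moreover have "\<lfloor>real (Suc k) * h / h\<rfloor> = int (Suc k)" using h by simp
  ultimately show ?thesis using match[of k] by (simp add: glue_def nat_add_distrib)
qed

lemma glue_grid: "glue h P (real k * h) = P k (real k * h)"
  using h by (intro glue_eq) (auto simp: mult_right_mono)

lemma continuous_glue: "continuous_on {0..} (glue h P)"
proof -
  have c: "continuous_on {0..real N * h} (glue h P)" for N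
  proof (induction N)
    case (Suc N)
    have "continuous_on {real N * h..real (Suc N) * h} (glue h P)"
      using continuous_on_subset[OF P[of N], of "{real N * h..real (Suc N) * h}"]
      by (rule continuous_on_eq) (auto intro: glue_eq[symmetric])
    from continuous_on_closed_Un[OF _ _ Suc this]
    have "continuous_on ({0..real N * h} \<union> {real N * h..real (Suc N) * h}) (glue h P)" by simp
    also have "{0..real N * h} \<union> {real N * h..real (Suc N) * h} = {0..real (Suc N) * h}"
      using h by (intro ivl_disj_un_two_touch) (auto simp: mult_right_mono)
    finally show ?case .
  qed simp
  show ?thesis unfolding continuous_on_eq_continuous_within
  proof
    fix t :: real assume t: "t \<in> {0..}"
    obtain N :: nat where N: "t / h < real N" using reals_Archimedean2 by blast
    then have tN: "t < real N * h" using h by (simp add: field_simps)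
    have "continuous (at t within {0..real N * h}) (glue h P)"
      using c[of N] t tN by (auto simp: continuous_on_eq_continuous_within)
    then show "continuous (at t within {0..}) (glue h P)"
      by (simp add: at_within_atLeast_eq[OF tN])
  qed
qed

lemma glue_has_vector_derivative:
  assumes t: "real k * h < t" "t < real (Suc k) * h" and D: "(P k has_vector_derivative D) (at t)"
  shows "(glue h P has_vector_derivative D) (at t within S)"
proof (rule has_vector_derivative_at_within)
  show "(glue h P has_vector_derivative D) (at t)"
    by (rule has_vector_derivative_transform_within_open[OF D, of "{real k * h<..<real (Suc k) * h}"])
      (use t in \<open>auto intro!: glue_eq[symmetric]\<close>)
qed

end

primrec verlet_iter :: "('a::real_vector \<Rightarrow> 'a) \<Rightarrow> real \<Rightarrow> 'a \<Rightarrow> 'a \<Rightarrow> nat \<Rightarrow> 'a \<times> 'a" where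
  "verlet_iter g h x v 0 = (x, v)"
| "verlet_iter g h x v (Suc k) = (let (q, w) = verlet_iter g h x v k;
     q' = q + h *\<^sub>R w - (h\<^sup>2 / 2) *\<^sub>R g q in (q', w - (h / 2) *\<^sub>R (g q + g q')))"

lemma verlet_solution_grid_exists:
  assumes h: "0 < h"
  shows "\<exists>q w. verlet_solution U h x v q w"
proof -
  define Q where "Q k = fst (verlet_iter (grad U) h x v k)" for k
  define W where "W k = snd (verlet_iter (grad U) h x v k)" for k
  define g where "g k = grad U (Q k)" for k
  have QW: "Q 0 = x" "W 0 = v" "Q (Suc k) = Q k + h *\<^sub>R W k - (h\<^sup>2 / 2) *\<^sub>R g k"
    "W (Suc k) = W k - (h / 2) *\<^sub>R (g k + g (Suc k))" for k
    by (simp_all add: g_def Q_def W_def Let_def split_beta)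
  \<comment> \<open>Within cell \<open>k\<close> the right side for the position is affine in time
    and that for the velocity constant, so the solution there is quadratic and affine
    respectively.\<close>
  define P1 where "P1 k t = Q k + (t - real k * h) *\<^sub>R W k - ((t - real k * h)\<^sup>2 / 2) *\<^sub>R g k" for k t
  define P2 where "P2 k t = W k - ((t - real k * h) / 2) *\<^sub>R (g k + g (Suc k))" for k t
  have c: "continuous_on UNIV (P1 k)" "continuous_on UNIV (P2 k)" for k
    unfolding P1_def P2_def by (auto intro!: continuous_intros)
  have m: "P1 k (real (Suc k) * h) = P1 (Suc k) (real (Suc k) * h)"
    "P2 k (real (Suc k) * h) = P2 (Suc k) (real (Suc k) * h)" for k
    by (simp_all add: P1_def P2_def QW algebra_simps)
  note G1 = h c(1) m(1) and G2 = h c(2) m(2)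
  have "verlet_solution U h x v (glue h P1) (glue h P2)"
    unfolding verlet_solution_def
  proof (intro conjI allI impI)
    have g1: "glue h P1 (real k * h) = Q k" for k by (subst glue_grid[OF G1]) (simp add: P1_def)
    have g2: "glue h P2 (real k * h) = W k" for k by (subst glue_grid[OF G2]) (simp add: P2_def)
    show "glue h P1 0 = x" "glue h P2 0 = v" using g1[of 0] g2[of 0] QW by simp_all
    show "continuous_on {0..} (glue h P1)" by (rule continuous_glue[OF G1])
    show "continuous_on {0..} (glue h P2)" by (rule continuous_glue[OF G2])
    fix t :: real assume t: "0 \<le> t" "h = 0 \<or> t \<notin> grid h"
    then obtain k where k: "real k * h < t" "t < real (Suc k) * h" using h not_in_gridE[OF h, of t] by auto
    note fl = floor_h_between[OF h k]
    show "(glue h P1 has_vector_derivative glue h P2 (floor_h h t) -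
         (t - floor_h h t) *\<^sub>R grad U (glue h P1 (floor_h h t))) (at t within {0..})"
    proof (rule glue_has_vector_derivative[OF G1 k])
      show "(P1 k has_vector_derivative glue h P2 (floor_h h t) -
         (t - floor_h h t) *\<^sub>R grad U (glue h P1 (floor_h h t))) (at t)"
        unfolding P1_def fl g1 g2 g_def
        by (auto intro!: derivative_eq_intros simp: has_vector_derivative_def scaleR_diff_right)
    qed
    show "(glue h P2 has_vector_derivative - (1 / 2) *\<^sub>R (grad U (glue h P1 (floor_h h t)) +
         grad U (glue h P1 (ceil_h h t)))) (at t within {0..})"
    proof (rule glue_has_vector_derivative[OF G2 k])
      show "(P2 k has_vector_derivative - (1 / 2) *\<^sub>R (grad U (glue h P1 (floor_h h t)) +
         grad U (glue h P1 (ceil_h h t)))) (at t)"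
        unfolding P2_def fl g1 g2 g_def
        by (auto intro!: derivative_eq_intros simp: has_vector_derivative_def scaleR_diff_right)
    qed
  qed
  then show ?thesis by blast
qed

text \<open>The equation holds only off the grid, so the fundamental theorem is applied on the open
  cell, together with continuity at its ends.\<close>

lemma verlet_solution_grid_step:
  assumes h: "0 < h" and sol: "verlet_solution U h x v q w"
  defines "Q \<equiv> \<lambda>k::nat. q (real k * h)" and "W \<equiv> \<lambda>k::nat. w (real k * h)"
  shows "Q (Suc k) = Q k + h *\<^sub>R W k - (h\<^sup>2 / 2) *\<^sub>R grad U (Q k)"
    and "W (Suc k) = W k - (h / 2) *\<^sub>R (grad U (Q k) + grad U (Q (Suc k)))"
proof -
  let ?a = "real k * h" and ?b = "real (Suc k) * h"
  have ab: "?a \<le> ?b" "0 \<le> ?a" and ba: "?b - ?a = h" using h by (auto simp: algebra_simps)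
  have cont: "continuous_on {?a..?b} q" "continuous_on {?a..?b} w"
    using sol ab(2) by (auto simp: verlet_solution_def elim!: continuous_on_subset)
  have D: "(q has_vector_derivative W k - (t - ?a) *\<^sub>R grad U (Q k)) (at t)"
    "(w has_vector_derivative - (1/2) *\<^sub>R (grad U (Q k) + grad U (Q (Suc k)))) (at t)"
    if t: "t \<in> {?a<..<?b}" for t
  proof -
    have t': "?a < t" "t < ?b" "0 < t" using t ab(2) by auto
    note fl = floor_h_between[OF h t'(1,2)]
    have at: "at t within {0..} = at t" using t' by (intro at_within_interior) (auto simp: interior_real_atLeast)
    show "(q has_vector_derivative W k - (t - ?a) *\<^sub>R grad U (Q k)) (at t)"
      "(w has_vector_derivative - (1/2) *\<^sub>R (grad U (Q k) + grad U (Q (Suc k)))) (at t)"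
      using sol t'(3) fl(3) by (auto simp: verlet_solution_def at[symmetric] fl(1,2) Q_def W_def dest!: spec[of _ t])
  qed
  have "((\<lambda>t. W k - (t - ?a) *\<^sub>R grad U (Q k)) has_integral (q ?b - q ?a)) {?a..?b}"
    by (rule fundamental_theorem_of_calculus_interior[OF ab(1) cont(1) D(1)])
  moreover have "((\<lambda>t. W k - (t - ?a) *\<^sub>R grad U (Q k)) has_integral
     (((?b - ?a) *\<^sub>R W k - ((?b - ?a)\<^sup>2 / 2) *\<^sub>R grad U (Q k)) - ((?a - ?a) *\<^sub>R W k - ((?a - ?a)\<^sup>2 / 2) *\<^sub>R grad U (Q k)))) {?a..?b}"
    by (rule fundamental_theorem_of_calculus[OF ab(1)])
      (auto intro!: derivative_eq_intros simp: has_vector_derivative_def scaleR_diff_right)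
  ultimately have "q ?b - q ?a = h *\<^sub>R W k - (h\<^sup>2 / 2) *\<^sub>R grad U (Q k)"
    unfolding ba by (simp add: has_integral_unique)
  then show "Q (Suc k) = Q k + h *\<^sub>R W k - (h\<^sup>2 / 2) *\<^sub>R grad U (Q k)" by (simp add: Q_def algebra_simps)
  have "((\<lambda>t. - (1/2) *\<^sub>R (grad U (Q k) + grad U (Q (Suc k)))) has_integral (w ?b - w ?a)) {?a..?b}"
    by (rule fundamental_theorem_of_calculus_interior[OF ab(1) cont(2) D(2)])
  from has_integral_unique[OF this has_integral_const_real]
  have "w ?b - w ?a = - ((h / 2) *\<^sub>R (grad U (Q k) + grad U (Q (Suc k))))"
    using ab(1) ba by (simp add: content_real)
  then show "W (Suc k) = W k - (h / 2) *\<^sub>R (grad U (Q k) + grad U (Q (Suc k)))"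
    by (simp add: W_def algebra_simps)
qed

section \<open>Paths indexed by grid steps\<close>

lemma continuous_on_discrete: "continuous_on S (f :: 'b discrete \<Rightarrow> 'c::topological_space)"
  by (rule continuous_on_subset[of UNIV]) (auto simp: continuous_on_open_vimage open_discrete)

lemma of_discrete_discrete [simp]: "of_discrete (discrete k) = k"
  by (rule discrete_inverse) simp

text \<open>Solving the Verlet recursion for the positions: \<open>q\<^sub>k = x + k h v\<close> minus this double sum of the
  gradients, cut off at the final step \<open>n\<close>.\<close>

definition verlet_sum :: "real \<Rightarrow> nat \<Rightarrow> (nat discrete \<Rightarrow>\<^sub>C 'a::real_normed_vector) \<Rightarrow> (nat discrete \<Rightarrow>\<^sub>C 'a)" where
  "verlet_sum h n p = Bcontfun (\<lambda>k. h\<^sup>2 *\<^sub>R (\<Sum>i<min (of_discrete k) n. (1/2) *\<^sub>R p (discrete 0) + (\<Sum>j=1..i. p (discrete j))))"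

lemma verlet_sum_apply:
  "verlet_sum h n p k = h\<^sup>2 *\<^sub>R (\<Sum>i<min (of_discrete k) n. (1/2) *\<^sub>R p (discrete 0) + (\<Sum>j=1..i. p (discrete j)))"
  "norm (verlet_sum h n p k) \<le> (real n * h)\<^sup>2 * norm p"
proof -
  have "norm (h\<^sup>2 *\<^sub>R (\<Sum>i<min k n. (1/2) *\<^sub>R p (discrete 0) + (\<Sum>j=1..i. p (discrete j)))) \<le> (real n * h)\<^sup>2 * norm p" for k
  proof -
    \<comment> \<open>The inner sum has total weight \<open>1/2 + i\<close>, at most
      \<open>n\<close> for \<open>i < n\<close>. With at most \<open>n\<close> outer terms this
      gives \<open>(n * h)\<^sup>2\<close>, the same bound \<open>T\<^sup>2\<close> as for the
      flow.\<close>
    have "norm ((1/2) *\<^sub>R p (discrete 0) + (\<Sum>j=1..i. p (discrete j))) \<le> real n * norm p" if "i < n" for i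
    proof -
      have "norm (\<Sum>j=1..i. p (discrete j)) \<le> real i * norm p"
        using sum_norm_le[of "{1..i}" "\<lambda>j. p (discrete j)" "\<lambda>_. norm p"] norm_bounded[of p] by simp
      then have "norm ((1/2) *\<^sub>R p (discrete 0) + (\<Sum>j=1..i. p (discrete j))) \<le> 1/2 * norm p + real i * norm p"
        using norm_triangle_ineq[of "(1/2) *\<^sub>R p (discrete 0)" "\<Sum>j=1..i. p (discrete j)"] norm_bounded[of p "discrete 0"] by simp
      also have "\<dots> = (1/2 + real i) * norm p" by (simp add: algebra_simps)
      also have "\<dots> \<le> real n * norm p" using that by (intro mult_right_mono) auto
      finally show ?thesis .
    qed
    then have "norm (\<Sum>i<min k n. (1/2) *\<^sub>R p (discrete 0) + (\<Sum>j=1..i. p (discrete j))) \<le> real (min k n) * (real n * norm p)"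
      using sum_norm_le[of "{..<min k n}" "\<lambda>i. (1/2) *\<^sub>R p (discrete 0) + (\<Sum>j=1..i. p (discrete j))"
          "\<lambda>_. real n * norm p"] by simp
    also have "\<dots> \<le> real n * (real n * norm p)" by (intro mult_right_mono) auto
    finally have "h\<^sup>2 * norm (\<Sum>i<min k n. (1/2) *\<^sub>R p (discrete 0) + (\<Sum>j=1..i. p (discrete j))) \<le> h\<^sup>2 * (real n * (real n * norm p))"
      by (rule mult_left_mono) simp
    then show ?thesis by (simp add: power2_eq_square mult_ac)
  qed
  note b = this
  show eq: "verlet_sum h n p k = h\<^sup>2 *\<^sub>R (\<Sum>i<min (of_discrete k) n. (1/2) *\<^sub>R p (discrete 0) + (\<Sum>j=1..i. p (discrete j)))"
    unfolding verlet_sum_def by (subst apply_Bcontfun[OF continuous_on_discrete b]) auto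
  show "norm (verlet_sum h n p k) \<le> (real n * h)\<^sup>2 * norm p" unfolding eq by (rule b)
qed

lemma (in smooth_gradient) verlet_path_equation:
  assumes T: "T = real n * h" "0 < T" "L * T\<^sup>2 \<le> 1/6"
  shows "path_equation (verlet_sum h n) compose_g compose_H const_bcontfun
    (ramp (\<lambda>k. real (min (of_discrete k) n) / real n)) (\<lambda>p. p (discrete n)) T L LH"
proof (rule path_equation_bcontfun)
  have n: "n > 0" using T by (cases n) auto
  show "bounded_linear (verlet_sum h n :: (nat discrete \<Rightarrow>\<^sub>C 'a) \<Rightarrow> _)"
    by (rule bounded_linear_bcontfun[where C = "T\<^sup>2"])
      (use verlet_sum_apply(2) T in \<open>auto simp: verlet_sum_apply(1) sum.distrib scaleR_add_right scaleR_sum_right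
          mult_ac\<close>)
  show "norm (verlet_sum h n p) \<le> T\<^sup>2 * norm p" for p :: "nat discrete \<Rightarrow>\<^sub>C 'a"
    by (rule norm_bound) (use verlet_sum_apply(2) T in auto)
  show "real (min (of_discrete k) n) / real n \<le> 1" for k using n by simp
  show "real (min (of_discrete (discrete n)) n) / real n = 1" using n by simp
qed (use T in \<open>auto intro: continuous_on_discrete\<close>)

lemma verlet_solution_grid:
  assumes sg: "smooth_gradient (grad U) H L LH" and T: "T = real n * h" "0 < T" "L * T\<^sup>2 \<le> 1/6"
    and h: "0 < h" and sol: "verlet_solution U h x v q w"
  shows "q T = path_equation.endpoint (verlet_sum h n)
    (smooth_gradient.compose_g (grad U)) const_bcontfun
    (smooth_gradient.ramp (\<lambda>k. real (min (of_discrete k) n) / real n)) (\<lambda>p. p (discrete n)) T x v"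
proof -
  interpret sg: smooth_gradient "grad U" H L LH by (fact sg)
  interpret pe: path_equation "verlet_sum h n" sg.compose_g sg.compose_H const_bcontfun
    "sg.ramp (\<lambda>k. real (min (of_discrete k) n) / real n)" "\<lambda>p. p (discrete n)" T L LH by (rule sg.verlet_path_equation[OF T])
  have n: "n > 0" using T by (cases n) auto
  define Q where "Q k = q (real k * h)" for k :: nat
  define W where "W k = w (real k * h)" for k :: nat
  define g where "g k = grad U (Q k)" for k
  note step = verlet_solution_grid_step[OF h sol, folded Q_def W_def g_def]
  have 0: "Q 0 = x" "W 0 = v" using sol by (auto simp: Q_def W_def verlet_solution_def)
  \<comment> \<open>The leapfrog form: this is the velocity at the half step, which changes by one
    full gradient per step and by which the position advances. The initial half kick is the source
    of the weight \<open>1/2\<close>.\<close>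
  have D: "W k - (h / 2) *\<^sub>R g k = v - h *\<^sub>R ((1/2) *\<^sub>R g 0 + (\<Sum>j=1..k. g j))" for k
  proof (induction k)
    case (Suc k)
    have "W (Suc k) - (h / 2) *\<^sub>R g (Suc k) = (W k - (h / 2) *\<^sub>R g k) - h *\<^sub>R g (Suc k)"
      unfolding step(2) by (simp add: algebra_simps flip: scaleR_add_left)
    then show ?case unfolding Suc by (simp add: algebra_simps)
  qed (simp add: 0)
  have Qk: "Q k = x + (real k * h) *\<^sub>R v - h\<^sup>2 *\<^sub>R (\<Sum>i<k. (1/2) *\<^sub>R g 0 + (\<Sum>j=1..i. g j))" for k
  proof (induction k)
    case (Suc k)
    have "Q (Suc k) = Q k + h *\<^sub>R (W k - (h / 2) *\<^sub>R g k)"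
      unfolding step(1) by (simp add: algebra_simps power2_eq_square)
    then show ?case unfolding Suc D by (simp add: algebra_simps power2_eq_square)
  qed (simp add: 0)
  define p where "p = Bcontfun (\<lambda>k. Q (min (of_discrete k) n))"
  have B: "norm (Q (min k n)) \<le> (\<Sum>i\<le>n. norm (Q i))" for k
    by (rule member_le_sum) auto
  have p: "p k = Q (min (of_discrete k) n)" for k
    unfolding p_def by (subst apply_Bcontfun[OF continuous_on_discrete B]) auto
  have "pe.ivp x v = p"
  proof (rule pe.ivp_unique, rule bcontfun_eqI)
    fix k :: "nat discrete"
    have "T *\<^sub>R sg.ramp (\<lambda>k. real (min (of_discrete k) n) / real n) v k = (real (min (of_discrete k) n) * h) *\<^sub>R v"
      using n T by (subst sg.ramp_apply) (auto intro: continuous_on_discrete)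
    moreover have "(\<Sum>i<min (of_discrete k) n. (1/2) *\<^sub>R sg.compose_g p (discrete 0) + (\<Sum>j=1..i. sg.compose_g p (discrete j)))
       = (\<Sum>i<min (of_discrete k) n. (1/2) *\<^sub>R g 0 + (\<Sum>j=1..i. g j))"
      by (intro sum.cong arg_cong2[where f = "(+)"] refl) (auto simp: sg.compose_g_apply p g_def)
    ultimately show "(p + verlet_sum h n (sg.compose_g p)) k
        = (const_bcontfun x + T *\<^sub>R sg.ramp (\<lambda>k. real (min (of_discrete k) n) / real n) v) k"
      using Qk[of "min (of_discrete k) n"] by (simp add: p verlet_sum_apply(1) const_bcontfun.rep_eq)
  qed
  then have "pe.endpoint x v = Q n" by (simp add: pe.endpoint_def p)
  then show ?thesis by (simp only: Q_def T(1)[symmetric])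
qed

section \<open>Derivatives of the potential\<close>

lemma norm_le_of_inner_le:
  fixes z :: "'a::real_inner"
  assumes "\<And>u. \<bar>z \<bullet> u\<bar> \<le> C * norm u" and "0 \<le> C"
  shows "norm z \<le> C"
proof (cases "z = 0")
  case False
  have "norm z * norm z \<le> C * norm z"
    using assms(1)[of z] by (simp add: power2_norm_eq_inner[symmetric] power2_eq_square)
  then show ?thesis using False by simp
qed (use assms in simp)

text \<open>A real \<open>Sup\<close> is an upper bound only of a set that is bounded above; for a
  bilinear form in finite dimension it is. Homogeneity then extends the bound from unit
  vectors.\<close>

lemma opnorm2_upper:
  fixes B :: "'a::euclidean_space \<Rightarrow> 'a \<Rightarrow> real"
  assumes B: "bilinear B"
  shows "\<bar>B u v\<bar> \<le> opnorm2 B * norm u * norm v"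
proof -
  obtain C where C: "\<And>u v. norm (B u v) \<le> C * norm u * norm v"
    using bilinear_bounded[OF B] by blast
  have unit: "\<bar>B u v\<bar> \<le> opnorm2 B" if "norm u = 1" "norm v = 1" for u v
    unfolding opnorm2_def
  proof (rule cSup_upper)
    show "bdd_above {\<bar>B u v\<bar> |u v. norm u = 1 \<and> norm v = 1}"
    proof (rule bdd_aboveI[of _ C])
      fix x assume "x \<in> {\<bar>B u v\<bar> |u v. norm u = 1 \<and> norm v = 1}"
      then obtain u v where "x = \<bar>B u v\<bar>" "norm u = 1" "norm v = 1" by blast
      then show "x \<le> C" using C[of u v] by simp
    qed
  qed (use that in blast)
  show ?thesis
  proof (cases "u = 0 \<or> v = 0")
    case True
    then show ?thesis using B by (auto simp: bilinear_lzero bilinear_rzero)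
  next
    case False
    have "B u v = B (norm u *\<^sub>R sgn u) (norm v *\<^sub>R sgn v)"
      using False by (simp add: sgn_div_norm)
    also have "\<dots> = norm u * norm v * B (sgn u) (sgn v)"
      by (simp only: bilinear_lmul[OF B] bilinear_rmul[OF B]) simp
    finally have "\<bar>B u v\<bar> = norm u * norm v * \<bar>B (sgn u) (sgn v)\<bar>" by (simp add: abs_mult)
    also have "\<dots> \<le> norm u * norm v * opnorm2 B"
      using False by (intro mult_left_mono unit) (auto simp: norm_sgn)
    finally show ?thesis by (simp add: mult_ac)
  qed
qed

text \<open>Trilinearity is supplied as an expansion in the first two arguments and linearity in the
  third, the form in which the third derivative of the potential provides it.\<close>

lemma opnorm3_upper:
  fixes B :: "'a::euclidean_space \<Rightarrow> 'a \<Rightarrow> 'a \<Rightarrow> real"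
  assumes B: "\<And>u v w. B u v w = (\<Sum>b\<in>Basis. \<Sum>c\<in>Basis. (u \<bullet> b) * (v \<bullet> c) * B b c w)"
    and lin: "\<And>u v. bounded_linear (B u v)"
  shows "\<bar>B u v w\<bar> \<le> opnorm3 B * norm u * norm v * norm w"
proof -
  have sc: "B (r *\<^sub>R u) (s *\<^sub>R v) (t *\<^sub>R w) = r * s * t * B u v w" for r s t u v w
  proof -
    have "B (r *\<^sub>R u) (s *\<^sub>R v) (t *\<^sub>R w)
        = (\<Sum>b\<in>Basis. \<Sum>c\<in>Basis. (r *\<^sub>R u \<bullet> b) * (s *\<^sub>R v \<bullet> c) * B b c (t *\<^sub>R w))" by (rule B)
    also have "\<dots> = r * s * t * (\<Sum>b\<in>Basis. \<Sum>c\<in>Basis. (u \<bullet> b) * (v \<bullet> c) * B b c w)"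
      by (simp add: linear_scale[OF bounded_linear.linear[OF lin]] sum_distrib_left mult_ac)
    finally show ?thesis using B[of u v w] by simp
  qed
  let ?C = "\<Sum>b\<in>(Basis::'a set). \<Sum>c\<in>(Basis::'a set). onorm (B b c)"
  have C: "\<bar>B u v w\<bar> \<le> ?C" if "norm u = 1" "norm v = 1" "norm w = 1" for u v w
  proof -
    have "\<bar>B u v w\<bar> \<le> (\<Sum>b\<in>Basis. \<Sum>c\<in>Basis. \<bar>(u \<bullet> b) * (v \<bullet> c) * B b c w\<bar>)"
      by (subst B[of u v w]) (rule order_trans[OF sum_abs sum_mono[OF sum_abs]])
    also have "\<dots> \<le> ?C"
    proof (intro sum_mono)
      fix b c :: 'a assume bc: "b \<in> Basis" "c \<in> Basis"
      have "\<bar>u \<bullet> b\<bar> * \<bar>v \<bullet> c\<bar> * \<bar>B b c w\<bar> \<le> 1 * 1 * onorm (B b c)"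
        using Basis_le_norm[OF bc(1), of u] Basis_le_norm[OF bc(2), of v] onorm[OF lin[of b c], of w] that
        by (intro mult_mono) auto
      then show "\<bar>(u \<bullet> b) * (v \<bullet> c) * B b c w\<bar> \<le> onorm (B b c)" by (simp add: abs_mult)
    qed
    finally show ?thesis .
  qed
  have unit: "\<bar>B u v w\<bar> \<le> opnorm3 B" if "norm u = 1" "norm v = 1" "norm w = 1" for u v w
    unfolding opnorm3_def
    by (rule cSup_upper) (use that in blast, use C in \<open>auto intro!: bdd_aboveI[of _ ?C]\<close>)
  show ?thesis
  proof (cases "u = 0 \<or> v = 0 \<or> w = 0")
    case True
    then have "B u v w = 0" using sc[of 0 u 1 v 1 w] sc[of 1 u 0 v 1 w] sc[of 1 u 1 v 0 w] by auto
    then show ?thesis using True by auto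
  next
    case False
    have "B u v w = norm u * norm v * norm w * B (sgn u) (sgn v) (sgn w)"
      unfolding sc[symmetric] using False by (simp add: sgn_div_norm)
    then have "\<bar>B u v w\<bar> = norm u * norm v * norm w * \<bar>B (sgn u) (sgn v) (sgn w)\<bar>" by (simp add: abs_mult)
    also have "\<dots> \<le> norm u * norm v * norm w * opnorm3 B"
      using False by (intro mult_left_mono unit) (auto simp: norm_sgn)
    finally show ?thesis by (simp add: mult_ac)
  qed
qed

text \<open>\<open>C_k\<close> speaks of directional derivatives one at a time; expanding the
  gradient in the basis assembles them into a derivative \<open>H\<close>. Its Lipschitz bound is
  the mean value theorem for \<open>D2 U z w u\<close> in \<open>z\<close> with both directions
  fixed, read back through the inner product.\<close>

lemma hessian_of_C3:
  fixes U :: "'a::euclidean_space \<Rightarrow> real"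
  assumes C3: "C_k 3 U"
    and bdd2: "bdd_above (range (\<lambda>x. opnorm2 (D2 U x)))" and L: "L = (SUP x. opnorm2 (D2 U x))"
    and bdd3: "bdd_above (range (\<lambda>x. opnorm3 (D3 U x)))" and LH: "L_H = (SUP x. opnorm3 (D3 U x))"
  obtains H where "\<And>x. (grad U has_derivative H x) (at x)"
    and "\<And>x u. norm (H x u) \<le> L * norm u"
    and "\<And>x y u. norm (H x u - H y u) \<le> L_H * norm (x - y) * norm u"
    and "0 \<le> L" and "0 \<le> L_H"
proof -
  define dU where "dU x = frechet_derivative U (at x)" for x
  have "U differentiable (at x)" "(\<lambda>y. frechet_derivative U (at y) u) differentiable (at x)"
    "(\<lambda>z. frechet_derivative (\<lambda>y. frechet_derivative U (at y) u) (at z) v) differentiable (at x)" for x u v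
    using C3 by (simp_all add: numeral_3_eq_3)
  note C = this[THEN frechet_derivative_works[THEN iffD1]]
  have dU: "(U has_derivative dU x) (at x)" for x
    unfolding dU_def by (rule C(1))
  have d2: "((\<lambda>y. dU y u) has_derivative D2 U x u) (at x)" for x u
    unfolding dU_def D2_def[abs_def] by (rule C(2))
  have d3: "((\<lambda>y. D2 U y u v) has_derivative D3 U x u v) (at x)" for x u v
    unfolding D3_def[abs_def] D2_def by (rule C(3))
  have dU_lin: "linear (dU x)" for x using has_derivative_linear[OF dU] .
  have rep: "dU x h = h \<bullet> (\<Sum>b\<in>Basis. dU x b *\<^sub>R b)" for x h
  proof -
    have "dU x h = dU x (\<Sum>b\<in>Basis. (h \<bullet> b) *\<^sub>R b)" by (simp add: euclidean_representation)
    also have "\<dots> = (\<Sum>b\<in>Basis. (h \<bullet> b) * dU x b)"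
      by (simp add: linear_sum[OF dU_lin] linear_scale[OF dU_lin])
    finally show ?thesis by (simp add: inner_sum_right mult.commute)
  qed
  have grad: "grad U x = (\<Sum>b\<in>Basis. dU x b *\<^sub>R b)" for x
    unfolding grad_def
  proof (rule the_equality)
    show g: "GDERIV U x :> (\<Sum>b\<in>Basis. dU x b *\<^sub>R b)"
      unfolding gderiv_def using dU[of x] by (simp add: rep[symmetric])
    fix g assume "GDERIV U x :> g"
    then have "(\<lambda>h. h \<bullet> g) = dU x" unfolding gderiv_def using dU has_derivative_unique by blast
    note eq = fun_cong[OF this]
    have "h \<bullet> g = h \<bullet> (\<Sum>b\<in>Basis. dU x b *\<^sub>R b)" for h
      using eq[of h] rep[of x h] by (rule trans)
    then show "g = (\<Sum>b\<in>Basis. dU x b *\<^sub>R b)"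
      using vector_eq_ldot[of g] by blast
  qed
  define H where "H x w = (\<Sum>b\<in>Basis. D2 U x b w *\<^sub>R b)" for x w
  have H: "(grad U has_derivative H x) (at x)" for x
    unfolding grad[abs_def] H_def[abs_def]
    by (intro has_derivative_sum has_derivative_scaleR_left d2)
  have D2: "D2 U x u w = H x w \<bullet> u" for x u w
  proof -
    have eq: "dU y u = grad U y \<bullet> u" for y using rep[of y u] by (simp add: grad inner_commute)
    have "((\<lambda>y. dU y u) has_derivative (\<lambda>w. H x w \<bullet> u)) (at x)"
      unfolding eq by (rule has_derivative_inner_left[OF H])
    from fun_cong[OF has_derivative_unique[OF d2 this]] show ?thesis .
  qed
  have H_lin: "linear (H x)" for x using has_derivative_linear[OF H] .
  have bil: "bilinear (D2 U x)" for x
    unfolding bilinear_def D2[abs_def]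
    by (auto intro!: linearI simp: inner_add_right linear_add[OF H_lin] linear_scale[OF H_lin] inner_add_left)
  have l2: "\<bar>D2 U x u w\<bar> \<le> L * norm u * norm w" for x u w
    by (rule order_trans[OF opnorm2_upper[OF bil]])
      (auto intro!: mult_right_mono cSUP_upper bdd2 simp: L)
  \<comment> \<open>The coefficients do not depend on the base point, so differentiating this
    identity carries the bilinear structure over to \<open>D3\<close>.\<close>
  have D2_rep: "D2 U y u v = (\<Sum>b\<in>Basis. \<Sum>c\<in>Basis. (u \<bullet> b) * (v \<bullet> c) * D2 U y b c)" for y u v
  proof -
    have "D2 U y u v = H y (\<Sum>c\<in>Basis. (v \<bullet> c) *\<^sub>R c) \<bullet> (\<Sum>b\<in>Basis. (u \<bullet> b) *\<^sub>R b)"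
      by (simp add: D2 euclidean_representation)
    also have "\<dots> = (\<Sum>b\<in>Basis. \<Sum>c\<in>Basis. (u \<bullet> b) * (v \<bullet> c) * D2 U y b c)"
      unfolding linear_sum[OF H_lin] linear_scale[OF H_lin] inner_sum_right inner_sum_left
      by (simp add: D2 sum_distrib_left mult_ac)
    finally show ?thesis .
  qed
  have D3_rep: "D3 U x u v w = (\<Sum>b\<in>Basis. \<Sum>c\<in>Basis. (u \<bullet> b) * (v \<bullet> c) * D3 U x b c w)" for x u v w
  proof -
    have eq: "(\<lambda>y. D2 U y u v) = (\<lambda>y. \<Sum>b\<in>Basis. \<Sum>c\<in>Basis. (u \<bullet> b) * (v \<bullet> c) * D2 U y b c)"
      by (rule ext) (rule D2_rep)
    have "((\<lambda>y. D2 U y u v) has_derivative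
       (\<lambda>w. \<Sum>b\<in>Basis. \<Sum>c\<in>Basis. (u \<bullet> b) * (v \<bullet> c) * D3 U x b c w)) (at x)"
      by (subst eq) (intro has_derivative_sum has_derivative_mult_right d3)
    from fun_cong[OF has_derivative_unique[OF d3 this]] show ?thesis .
  qed
  have l3: "\<bar>D3 U x u v w\<bar> \<le> L_H * norm u * norm v * norm w" for x u v w
  proof -
    have "\<bar>D3 U x u v w\<bar> \<le> opnorm3 (D3 U x) * norm u * norm v * norm w"
      by (rule opnorm3_upper[of "D3 U x", OF D3_rep has_derivative_bounded_linear[OF d3]])
    also have "\<dots> \<le> L_H * norm u * norm v * norm w"
      unfolding LH by (intro mult_right_mono cSUP_upper bdd3) auto
    finally show ?thesis .
  qed
  \<comment> \<open>A unit vector turns the bounds into \<open>0 \<le> L\<close> and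
    \<open>0 \<le> L_H\<close>, since absolute values are nonnegative.\<close>
  obtain e :: 'a where e: "norm e = 1" using vector_choose_size[of 1] by auto
  have L0: "0 \<le> L" using l2[of 0 e e] e by simp
  have LH0: "0 \<le> L_H" using l3[of 0 e e e] e by simp
  have h1: "norm (H x u) \<le> L * norm u" for x u
  proof (rule norm_le_of_inner_le)
    show "\<bar>H x u \<bullet> w\<bar> \<le> L * norm u * norm w" for w
      using l2[of x w u] unfolding D2 by (simp only: mult_ac)
    show "0 \<le> L * norm u" using L0 by simp
  qed
  have h2: "norm (H x u - H y u) \<le> L_H * norm (x - y) * norm u" for x y u
  proof (rule norm_le_of_inner_le)
    fix w
    have "norm (D2 U x w u - D2 U y w u) \<le> (L_H * norm w * norm u) * norm (x - y)"
    proof (rule differentiable_bound[where S = UNIV and f = "\<lambda>z. D2 U z w u" and f' = "\<lambda>z. D3 U z w u"])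
      show "onorm (D3 U z w u) \<le> L_H * norm w * norm u" for z
      proof (rule onorm_bound)
        show "norm (D3 U z w u v) \<le> L_H * norm w * norm u * norm v" for v
          unfolding real_norm_def by (rule l3)
      qed (simp add: LH0)
      show "((\<lambda>z. D2 U z w u) has_derivative D3 U z w u) (at z within UNIV)" for z by (rule d3)
    qed simp_all
    then show "\<bar>(H x u - H y u) \<bullet> w\<bar> \<le> L_H * norm (x - y) * norm u * norm w"
      unfolding D2 real_norm_def inner_diff_left by (simp only: mult_ac)
  next
    show "0 \<le> L_H * norm (x - y) * norm u" using LH0 by simp
  qed
  show thesis by (rule that[OF H h1 h2 L0 LH0])
qed

section \<open>Total variation bound\<close>

text \<open>The constants are those that \<open>L T\<^sup>2 \<le> 1/6\<close> yields in the locale \<open>path_equation\<close>.\<close>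

definition velocity_transport ::
  "real \<Rightarrow> real \<Rightarrow> ('a::real_normed_vector \<Rightarrow> 'a \<Rightarrow> 'a) \<Rightarrow> bool" where
  "velocity_transport T LH F \<longleftrightarrow>
    (\<forall>x y v w. norm (F x v - F y w) \<le> 6/5 * (norm (x - y) + T * norm (v - w))) \<and>
    (\<forall>x y. \<exists>\<Phi> A. bij \<Phi> \<and> (\<forall>v. F y (\<Phi> v) = F x v) \<and>
      (\<forall>v. (\<Phi> has_derivative (\<lambda>b. b + A v b)) (at v)) \<and>
      (\<forall>v. norm (\<Phi> v - v) \<le> 5/4 / T * norm (x - y)) \<and>
      (\<forall>v b. norm (A v b) \<le> 81/20 * T\<^sup>2 * LH * norm (x - y) * norm b))"

lemma (in path_equation) velocity_transport_endpoint: "velocity_transport T LH endpoint"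
  unfolding velocity_transport_def
proof (intro conjI allI)
  fix x y
  obtain A where "\<And>v. (coupling x y has_derivative (\<lambda>b. b + A v b)) (at v)"
    and "\<And>v b. norm (A v b) \<le> 81/20 * T\<^sup>2 * LH * norm (x - y) * norm b"
    using coupling_has_derivative[of x y] by blast
  then show "\<exists>\<Phi> A. bij \<Phi> \<and> (\<forall>v. endpoint y (\<Phi> v) = endpoint x v) \<and>
      (\<forall>v. (\<Phi> has_derivative (\<lambda>b. b + A v b)) (at v)) \<and>
      (\<forall>v. norm (\<Phi> v - v) \<le> 5/4 / T * norm (x - y)) \<and>
      (\<forall>v b. norm (A v b) \<le> 81/20 * T\<^sup>2 * LH * norm (x - y) * norm b)"
    using bij_coupling endpoint_coupling coupling_dist by blast
qed (rule endpoint_lipschitz)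

lemma verlet_pos_eq:
  assumes "\<exists>q w. verlet_solution U h x v q w"
    and "\<And>q w. verlet_solution U h x v q w \<Longrightarrow> q t = y"
  shows "verlet_pos U h t x v = y"
  unfolding verlet_pos_def using assms by (intro the_equality) blast+

lemma velocity_transport_verlet_pos:
  assumes sg: "smooth_gradient (grad U) H L LH" and T: "0 < T" and h: "0 \<le> h"
    and LT: "L * T\<^sup>2 \<le> 1/6" and Th: "0 < h \<longrightarrow> T / h \<in> \<nat>"
  shows "velocity_transport T LH (verlet_pos U h T)"
proof (cases "h = 0")
  case True
  interpret pe: path_equation "\<lambda>p. primitive T (primitive T p)" "smooth_gradient.compose_g (grad U)"
    "smooth_gradient.compose_H H" const_bcontfun "smooth_gradient.ramp (\<lambda>t. cutoff T t / T)" "\<lambda>p. p T" T L LH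
    by (rule smooth_gradient.exact_flow_path_equation[OF sg T LT])
  have "verlet_pos U h T = pe.endpoint"
    using verlet_solution_exact[OF sg T LT] verlet_solution_exact_exists[OF sg]
    unfolding True by (intro ext verlet_pos_eq)
  then show ?thesis using pe.velocity_transport_endpoint by simp
next
  case False
  then have h: "0 < h" using h by simp
  then obtain n :: nat where "T / h = real n" using Th by (auto elim: Nats_cases)
  then have Tn: "T = real n * h" using h by (simp add: field_simps)
  interpret pe: path_equation "verlet_sum h n" "smooth_gradient.compose_g (grad U)"
    "smooth_gradient.compose_H H" const_bcontfun
    "smooth_gradient.ramp (\<lambda>k. real (min (of_discrete k) n) / real n)" "\<lambda>p. p (discrete n)" T L LH
    by (rule smooth_gradient.verlet_path_equation[OF sg Tn T LT])
  have "verlet_pos U h T = pe.endpoint"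
    using verlet_solution_grid[OF sg Tn T LT h] verlet_solution_grid_exists[OF h]
    by (intro ext verlet_pos_eq)
  then show ?thesis using pe.velocity_transport_endpoint by simp
qed

lemma velocity_transport_continuous:
  fixes F :: "'a::euclidean_space \<Rightarrow> 'a \<Rightarrow> 'a"
  assumes F: "velocity_transport T LH F" and T: "0 < T"
  shows "continuous_on UNIV (\<lambda>p. F (fst p) (snd p))"
proof (rule lipschitz_on_continuous_on, rule lipschitz_onI)
  fix p r :: "'a \<times> 'a"
  have "norm (F (fst p) (snd p) - F (fst r) (snd r)) \<le> 6/5 * (norm (fst p - fst r) + T * norm (snd p - snd r))"
    using F by (auto simp: velocity_transport_def)
  also have "\<dots> \<le> 6/5 * (norm (p - r) + T * norm (p - r))"
    using T norm_fst_le[of "fst p - fst r" "snd p - snd r"] norm_snd_le[of "snd p - snd r" "fst p - fst r"]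
    by (intro mult_left_mono add_mono) (auto simp: minus_prod_def)
  finally show "dist (F (fst p) (snd p)) (F (fst r) (snd r)) \<le> 6/5 * (1 + T) * dist p r"
    by (simp add: dist_norm algebra_simps)
qed (use T in simp)

text \<open>This is the bound for two point masses, in one direction; exchanging \<open>x\<close>
  and \<open>y\<close> gives the other.\<close>

lemma gaussian_image_lipschitz:
  fixes F :: "real^'n \<Rightarrow> real^'n \<Rightarrow> real^'n"
  assumes F: "velocity_transport T LH F" and T: "0 < T" and LH: "0 \<le> LH" and A: "A \<in> sets borel"
  shows "measure std_gaussian (F x -` A) - measure std_gaussian (F y -` A)
    \<le> 3/2 * sqrt (1 / T\<^sup>2 + 27 * real CARD('n) * LH\<^sup>2 * T ^ 4) * norm (x - y)"
proof (cases "x = y")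
  case False
  define r where "r = norm (x - y)"
  have r: "0 < r" using False by (simp add: r_def)
  let ?d = "real CARD('n)"
  have d: "1 \<le> ?d" using zero_less_card_finite[where 'a = 'n] by (simp add: Suc_leI)
  define C where "C = 3/2 * sqrt (1 / T\<^sup>2 + 27 * ?d * LH\<^sup>2 * T ^ 4)"
  have C: "0 < C" using T unfolding C_def by (auto intro!: add_pos_nonneg)
  have C2: "C\<^sup>2 = 9/4 * (1 / T\<^sup>2 + 27 * ?d * LH\<^sup>2 * T ^ 4)"
    unfolding C_def using T by (simp add: power_mult_distrib power_divide)
  have meas: "F z -` A \<in> sets borel" for z
  proof -
    have "continuous_on UNIV (\<lambda>v. (\<lambda>p. F (fst p) (snd p)) (z, v))"
      by (rule continuous_on_compose2[OF velocity_transport_continuous[OF F T]]) (auto intro!: continuous_intros)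
    then have "F z \<in> borel_measurable borel" by (simp add: borel_measurable_continuous_onI)
    from measurable_sets[OF this A] show ?thesis by simp
  qed
  interpret g: prob_space "std_gaussian :: (real^'n) measure" by (rule prob_space_std_gaussian)
  show ?thesis
  proof (cases "1 \<le> C * r")
    case True
    have "measure std_gaussian (F x -` A) - measure std_gaussian (F y -` A) \<le> 1"
      using g.prob_le_1[of "F x -` A"] measure_nonneg[of std_gaussian "F y -` A"] by linarith
    then show ?thesis using True by (simp add: C_def r_def)
  next
    case False
    define a where "a = 81/20 * T\<^sup>2 * LH * r"
    have a0: "0 \<le> a" using LH r T by (simp add: a_def)
    have a2: "a\<^sup>2 = 6561/400 * (LH\<^sup>2 * T ^ 4 * r\<^sup>2)"
      by (simp add: a_def power_mult_distrib power2_eq_square power4_eq_xxxx)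
    have u0: "0 \<le> LH\<^sup>2 * T ^ 4 * r\<^sup>2" by simp
    \<comment> \<open>The smallness of \<open>a\<close> is extracted here: since
      \<open>1 \<le> d\<close>, the second term alone yields
      \<open>LH\<^sup>2 * T ^ 4 * r\<^sup>2 \<le> 4/243\<close>, so \<open>a\<^sup>2\<close> is at
      most \<open>27/100\<close>, below \<open>(3/5)\<^sup>2\<close>.\<close>
    have "(C * r)\<^sup>2 \<le> 1" using False C r by (intro power_le_one) auto
    then have "9/4 * (r\<^sup>2 / T\<^sup>2) + 243/4 * (?d * (LH\<^sup>2 * T ^ 4 * r\<^sup>2)) \<le> 1"
      by (simp add: power_mult_distrib C2 algebra_simps)
    moreover have "0 \<le> r\<^sup>2 / T\<^sup>2" by simp
    moreover have "1 * (LH\<^sup>2 * T ^ 4 * r\<^sup>2) \<le> ?d * (LH\<^sup>2 * T ^ 4 * r\<^sup>2)" by (rule mult_right_mono[OF d u0])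
    ultimately have "LH\<^sup>2 * T ^ 4 * r\<^sup>2 \<le> 4/243" by linarith
    then have "6561/400 * (LH\<^sup>2 * T ^ 4 * r\<^sup>2) \<le> 6561/400 * (4/243)" by (rule mult_left_mono) simp
    also have "\<dots> \<le> (3/5)\<^sup>2" by (simp add: power2_eq_square)
    finally have "a\<^sup>2 \<le> (3/5)\<^sup>2" unfolding a2 .
    then have a1: "a \<le> 3/5" by (rule power2_le_imp_le) simp
    obtain \<Phi> D where \<Phi>: "bij \<Phi>" "\<And>v. F y (\<Phi> v) = F x v" "\<And>v. (\<Phi> has_derivative (\<lambda>b. b + D v b)) (at v)"
      "\<And>v. norm (\<Phi> v - v) \<le> 5/4 / T * r" "\<And>v b. norm (D v b) \<le> a * norm b"
      using F[unfolded velocity_transport_def, THEN conjunct2, THEN spec[of _ x], THEN spec[of _ y]]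
      unfolding a_def r_def by blast
    \<comment> \<open>Velocities from \<open>x\<close> that reach \<open>A\<close> correspond under
      \<open>\<Phi>\<close> to velocities from \<open>y\<close> that reach \<open>A\<close>; the
      kernels are thus compared through one Gaussian set and its image.\<close>
    have im: "\<Phi> ` (F x -` A) = F y -` A"
    proof
      show "F y -` A \<subseteq> \<Phi> ` (F x -` A)"
      proof
        fix w assume "w \<in> F y -` A"
        moreover obtain v where "w = \<Phi> v" using \<Phi>(1) by (metis bij_pointE)
        ultimately show "w \<in> \<Phi> ` (F x -` A)" using \<Phi>(2) by auto
      qed
    qed (use \<Phi>(2) in auto)
    \<comment> \<open>The free parameter is set to \<open>C * r\<close>, which balances the two
      terms.\<close>
    have "measure std_gaussian (F x -` A) - measure std_gaussian (\<Phi> ` (F x -` A))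
       \<le> ((5/4 / T * r)\<^sup>2 / 2 + 5/4 * ?d * a\<^sup>2) / (C * r) + (C * r) / 2"
      by (rule gaussian_transport_bound[OF \<Phi>(3,1,4,5) a0 a1]) (use C r meas im in auto)
    \<comment> \<open>Coefficients are compared separately: \<open>25/32 \<le> 9/8\<close> for
      \<open>r\<^sup>2 / T\<^sup>2\<close> and \<open>6561/320 \<le> 243/8\<close> for the term with
      the dimension.\<close>
    also have "(5/4 / T * r)\<^sup>2 / 2 + 5/4 * ?d * a\<^sup>2 \<le> (C * r)\<^sup>2 / 2"
    proof -
      have "(5/4 / T * r)\<^sup>2 / 2 = 25/32 * (r\<^sup>2 / T\<^sup>2)" by (simp add: power_mult_distrib power_divide)
      moreover have "5/4 * ?d * a\<^sup>2 = 6561/320 * (?d * (LH\<^sup>2 * T ^ 4 * r\<^sup>2))" by (simp add: a2)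
      moreover have "(C * r)\<^sup>2 / 2 = 9/8 * (r\<^sup>2 / T\<^sup>2) + 243/8 * (?d * (LH\<^sup>2 * T ^ 4 * r\<^sup>2))"
        by (simp add: power_mult_distrib C2 algebra_simps)
      moreover have "0 \<le> ?d * (LH\<^sup>2 * T ^ 4 * r\<^sup>2)" "0 \<le> r\<^sup>2 / T\<^sup>2" using u0 by auto
      ultimately show ?thesis by linarith
    qed
    also have "(C * r)\<^sup>2 / 2 / (C * r) + (C * r) / 2 = C * r"
      using C r by (simp add: power2_eq_square)
    finally show ?thesis using C r unfolding im by (simp add: C_def r_def divide_right_mono)
  qed
qed simp

section \<open>From point masses to arbitrary initial laws\<close>

lemma uHMC_kernel:
  fixes U :: "real^'n \<Rightarrow> real"
  assumes F: "velocity_transport T LH (verlet_pos U h T)" and T: "0 < T"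
  shows "uHMC U T h \<in> borel \<rightarrow>\<^sub>M subprob_algebra borel"
    and "A \<in> sets borel \<Longrightarrow> measure (uHMC U T h x) A = measure std_gaussian (verlet_pos U h T x -` A)"
proof -
  have "(\<lambda>p. verlet_pos U h T (fst p) (snd p)) \<in> borel_measurable borel"
    by (rule borel_measurable_continuous_onI[OF velocity_transport_continuous[OF F T]])
  then have m [measurable]: "(\<lambda>(x, v). verlet_pos U h T x v) \<in> borel_measurable (borel \<Otimes>\<^sub>M borel)"
    by (simp add: borel_prod split_beta')
  have "(\<lambda>x. distr ((\<lambda>_. std_gaussian) x) borel (verlet_pos U h T x)) \<in> borel \<rightarrow>\<^sub>M subprob_algebra borel"
  proof (rule measurable_distr2)
    show "(\<lambda>(x, v). verlet_pos U h T x v) \<in> borel_measurable (borel \<Otimes>\<^sub>M std_gaussian)"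
      using m by (simp cong: measurable_cong_sets sets_pair_measure_cong)
    show "(\<lambda>_. std_gaussian) \<in> borel \<rightarrow>\<^sub>M subprob_algebra std_gaussian"
      by (intro measurable_const)
        (auto simp: space_subprob_algebra intro!: prob_space_imp_subprob_space prob_space_std_gaussian)
  qed
  then show "uHMC U T h \<in> borel \<rightarrow>\<^sub>M subprob_algebra borel" by (simp add: uHMC_def[abs_def])
  have "verlet_pos U h T x \<in> borel_measurable std_gaussian"
    using measurable_compose[OF measurable_Pair1'[of x borel borel] m] by (simp add: measurable_cong_sets[OF sets_std_gaussian refl])
  then show "A \<in> sets borel \<Longrightarrow> measure (uHMC U T h x) A = measure std_gaussian (verlet_pos U h T x -` A)"
    by (simp add: uHMC_def measure_distr)
qed

text \<open>For each set \<open>A\<close> the two masses are integrals of the same function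
  \<open>x \<mapsto> measure (\<pi> x) A\<close> against the marginals of a coupling, so the
  pointwise Lipschitz bound integrates to the cost of that coupling.\<close>

lemma TV_bind_le_W1:
  fixes \<pi> :: "'a::euclidean_space \<Rightarrow> 'b::topological_space measure"
  assumes \<pi> [measurable]: "\<pi> \<in> borel \<rightarrow>\<^sub>M subprob_algebra borel" and C: "0 < C"
    and lip: "\<And>A x y. A \<in> sets borel \<Longrightarrow> measure (\<pi> x) A - measure (\<pi> y) A \<le> C * norm (x - y)"
    and "prob_space \<mu>" "sets \<mu> = sets borel" "prob_space \<nu>" "sets \<nu> = sets borel"
  shows "ennreal (TV (\<mu> \<bind> \<pi>) (\<nu> \<bind> \<pi>)) \<le> ennreal C * W1 \<mu> \<nu>"
proof -
  let ?t = "TV (\<mu> \<bind> \<pi>) (\<nu> \<bind> \<pi>)"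
  have bind: "measure (\<rho> \<bind> \<pi>) A = (\<integral>x. measure (\<pi> x) A \<partial>\<rho>)"
    if A: "A \<in> sets borel" and \<rho>: "prob_space \<rho>" "sets \<rho> = sets borel" for A \<rho>
  proof -
    interpret prob_space \<rho> by fact
    have m: "\<pi> \<in> \<rho> \<rightarrow>\<^sub>M subprob_algebra borel" using \<pi> \<rho>(2) by (simp cong: measurable_cong_sets)
    have sp: "subprob_space (\<pi> x)" for x
      using measurable_space[OF \<pi>, of x] by (simp add: space_subprob_algebra)
    have mA: "(\<lambda>x. measure (\<pi> x) A) \<in> borel_measurable \<rho>"
      by (rule measurable_compose[OF m measurable_measure_subprob_algebra[OF A]])
    have "emeasure (\<rho> \<bind> \<pi>) A = (\<integral>\<^sup>+x. emeasure (\<pi> x) A \<partial>\<rho>)"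
      by (rule emeasure_bind[OF not_empty m A])
    also have "\<dots> = (\<integral>\<^sup>+x. ennreal (measure (\<pi> x) A) \<partial>\<rho>)"
      using sp by (intro nn_integral_cong) (simp add: finite_measure.emeasure_eq_measure subprob_space_def)
    finally show ?thesis using mA by (simp add: measure_def[of "\<rho> \<bind> \<pi>"] integral_eq_nn_integral)
  qed
  \<comment> \<open>Dividing by \<open>C\<close> first turns the claim into a lower bound for every
    coupling cost, which passes to the infimum; an infinite cost is harmless.\<close>
  have step: "ennreal (?t / C) \<le> (\<integral>\<^sup>+ p. ennreal (norm (fst p - snd p)) \<partial>\<gamma>)"
    if \<gamma>: "\<gamma> \<in> couplings \<mu> \<nu>" for \<gamma>
  proof -
    let ?I = "\<integral>\<^sup>+ p. ennreal (norm (fst p - snd p)) \<partial>\<gamma>"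
    from \<gamma> have s [measurable_cong]: "sets \<gamma> = sets (borel \<Otimes>\<^sub>M borel)" and ps: "prob_space \<gamma>"
      and d: "distr \<gamma> borel fst = \<mu>" "distr \<gamma> borel snd = \<nu>" by (auto simp: couplings_def)
    interpret g: prob_space \<gamma> by fact
    show ?thesis
    proof (cases "?I = \<top>")
      case False
      then obtain i where i: "0 \<le> i" "?I = ennreal i" by (cases ?I) auto
      have "?t \<le> C * i"
        unfolding TV_def
      proof (rule cSUP_least)
        fix A :: "'b set" assume A: "A \<in> sets borel"
        define f where "f x = measure (\<pi> x) A" for x
        have [measurable]: "f \<in> borel_measurable borel" unfolding f_def
          by (rule measurable_compose[OF \<pi> measurable_measure_subprob_algebra[OF A]])
        have fb: "norm (f x) \<le> 1" for x
        proof -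
          interpret subprob_space "\<pi> x" using measurable_space[OF \<pi>, of x] by (simp add: space_subprob_algebra)
          show ?thesis using subprob_measure_le_1 by (simp add: f_def)
        qed
        have m1 [measurable]: "(fst :: 'a \<times> 'a \<Rightarrow> 'a) \<in> \<gamma> \<rightarrow>\<^sub>M borel" "(snd :: 'a \<times> 'a \<Rightarrow> 'a) \<in> \<gamma> \<rightarrow>\<^sub>M borel"
          by measurable
        have int: "integrable \<gamma> (\<lambda>p. f (fst p))" "integrable \<gamma> (\<lambda>p. f (snd p))"
          using fb by (auto intro!: g.integrable_const_bound[where B = 1])
        have "measure (\<mu> \<bind> \<pi>) A - measure (\<nu> \<bind> \<pi>) A = (\<integral>p. f (fst p) \<partial>\<gamma>) - (\<integral>p. f (snd p) \<partial>\<gamma>)"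
          using assms(4-7) by (simp add: bind[OF A] d[symmetric] integral_distr f_def[symmetric])
        also have "\<dots> = (\<integral>p. f (fst p) - f (snd p) \<partial>\<gamma>)" using int by simp
        finally have "ennreal \<bar>measure (\<mu> \<bind> \<pi>) A - measure (\<nu> \<bind> \<pi>) A\<bar>
            \<le> (\<integral>\<^sup>+p. ennreal (norm (f (fst p) - f (snd p))) \<partial>\<gamma>)"
          using integral_norm_bound_ennreal[of \<gamma> "\<lambda>p. f (fst p) - f (snd p)"] int by simp
        also have "\<dots> \<le> (\<integral>\<^sup>+p. ennreal C * ennreal (norm (fst p - snd p)) \<partial>\<gamma>)"
        proof (rule nn_integral_mono)
          fix p :: "'a \<times> 'a"
          \<comment> \<open>The one-sided hypothesis is used for both orders of the pair to obtain
            the absolute value.\<close>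
          have "norm (f (fst p) - f (snd p)) \<le> C * norm (fst p - snd p)"
            using lip[OF A, of "fst p" "snd p"] lip[OF A, of "snd p" "fst p"]
            by (auto simp: f_def abs_le_iff norm_minus_commute)
          then show "ennreal (norm (f (fst p) - f (snd p))) \<le> ennreal C * ennreal (norm (fst p - snd p))"
            using C by (simp add: ennreal_mult[symmetric] ennreal_leI)
        qed
        also have "\<dots> = ennreal C * ennreal i" unfolding i(2)[symmetric] by (rule nn_integral_cmult) measurable
        also have "\<dots> = ennreal (C * i)" using C i by (simp add: ennreal_mult)
        finally show "\<bar>measure (\<mu> \<bind> \<pi>) A - measure (\<nu> \<bind> \<pi>) A\<bar> \<le> C * i"
          using C i by (simp add: ennreal_le_iff)
      qed auto
      then show ?thesis unfolding i(2) using C by (intro ennreal_leI) (simp add: field_simps)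
    qed simp
  qed
  have "ennreal (?t / C) \<le> W1 \<mu> \<nu>" unfolding W1_def by (rule INF_greatest[OF step])
  then have "ennreal C * ennreal (?t / C) \<le> ennreal C * W1 \<mu> \<nu>" by (rule mult_left_mono) simp
  moreover have "ennreal C * ennreal (?t / C) = ennreal ?t"
    using C by (simp add: ennreal_mult'[symmetric])
  ultimately show ?thesis by simp
qed

theorem lemma17:
  fixes U :: "real ^ 'n \<Rightarrow> real" and L L_H T h :: real
    and \<nu> \<eta> :: "(real ^ 'n) measure"
  assumes "C_k 3 U"
    and "\<And>x. U 0 \<le> U x" and "U 0 = 0"
    and "bdd_above (range (\<lambda>x. opnorm2 (D2 U x)))"
    and "L = (SUP x. opnorm2 (D2 U x))"
    and "bdd_above (range (\<lambda>x. opnorm3 (D3 U x)))"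
    and "L_H = (SUP x. opnorm3 (D3 U x))"
    and "T > 0" and "h \<ge> 0"
    and "L * (T\<^sup>2 + T * h) \<le> 1 / 6"
    and "h > 0 \<longrightarrow> T / h \<in> \<nat>"
    and "prob_space \<nu>" and "sets \<nu> = sets borel"
    and "prob_space \<eta>" and "sets \<eta> = sets borel"
  shows "ennreal (TV (\<eta> \<bind> uHMC U T h) (\<nu> \<bind> uHMC U T h)) \<le>
    ennreal (3 / 2 * sqrt (1 / T\<^sup>2 + 27 * real CARD('n) * L_H\<^sup>2 * T ^ 4)) * W1 \<eta> \<nu>"
proof -
  obtain H where H: "\<And>x. (grad U has_derivative H x) (at x)" "\<And>x u. norm (H x u) \<le> L * norm u"
    "\<And>x y u. norm (H x u - H y u) \<le> L_H * norm (x - y) * norm u" "0 \<le> L" "0 \<le> L_H"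
    using hessian_of_C3[OF assms(1,4-7)] by metis
  have sg: "smooth_gradient (grad U) H L L_H" by (rule smooth_gradient.intro[OF H])
  have "0 \<le> L * (T * h)" using H(4) assms(8,9) by simp
  then have LT: "L * T\<^sup>2 \<le> 1/6" using assms(10) by (simp add: distrib_left)
  note F = velocity_transport_verlet_pos[OF sg assms(8,9) LT assms(11)]
  show ?thesis
  proof (rule TV_bind_le_W1[OF uHMC_kernel(1)[OF F assms(8)]])
    show "0 < 3 / 2 * sqrt (1 / T\<^sup>2 + 27 * real CARD('n) * L_H\<^sup>2 * T ^ 4)"
      using assms(8) by (auto intro!: add_pos_nonneg)
    show "measure (uHMC U T h x) A - measure (uHMC U T h y) A
        \<le> 3 / 2 * sqrt (1 / T\<^sup>2 + 27 * real CARD('n) * L_H\<^sup>2 * T ^ 4) * norm (x - y)"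
      if "A \<in> sets borel" for A x y
      unfolding uHMC_kernel(2)[OF F assms(8) that]
      by (rule gaussian_image_lipschitz[OF F assms(8) H(5) that])
  qed (use assms in auto)
qed

end
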